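(* Let $x_0<x_1$ and let the entropy profile be $m(x)=m_*$ for $x<x_0$ and for $x>x_1$, and $m(x)=m$ (constant) for $x_0<x<x_1$, with $m>m_*>0$. Set $Q=(m/m_* )^{(d-1)/(d+1)}>1$ and $\eta=\frac{Q-1}{Q+1}$. Consider the global shock-free solution of the Lagrangian compressible Euler equations with rarefactive initial data prescribed on $(x_0,x_1)$ and constant data for $x\le x_0$ and $x\ge x_1$. Starting from $(x_1,0)$, follow the backward characteristic until it meets $x_0$, then the forward characteristic from that point until it meets $x_1$, and so on; let $t_0=0$, let $t_k$ be the time of the $k$-th such intersection with the boundary, and let $z_{2k}=z(x_1-,t_{2k})$, $z_{2k+1}=z(x_0+,t_{2k+1})$, $c_0=m\,z_0^d$. Suppose $\zeta:=z_1-\eta z_0=0$. Then the solution asymptotically approaches vacuum at the rate $$z_0\left(1+\frac{t_n\,c_0}{x_1-x_0}\,(\eta^{-d}-1)\right)^{-1/d}\le z_n\le z_0\left(1+\frac{t_n\,c_0}{x_1-x_0}\,(1-\eta^{d})\right)^{-1/d}$$ for all $n\ge 0$. In particular, $z\sim O(1)\,(1+t)^{-1/d}$ in the interval $[x_0,x_1]$ between the contacts (i.e. $z$ is bounded above and below by positive constants times $(1+t)^{-1/d}$), which implies $$\tau=O(1)\,(1+t)^{1-1/d},\qquad\text{or}\qquad \rho=1/\tau=O(1)\,(1+t)^{1/d-1}.$$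
   Context: Equations. Fix constants $\gamma>1$, $K>0$, $c_v>0$. The Lagrangian compressible Euler equations for a polytropic ideal gas are $$\tau_t-u_x=0,\quad u_t+p_x=0,\quad (\tfrac12u^2+e)_t+(up)_x=0,$$ for $x\in\mathbb R$, $t\ge0$, with specific volume $\tau>0$, velocity $u$, pressure $p=Ke^{S/c_v}\tau^{-\gamma}$, entropy $S$, and $e=p\tau/(\gamma-1)$. For smooth solutions the third equation is equivalent to $S_t=0$. Set $d=\frac{\gamma+1}{\gamma-1}$, $C_z=(d-1)^{1/(1-d)}$, $C_m=\sqrt{K\gamma}\,C_z^{-d}$, and $m=C_me^{S/2c_v}$ (the entropy variable), $z=C_z\tau^{-(\gamma-1)/2}$. Then the Lagrangian sound speed is $c=\sqrt{-p_\tau}=mz^d$, $p=\frac{m^2z^{1+d}}{d+1}$, $\tau=\frac{z^{1-d}}{d-1}$; the vacuum is $z=0$. Global shock-free solution (piecewise constant entropy): a solution for all $t\ge0$ with $z>0$, time-independent entropy $m(x)$, with $u,p$ continuous on $\mathbb R\times[0,\infty)$ and $C^2$ up to the boundary on each closed strip between consecutive jump points of $m$, where the equations hold classically. Initial data: $u_0,p_0\in C^2(\mathbb R)$, $p_0>0$, constant on $(-\infty,x_0]$ and on $[x_1,\infty)$. Rarefactive means nowhere compressive and not identically constant, where nowhere compressive means $\alpha\ge0$ and $\beta\ge0$ everywhere at $t=0$, with $\alpha=u_x+p_x/c$, $\beta=u_x-p_x/c$. A forward (resp. backward) characteristic is a curve $x(t)$ with $dx/dt=c$ (resp. $-c$).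 *)

theory Defs
  imports "HOL-Analysis.Analysis"
begin

subsection \<open>Polytropic ideal gas\<close>

definition gas_d :: "real \<Rightarrow> real" where
  "gas_d \<gamma> = (\<gamma> + 1) / (\<gamma> - 1)"

definition gas_Cz :: "real \<Rightarrow> real" where
  "gas_Cz \<gamma> = (gas_d \<gamma> - 1) powr (1 / (1 - gas_d \<gamma>))"

definition gas_Cm :: "real \<Rightarrow> real \<Rightarrow> real" where
  "gas_Cm \<gamma> K = sqrt (K * \<gamma>) * gas_Cz \<gamma> powr (- gas_d \<gamma>)"

definition pressure :: "real \<Rightarrow> real \<Rightarrow> real \<Rightarrow> real \<Rightarrow> real \<Rightarrow> real" where
  "pressure \<gamma> K cv v s = K * exp (s / cv) * v powr (- \<gamma>)"

definition internal_energy :: "real \<Rightarrow> real \<Rightarrow> real \<Rightarrow> real \<Rightarrow> real \<Rightarrow> real" where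
  "internal_energy \<gamma> K cv v s = pressure \<gamma> K cv v s * v / (\<gamma> - 1)"

definition sound_speed :: "real \<Rightarrow> real \<Rightarrow> real \<Rightarrow> real \<Rightarrow> real \<Rightarrow> real" where
  "sound_speed \<gamma> K cv v s = sqrt (- deriv (\<lambda>w. pressure \<gamma> K cv w s) v)"

definition entropy_var :: "real \<Rightarrow> real \<Rightarrow> real \<Rightarrow> real \<Rightarrow> real" where
  "entropy_var \<gamma> K cv s = gas_Cm \<gamma> K * exp (s / (2 * cv))"

definition z_var :: "real \<Rightarrow> real \<Rightarrow> real" where
  "z_var \<gamma> v = gas_Cz \<gamma> * v powr (- (\<gamma> - 1) / 2)"

text \<open>The relations \<open>c = m z\<^sup>d\<close>, \<open>p = m\<^sup>2 z\<^sup>1\<^sup>+\<^sup>d / (d + 1)\<close> and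
  \<open>\<tau> = z\<^sup>1\<^sup>-\<^sup>d / (d - 1)\<close> between the variables defined above.\<close>

lemma gas_d_gt_1: "\<gamma> > 1 \<Longrightarrow> gas_d \<gamma> > 1"
  by (simp add: gas_d_def field_simps)

lemma gas_Cz_pos: "\<gamma> > 1 \<Longrightarrow> gas_Cz \<gamma> > 0"
  using gas_d_gt_1[of \<gamma>] by (simp add: gas_Cz_def)

lemma gas_Cz_powr: "\<gamma> > 1 \<Longrightarrow> gas_Cz \<gamma> powr (1 - gas_d \<gamma>) = gas_d \<gamma> - 1"
  using gas_d_gt_1[of \<gamma>] by (simp add: gas_Cz_def powr_powr)

lemma z_var_powr:
  assumes "\<gamma> > 1" "v > 0"
  shows "z_var \<gamma> v powr a = gas_Cz \<gamma> powr a * v powr (- (\<gamma> - 1) / 2 * a)"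
  using assms gas_Cz_pos[of \<gamma>] by (simp add: z_var_def powr_mult powr_powr)

lemma tau_eq_z_var:
  assumes "\<gamma> > 1" "v > 0"
  shows "v = z_var \<gamma> v powr (1 - gas_d \<gamma>) / (gas_d \<gamma> - 1)"
proof -
  have e: "- (\<gamma> - 1) / 2 * (1 - gas_d \<gamma>) = 1"
    using assms by (simp add: gas_d_def field_simps)
  show ?thesis
    using assms gas_d_gt_1[of \<gamma>] unfolding z_var_powr[OF assms] e gas_Cz_powr[OF assms(1)]
    by simp
qed

lemma sound_speed_eq:
  assumes "\<gamma> > 1" "K > 0" "v > 0"
  shows "sound_speed \<gamma> K cv v s = entropy_var \<gamma> K cv s * z_var \<gamma> v powr gas_d \<gamma>"
proof -
  have "((\<lambda>w. pressure \<gamma> K cv w s) has_real_derivative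
          K * exp (s / cv) * (- \<gamma> * v powr (- \<gamma> - 1))) (at v)"
    unfolding pressure_def using assms(3) by (auto intro!: derivative_eq_intros)
  then have "deriv (\<lambda>w. pressure \<gamma> K cv w s) v = K * exp (s / cv) * (- \<gamma> * v powr (- \<gamma> - 1))"
    by (rule DERIV_imp_deriv)
  moreover have "exp (s / cv) = (exp (s / (2 * cv)))\<^sup>2"
    by (simp flip: exp_double)
  moreover have "v powr (- \<gamma> - 1) = (v powr (- (\<gamma> + 1) / 2))\<^sup>2"
    using assms(3) by (simp add: power2_eq_square flip: powr_add)
  ultimately have "sound_speed \<gamma> K cv v s =
      sqrt ((K * \<gamma>) * (exp (s / (2 * cv)) * v powr (- (\<gamma> + 1) / 2))\<^sup>2)"
    by (simp add: sound_speed_def power_mult_distrib algebra_simps)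
  also have "\<dots> = sqrt (K * \<gamma>) * (exp (s / (2 * cv)) * v powr (- (\<gamma> + 1) / 2))"
    by (simp add: real_sqrt_mult)
  also have "- (\<gamma> + 1) / 2 = - (\<gamma> - 1) / 2 * gas_d \<gamma>"
    using assms(1) by (simp add: gas_d_def field_simps)
  finally show ?thesis
    using gas_Cz_pos[OF assms(1)] unfolding z_var_powr[OF assms(1,3)] entropy_var_def gas_Cm_def
    by (simp add: powr_minus field_simps)
qed

lemma pressure_eq:
  assumes "\<gamma> > 1" "K > 0" "v > 0"
  shows "pressure \<gamma> K cv v s =
    (entropy_var \<gamma> K cv s)\<^sup>2 * z_var \<gamma> v powr (1 + gas_d \<gamma>) / (gas_d \<gamma> + 1)"
proof -
  let ?d = "gas_d \<gamma>"
  have e: "- (\<gamma> - 1) / 2 * (1 + ?d) = - \<gamma>"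
    using assms by (simp add: gas_d_def field_simps)
  have ex: "(exp (s / (2 * cv)))\<^sup>2 = exp (s / cv)"
    by (simp flip: exp_double)
  have "(gas_Cz \<gamma> powr (- ?d))\<^sup>2 * gas_Cz \<gamma> powr (1 + ?d) = gas_Cz \<gamma> powr (1 - ?d)"
    using gas_Cz_pos[OF assms(1)] by (simp add: power2_eq_square flip: powr_add)
  then have "(gas_Cm \<gamma> K)\<^sup>2 * gas_Cz \<gamma> powr (1 + ?d) = K * \<gamma> * (?d - 1)"
    using assms gas_Cz_powr[OF assms(1)] by (simp add: gas_Cm_def power_mult_distrib)
  moreover have "\<gamma> * (?d - 1) = ?d + 1"
    using assms(1) by (simp add: gas_d_def field_simps)
  ultimately have c: "(gas_Cm \<gamma> K)\<^sup>2 * gas_Cz \<gamma> powr (1 + ?d) = K * (?d + 1)"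
    by (metis mult.assoc)
  have "(entropy_var \<gamma> K cv s)\<^sup>2 * z_var \<gamma> v powr (1 + ?d)
      = ((gas_Cm \<gamma> K)\<^sup>2 * gas_Cz \<gamma> powr (1 + ?d)) * (exp (s / cv) * v powr (- \<gamma>))"
    unfolding z_var_powr[OF assms(1,3)] e entropy_var_def power_mult_distrib ex
    by (simp only: mult_ac)
  then show ?thesis
    using gas_d_gt_1[OF assms(1)] unfolding c by (simp add: pressure_def)
qed


subsection \<open>Smoothness\<close>

definition C2_real :: "(real \<Rightarrow> real) \<Rightarrow> bool" where
  "C2_real f \<longleftrightarrow> (\<exists>f' f''. (\<forall>x. (f has_real_derivative f' x) (at x)) \<and>
     (\<forall>x. (f' has_real_derivative f'' x) (at x)) \<and> continuous_on UNIV f'')"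

definition has_partials_on ::
  "(real \<Rightarrow> real \<Rightarrow> real) \<Rightarrow> (real \<Rightarrow> real \<Rightarrow> real) \<Rightarrow> (real \<Rightarrow> real \<Rightarrow> real) \<Rightarrow> (real \<times> real) set \<Rightarrow> bool"
where
  "has_partials_on f fx ft A \<longleftrightarrow> (\<forall>(x, t)\<in>A.
     ((\<lambda>(x, t). f x t) has_derivative (\<lambda>(h, k). fx x t * h + ft x t * k)) (at (x, t) within A))"

text \<open>Derivatives are taken within \<open>A\<close>.  For \<open>A\<close> convex with nonempty interior (the only case
  used) this says that \<open>f\<close> is twice continuously differentiable in the interior and that all
  derivatives of order at most two extend continuously to \<open>A\<close>.\<close>

definition C2_on :: "(real \<Rightarrow> real \<Rightarrow> real) \<Rightarrow> (real \<times> real) set \<Rightarrow> bool" where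
  "C2_on f A \<longleftrightarrow> (\<exists>fx ft fxx fxt ftx ftt.
     has_partials_on f fx ft A \<and> has_partials_on fx fxx fxt A \<and> has_partials_on ft ftx ftt A \<and>
     continuous_on A (\<lambda>(x, t). fxx x t) \<and> continuous_on A (\<lambda>(x, t). fxt x t) \<and>
     continuous_on A (\<lambda>(x, t). ftx x t) \<and> continuous_on A (\<lambda>(x, t). ftt x t))"


subsection \<open>Global shock-free solutions\<close>

text \<open>A state consists of the specific volume \<open>\<tau> x t\<close>, the velocity \<open>u x t\<close> and the
  time-independent entropy \<open>S x\<close>.\<close>

definition p_field where
  "p_field \<gamma> K cv \<tau> S x t = pressure \<gamma> K cv (\<tau> x t) (S x)"
  for \<tau> :: "real \<Rightarrow> real \<Rightarrow> real" and S :: "real \<Rightarrow> real"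

definition e_field where
  "e_field \<gamma> K cv \<tau> S x t = internal_energy \<gamma> K cv (\<tau> x t) (S x)"
  for \<tau> :: "real \<Rightarrow> real \<Rightarrow> real" and S :: "real \<Rightarrow> real"

definition c_field where
  "c_field \<gamma> K cv \<tau> S x t = sound_speed \<gamma> K cv (\<tau> x t) (S x)"
  for \<tau> :: "real \<Rightarrow> real \<Rightarrow> real" and S :: "real \<Rightarrow> real"

definition z_field where
  "z_field \<gamma> \<tau> x t = z_var \<gamma> (\<tau> x t)"
  for \<tau> :: "real \<Rightarrow> real \<Rightarrow> real"

definition m_field where
  "m_field \<gamma> K cv S x = entropy_var \<gamma> K cv (S x)"
  for S :: "real \<Rightarrow> real"

text \<open>The three conservation laws at \<open>(x, t)\<close>; at \<open>t = 0\<close> the time derivatives are one-sided.\<close>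

definition euler_at ::
  "real \<Rightarrow> real \<Rightarrow> real \<Rightarrow> (real \<Rightarrow> real \<Rightarrow> real) \<Rightarrow> (real \<Rightarrow> real \<Rightarrow> real) \<Rightarrow> (real \<Rightarrow> real) \<Rightarrow>
   real \<Rightarrow> real \<Rightarrow> bool"
where
  "euler_at \<gamma> K cv \<tau> u S x t \<longleftrightarrow> (\<exists>ux px upx.
     ((\<lambda>y. u y t) has_real_derivative ux) (at x) \<and>
     ((\<lambda>y. p_field \<gamma> K cv \<tau> S y t) has_real_derivative px) (at x) \<and>
     ((\<lambda>y. u y t * p_field \<gamma> K cv \<tau> S y t) has_real_derivative upx) (at x) \<and>
     ((\<lambda>s. \<tau> x s) has_real_derivative ux) (at t within {0..}) \<and>
     ((\<lambda>s. u x s) has_real_derivative - px) (at t within {0..}) \<and>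
     ((\<lambda>s. (u x s)\<^sup>2 / 2 + e_field \<gamma> K cv \<tau> S x s) has_real_derivative - upx) (at t within {0..}))"

definition jumps :: "(real \<Rightarrow> real) \<Rightarrow> real set" where
  "jumps f = {x. \<not> isCont f x}"

text \<open>The values of \<open>S\<close>, and hence of \<open>\<tau>\<close>, at the jump points themselves are immaterial: only
  \<open>u\<close> and \<open>p\<close> are continuous there.  Positivity of \<open>\<tau>\<close> is the condition \<open>z > 0\<close>.\<close>

definition global_shock_free ::
  "real \<Rightarrow> real \<Rightarrow> real \<Rightarrow> (real \<Rightarrow> real \<Rightarrow> real) \<Rightarrow> (real \<Rightarrow> real \<Rightarrow> real) \<Rightarrow> (real \<Rightarrow> real) \<Rightarrow> bool"
where
  "global_shock_free \<gamma> K cv \<tau> u S \<longleftrightarrow>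
     finite (jumps S) \<and>
     (\<forall>I\<in>components (- jumps S). S constant_on I) \<and>
     (\<forall>x. \<forall>t\<ge>0. \<tau> x t > 0) \<and>
     continuous_on (UNIV \<times> {0..}) (\<lambda>(x, t). u x t) \<and>
     continuous_on (UNIV \<times> {0..}) (\<lambda>(x, t). p_field \<gamma> K cv \<tau> S x t) \<and>
     (\<forall>I\<in>components (- jumps S).
        C2_on u (closure I \<times> {0..}) \<and> C2_on (p_field \<gamma> K cv \<tau> S) (closure I \<times> {0..})) \<and>
     (\<forall>x\<in>- jumps S. \<forall>t\<ge>0. euler_at \<gamma> K cv \<tau> u S x t)"


subsection \<open>Initial data\<close>

definition admissible_data ::
  "real \<Rightarrow> real \<Rightarrow> (real \<Rightarrow> real) \<Rightarrow> (real \<Rightarrow> real) \<Rightarrow> bool"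
where
  "admissible_data x0 x1 u0 p0 \<longleftrightarrow>
     C2_real u0 \<and> C2_real p0 \<and> (\<forall>x. p0 x > 0) \<and>
     u0 constant_on {..x0} \<and> p0 constant_on {..x0} \<and>
     u0 constant_on {x1..} \<and> p0 constant_on {x1..}"

definition alpha_field where
  "alpha_field \<gamma> K cv \<tau> u S x t =
     deriv (\<lambda>y. u y t) x + deriv (\<lambda>y. p_field \<gamma> K cv \<tau> S y t) x / c_field \<gamma> K cv \<tau> S x t"
  for \<tau> u :: "real \<Rightarrow> real \<Rightarrow> real" and S :: "real \<Rightarrow> real"

definition beta_field where
  "beta_field \<gamma> K cv \<tau> u S x t =
     deriv (\<lambda>y. u y t) x - deriv (\<lambda>y. p_field \<gamma> K cv \<tau> S y t) x / c_field \<gamma> K cv \<tau> S x t"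
  for \<tau> u :: "real \<Rightarrow> real \<Rightarrow> real" and S :: "real \<Rightarrow> real"

definition rarefactive where
  "rarefactive \<gamma> K cv \<tau> u S \<longleftrightarrow>
     (\<forall>x. alpha_field \<gamma> K cv \<tau> u S x 0 \<ge> 0 \<and> beta_field \<gamma> K cv \<tau> u S x 0 \<ge> 0) \<and>
     \<not> ((\<lambda>x. u x 0) constant_on UNIV \<and> (\<lambda>x. p_field \<gamma> K cv \<tau> S x 0) constant_on UNIV)"
  for \<tau> u :: "real \<Rightarrow> real \<Rightarrow> real" and S :: "real \<Rightarrow> real"


subsection \<open>Characteristics bouncing between two contacts\<close>

text \<open>\<open>\<sigma> = 1\<close>: forward characteristic, \<open>\<sigma> = -1\<close>: backward characteristic, running from \<open>y0\<close> at
  time \<open>a\<close> to its first meeting with \<open>y1\<close> at time \<open>b\<close>.  The differential equation is imposed at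
  times strictly between \<open>a\<close> and \<open>b\<close>, when the curve is in the open interval between \<open>y0\<close> and
  \<open>y1\<close>, because at the endpoints the sound speed may be discontinuous in \<open>x\<close>.\<close>

definition crossing ::
  "(real \<Rightarrow> real \<Rightarrow> real) \<Rightarrow> real \<Rightarrow> real \<Rightarrow> real \<Rightarrow> real \<Rightarrow> real \<Rightarrow> bool"
where
  "crossing c \<sigma> y0 y1 a b \<longleftrightarrow> a < b \<and> (\<exists>X.
     continuous_on {a..b} X \<and> X a = y0 \<and> X b = y1 \<and>
     (\<forall>t\<in>{a<..<b}. min y0 y1 < X t \<and> X t < max y0 y1 \<and>
        (X has_real_derivative \<sigma> * c (X t) t) (at t)))"

text \<open>\<open>bounce_time c x0 x1 k t\<close>: the \<open>k\<close>-th intersection with the boundary of the path started at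
  \<open>(x1, 0)\<close> exists and takes place at time \<open>t\<close>.\<close>

inductive bounce_time :: "(real \<Rightarrow> real \<Rightarrow> real) \<Rightarrow> real \<Rightarrow> real \<Rightarrow> nat \<Rightarrow> real \<Rightarrow> bool"
  for c :: "real \<Rightarrow> real \<Rightarrow> real" and x0 x1 :: real
where
  start: "bounce_time c x0 x1 0 0"
| backward: "bounce_time c x0 x1 k a \<Longrightarrow> even k \<Longrightarrow> crossing c (- 1) x1 x0 a b \<Longrightarrow>
    bounce_time c x0 x1 (Suc k) b"
| forward: "bounce_time c x0 x1 k a \<Longrightarrow> odd k \<Longrightarrow> crossing c 1 x0 x1 a b \<Longrightarrow>
    bounce_time c x0 x1 (Suc k) b"

text \<open>The trace of \<open>z\<close> from inside \<open>(x0, x1)\<close> at the end where the \<open>k\<close>-th intersection takes place.\<close>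

definition inner_trace :: "(real \<Rightarrow> real \<Rightarrow> real) \<Rightarrow> real \<Rightarrow> real \<Rightarrow> nat \<Rightarrow> real \<Rightarrow> real" where
  "inner_trace z x0 x1 k t =
     (if even k then Lim (at_left x1) (\<lambda>x. z x t) else Lim (at_right x0) (\<lambda>x. z x t))"

end

theory Submission imports Defs begin

text \<open>
  In terms of \<open>z\<close> the Riemann invariants \<open>r = u + m z\<close> and \<open>s = u - m z\<close> are transported along forward
  and backward characteristics.  The data are constant outside \<open>[x\<^sub>0, x\<^sub>1]\<close>, so the invariant entering
  through each contact from outside is a constant for all times, \<open>A\<close> at \<open>x\<^sub>0\<close> and \<open>B\<close> at \<open>x\<^sub>1\<close>.
  Continuity of \<open>u\<close> and \<open>p\<close> then gives the reflection conditions \<open>r - A = - \<eta> (s - A)\<close> at \<open>x\<^sub>0\<close> and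
  \<open>s - B = - \<eta> (r - B)\<close> at \<open>x\<^sub>1\<close>, and \<open>\<zeta> = 0\<close> says exactly \<open>A = B\<close>.  Hence every leg of the bouncing
  characteristic multiplies \<open>z\<close> by \<open>\<eta>\<close>.

  The gradients \<open>\<alpha> = r\<^sub>x\<close> and \<open>\<beta> = s\<^sub>x\<close> satisfy linear transport equations and reflect with factor
  \<open>\<eta>\<close>, so they stay nonnegative; therefore \<open>z\<close> decreases along characteristics, the traversal time of
  a leg lies between the ones for its initial and final sound speed, and the \<open>t\<^sub>n\<close> are bounded by
  geometric sums.  Monotonicity of \<open>r\<close> and \<open>s\<close> in \<open>x\<close> bounds \<open>z\<close> in the strip by its two traces.

  The sign and constancy statements are proved without characteristics: at a first point where a
  strict version of the claim fails, a small step backward in the characteristic direction gives an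
  earlier failure.
\<close>

subsection \<open>Partial derivatives on closed regions\<close>

text \<open>\<open>z\<close> and \<open>\<tau>\<close> jump at the contacts, while \<open>p\<close>
  is continuous there and \<open>C2_on\<close> each closed strip. Hence everything is computed from
  the pressure: \<open>z_of_p\<close> recovers \<open>z\<close> from \<open>p\<close> and an entropy
  value, each side of a contact has its own \<open>z\<close> for the common pressure, and comparing
  the two sides produces \<open>Q\<close> and \<open>\<eta>\<close>.

  The coefficient \<open>- \<eta>\<close> for the invariants becomes \<open>+ \<eta>\<close> for
  their gradients, because the time derivatives of \<open>r\<close> and \<open>s\<close> at a fixed
  point are \<open>- c * \<alpha>\<close> and \<open>c * \<beta>\<close>. This sign is what
  preserves rarefaction.

  A leg from \<open>y0\<close> to \<open>y1\<close> satisfies \<open>z y1 b - \<eta> * z y0 a = (A -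
  B) * ((1 + \<eta>) / (2 * m))\<close>. The right side does not depend on the leg, so one vanishing
  defect settles all of them. Since the sound speed scales like \<open>z powr d\<close>, the bounce
  times grow geometrically with ratio \<open>\<eta> powr (- d)\<close>, and inverting this gives the
  exponent \<open>- 1 / d\<close>.

  The bouncing path samples one contact at a time, whereas a bound inside the strip needs both
  traces at the same time; the gap is filled by showing that each trace decreases in time.\<close>

lemma has_partials_onD:
  "has_partials_on f fx ft A \<Longrightarrow> (x, t) \<in> A \<Longrightarrow>
    ((\<lambda>q. f (fst q) (snd q)) has_derivative (\<lambda>q. fx x t * fst q + ft x t * snd q))
      (at (x, t) within A)"
  by (auto simp: has_partials_on_def case_prod_unfold)

lemma has_partials_onI:
  "(\<And>x t. (x, t) \<in> A \<Longrightarrow>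
    ((\<lambda>q. f (fst q) (snd q)) has_derivative (\<lambda>q. fx x t * fst q + ft x t * snd q))
      (at (x, t) within A)) \<Longrightarrow> has_partials_on f fx ft A"
  by (auto simp: has_partials_on_def case_prod_unfold)

text \<open>Derivatives within \<open>S\<close> admit curves that run along the edge of
  \<open>A\<close> and one-sided derivatives at their ends; the partials on \<open>A\<close> are
  restricted to the image of the curve before composing.\<close>

lemma has_partials_on_chain:
  assumes f: "has_partials_on f fx ft A"
    and X: "(X has_real_derivative v) (at s within S)"
    and T: "(T has_real_derivative w) (at s within S)"
    and A: "\<And>h. h \<in> S \<Longrightarrow> (X h, T h) \<in> A" and s: "s \<in> S"
  shows "((\<lambda>h. f (X h) (T h)) has_real_derivative fx (X s) (T s) * v + ft (X s) (T s) * w)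
    (at s within S)"
proof -
  have "((\<lambda>h. (X h, T h)) has_derivative (\<lambda>h. (v * h, w * h))) (at s within S)"
    using X T by (auto intro!: has_derivative_Pair simp: has_field_derivative_def)
  moreover have "((\<lambda>q. f (fst q) (snd q)) has_derivative
      (\<lambda>q. fx (X s) (T s) * fst q + ft (X s) (T s) * snd q))
      (at (X s, T s) within (\<lambda>h. (X h, T h)) ` S)"
    by (rule has_derivative_subset[OF has_partials_onD[OF f]]) (use A s in auto)
  ultimately have "((\<lambda>h. f (fst (X h, T h)) (snd (X h, T h))) has_derivative
      (\<lambda>h. fx (X s) (T s) * fst (v * h, w * h) + ft (X s) (T s) * snd (v * h, w * h)))
      (at s within S)"
    by (rule has_derivative_in_compose)
  moreover have "(\<lambda>h. fx (X s) (T s) * fst (v * h, w * h) + ft (X s) (T s) * snd (v * h, w * h))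
      = (*) (fx (X s) (T s) * v + ft (X s) (T s) * w)"
    by (auto simp: algebra_simps)
  ultimately show ?thesis
    by (simp add: has_field_derivative_def)
qed

lemma has_partials_on_continuous:
  assumes "has_partials_on f fx ft A"
  shows "continuous_on A (\<lambda>(x, t). f x t)"
proof -
  have "continuous (at (x, t) within A) (\<lambda>q. f (fst q) (snd q))" if "(x, t) \<in> A" for x t
    using has_partials_onD[OF assms that] by (rule has_derivative_continuous)
  then show ?thesis
    by (auto simp: continuous_on_eq_continuous_within case_prod_unfold)
qed

lemma has_partials_on_x:
  assumes "has_partials_on f fx ft A" "\<And>y. y \<in> S \<Longrightarrow> (y, t) \<in> A" "x \<in> S"
  shows "((\<lambda>y. f y t) has_real_derivative fx x t) (at x within S)"
  using has_partials_on_chain[OF assms(1), of "\<lambda>y. y" 1 x S "\<lambda>_. t" 0] assms by auto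

lemma has_partials_on_t:
  assumes "has_partials_on f fx ft A" "\<And>y. y \<in> S \<Longrightarrow> (x, y) \<in> A" "t \<in> S"
  shows "((\<lambda>y. f x y) has_real_derivative ft x t) (at t within S)"
  using has_partials_on_chain[OF assms(1), of "\<lambda>_. x" 0 t S "\<lambda>y. y" 1] assms by auto

lemma has_partials_on_subset:
  "has_partials_on f fx ft A \<Longrightarrow> B \<subseteq> A \<Longrightarrow> has_partials_on f fx ft B"
  unfolding has_partials_on_def by (blast intro: has_derivative_subset)

lemma has_partials_on_cong:
  assumes "has_partials_on f fx ft A"
    "\<And>x t. (x, t) \<in> A \<Longrightarrow> f x t = g x t"
    "\<And>x t. (x, t) \<in> A \<Longrightarrow> fx x t = gx x t" "\<And>x t. (x, t) \<in> A \<Longrightarrow> ft x t = gt x t"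
  shows "has_partials_on g gx gt A"
  unfolding has_partials_on_def
proof safe
  fix x t assume xt: "(x, t) \<in> A"
  have "((\<lambda>(x, t). f x t) has_derivative (\<lambda>(h, k). fx x t * h + ft x t * k)) (at (x, t) within A)"
    using assms(1) xt unfolding has_partials_on_def by blast
  then have "((\<lambda>(x, t). f x t) has_derivative (\<lambda>(h, k). gx x t * h + gt x t * k)) (at (x, t) within A)"
    using assms(3,4) xt by simp
  then show "((\<lambda>(x, t). g x t) has_derivative (\<lambda>(h, k). gx x t * h + gt x t * k)) (at (x, t) within A)"
    by (rule has_derivative_transform[rotated 2]) (use xt assms(2) in auto)
qed

lemma has_partials_on_lincomb:
  assumes f: "has_partials_on f fx ft A" and g: "has_partials_on g gx gt A"
  shows "has_partials_on (\<lambda>x t. a * f x t + b * g x t) (\<lambda>x t. a * fx x t + b * gx x t)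
    (\<lambda>x t. a * ft x t + b * gt x t) A"
  by (rule has_partials_onI)
    (auto intro!: derivative_eq_intros has_partials_onD[OF f] has_partials_onD[OF g]
      simp: algebra_simps)

lemma has_partials_on_mult:
  assumes f: "has_partials_on f fx ft A" and g: "has_partials_on g gx gt A"
  shows "has_partials_on (\<lambda>x t. f x t * g x t) (\<lambda>x t. f x t * gx x t + fx x t * g x t)
    (\<lambda>x t. f x t * gt x t + ft x t * g x t) A"
  by (rule has_partials_onI)
    (auto intro!: has_derivative_eq_rhs[OF has_derivative_mult] has_partials_onD[OF f]
      has_partials_onD[OF g] simp: algebra_simps)

lemma has_partials_on_compose:
  assumes f: "has_partials_on f fx ft A"
    and g: "\<And>x t. (x, t) \<in> A \<Longrightarrow> (g has_real_derivative g' (f x t)) (at (f x t))"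
  shows "has_partials_on (\<lambda>x t. g (f x t)) (\<lambda>x t. g' (f x t) * fx x t)
    (\<lambda>x t. g' (f x t) * ft x t) A"
proof (rule has_partials_onI)
  fix x t assume xt: "(x, t) \<in> A"
  have "((\<lambda>q. g (f (fst q) (snd q))) has_derivative
      (\<lambda>q. g' (f x t) * (fx x t * fst q + ft x t * snd q))) (at (x, t) within A)"
    by (rule has_derivative_compose[OF has_partials_onD[OF f xt]])
      (use g[OF xt] in \<open>simp add: has_field_derivative_def\<close>)
  then show "((\<lambda>q. g (f (fst q) (snd q))) has_derivative
      (\<lambda>q. g' (f x t) * fx x t * fst q + g' (f x t) * ft x t * snd q)) (at (x, t) within A)"
    by (simp add: algebra_simps)
qed

lemma C2_on_lincomb:
  assumes "C2_on f A" "C2_on g A"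
  shows "C2_on (\<lambda>x t. a * f x t + b * g x t) A"
proof -
  obtain fx ft fxx fxt ftx ftt where f: "has_partials_on f fx ft A" "has_partials_on fx fxx fxt A"
    "has_partials_on ft ftx ftt A" "continuous_on A (\<lambda>(x, t). fxx x t)"
    "continuous_on A (\<lambda>(x, t). fxt x t)" "continuous_on A (\<lambda>(x, t). ftx x t)"
    "continuous_on A (\<lambda>(x, t). ftt x t)"
    using assms(1) unfolding C2_on_def by blast
  obtain gx gt gxx gxt gtx gtt where g: "has_partials_on g gx gt A" "has_partials_on gx gxx gxt A"
    "has_partials_on gt gtx gtt A" "continuous_on A (\<lambda>(x, t). gxx x t)"
    "continuous_on A (\<lambda>(x, t). gxt x t)" "continuous_on A (\<lambda>(x, t). gtx x t)"
    "continuous_on A (\<lambda>(x, t). gtt x t)"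
    using assms(2) unfolding C2_on_def by blast
  show ?thesis
    unfolding C2_on_def
    by (intro exI conjI, rule has_partials_on_lincomb[OF f(1) g(1)],
        rule has_partials_on_lincomb[OF f(2) g(2)], rule has_partials_on_lincomb[OF f(3) g(3)])
      (use f(4-7) g(4-7) in \<open>auto simp: case_prod_unfold intro!: continuous_intros\<close>)
qed

lemma C2_on_compose:
  assumes "C2_on f A"
    and g: "\<And>x t. (x, t) \<in> A \<Longrightarrow> (g has_real_derivative g' (f x t)) (at (f x t))"
    and g': "\<And>x t. (x, t) \<in> A \<Longrightarrow> (g' has_real_derivative g'' (f x t)) (at (f x t))"
    and g'': "continuous_on ((\<lambda>(x, t). f x t) ` A) g''"
  shows "C2_on (\<lambda>x t. g (f x t)) A"
proof -
  obtain fx ft fxx fxt ftx ftt where f: "has_partials_on f fx ft A" "has_partials_on fx fxx fxt A"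
    "has_partials_on ft ftx ftt A" "continuous_on A (\<lambda>(x, t). fxx x t)"
    "continuous_on A (\<lambda>(x, t). fxt x t)" "continuous_on A (\<lambda>(x, t). ftx x t)"
    "continuous_on A (\<lambda>(x, t). ftt x t)"
    using assms(1) unfolding C2_on_def by blast
  have 1: "has_partials_on (\<lambda>x t. g' (f x t)) (\<lambda>x t. g'' (f x t) * fx x t)
    (\<lambda>x t. g'' (f x t) * ft x t) A"
    by (rule has_partials_on_compose[OF f(1) g'])
  note cont = f(4-7) has_partials_on_continuous[OF 1] has_partials_on_continuous[OF f(2)]
    has_partials_on_continuous[OF f(3)]
    continuous_on_compose2[OF g'' has_partials_on_continuous[OF f(1)] order.refl]
  show ?thesis
    unfolding C2_on_def
    by (intro exI conjI, rule has_partials_on_compose[OF f(1) g], assumption,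
        rule has_partials_on_mult[OF 1 f(2)], rule has_partials_on_mult[OF 1 f(3)])
      (use cont in \<open>auto simp: case_prod_unfold intro!: continuous_intros\<close>)
qed

text \<open>The mean value theorem is applied in the first variable to the increment in the second,
  and then in the second variable to \<open>fx\<close>. With the variables exchanged, the same
  second difference yields the other mixed derivative.\<close>

lemma second_difference:
  fixes f :: "real \<Rightarrow> real \<Rightarrow> real"
  assumes "h > 0"
    and fx: "\<And>x y. x \<in> {a..a+h} \<Longrightarrow> y \<in> {b..b+h} \<Longrightarrow> ((\<lambda>x. f x y) has_real_derivative fx x y) (at x)"
    and fxy: "\<And>x y. x \<in> {a..a+h} \<Longrightarrow> y \<in> {b..b+h} \<Longrightarrow> (fx x has_real_derivative fxy x y) (at y)"
  obtains x y where "x \<in> {a..a+h}" "y \<in> {b..b+h}"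
    "f (a+h) (b+h) - f (a+h) b - f a (b+h) + f a b = h * h * fxy x y"
proof -
  have "\<exists>x>a. x < a+h \<and> (f (a+h) (b+h) - f (a+h) b) - (f a (b+h) - f a b)
      = (a + h - a) * (fx x (b+h) - fx x b)"
    by (rule MVT2) (use assms in \<open>auto intro!: derivative_intros\<close>)
  then obtain x where x: "a < x" "x < a+h"
    "(f (a+h) (b+h) - f (a+h) b) - (f a (b+h) - f a b) = h * (fx x (b+h) - fx x b)" by auto
  have "\<exists>y>b. y < b+h \<and> fx x (b+h) - fx x b = (b + h - b) * fxy x y"
    by (rule MVT2) (use assms x in auto)
  then obtain y where "b < y" "y < b+h" "fx x (b+h) - fx x b = h * fxy x y" by auto
  then show thesis using x by (intro that[of x y]) auto
qed

text \<open>\<open>C2_on\<close> lists both mixed derivatives without equating them. Schwarz's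
  argument: one second difference over a small square is \<open>h * h\<close> times a value of
  \<open>fxt\<close> and also \<open>h * h\<close> times a value of \<open>ftx\<close>, and both
  values are within half of the supposed gap of those at \<open>(a, b)\<close>.\<close>

lemma mixed_partials_eq_interior:
  assumes f: "has_partials_on f fx ft A" and fx: "has_partials_on fx fxx fxt A"
    and ft: "has_partials_on ft ftx ftt A"
    and cont: "continuous_on A (\<lambda>(x, t). fxt x t)" "continuous_on A (\<lambda>(x, t). ftx x t)"
    and ab: "(a, b) \<in> interior A"
  shows "fxt a b = ftx a b"
proof (rule ccontr)
  assume ne: "fxt a b \<noteq> ftx a b"
  define e where "e = \<bar>fxt a b - ftx a b\<bar> / 2"
  have "e > 0" using ne by (simp add: e_def)
  have c: "continuous_on (interior A) (\<lambda>(x, t). fxt x t)" "continuous_on (interior A) (\<lambda>(x, t). ftx x t)"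
    using cont continuous_on_subset interior_subset by blast+
  obtain d1 where d1: "d1 > 0" "\<And>x t. (x, t) \<in> interior A \<Longrightarrow> dist (x, t) (a, b) < d1 \<Longrightarrow>
      dist (fxt x t) (fxt a b) < e"
    using c(1)[unfolded continuous_on_iff, rule_format, OF ab \<open>e > 0\<close>] by fastforce
  obtain d2 where d2: "d2 > 0" "\<And>x t. (x, t) \<in> interior A \<Longrightarrow> dist (x, t) (a, b) < d2 \<Longrightarrow>
      dist (ftx x t) (ftx a b) < e"
    using c(2)[unfolded continuous_on_iff, rule_format, OF ab \<open>e > 0\<close>] by fastforce
  obtain d3 where d3: "d3 > 0" "ball (a, b) d3 \<subseteq> interior A"
    using ab open_contains_ball open_interior by blast
  \<comment> \<open>Points of the square are at distance at most \<open>2 * h\<close> from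
    \<open>(a, b)\<close>, so a third of the smallest radius suffices.\<close>
  define h where "h = min d1 (min d2 d3) / 3"
  have h: "h > 0" using d1(1) d2(1) d3(1) by (simp add: h_def)
  have near: "dist (x, t) (a, b) < min d1 (min d2 d3)" if "x \<in> {a..a+h}" "t \<in> {b..b+h}" for x t
  proof -
    have "dist (x, t) (a, b) \<le> \<bar>x - a\<bar> + \<bar>t - b\<bar>"
      unfolding dist_Pair_Pair dist_real_def by (rule sqrt_sum_squares_le_sum_abs[THEN order_trans]) auto
    also have "\<dots> \<le> 2 * h" using that by auto
    also have "\<dots> < 3 * h" using h by simp
    finally show ?thesis by (simp add: h_def)
  qed
  have inA: "(x, t) \<in> interior A" if "x \<in> {a..a+h}" "t \<in> {b..b+h}" for x t
    using near[OF that] d3(2) by (auto simp: dist_commute subset_iff)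
  have Dx: "((\<lambda>y. g y t) has_real_derivative gx x t) (at x)"
    if "has_partials_on g gx gt A" "x \<in> {a..a+h}" "t \<in> {b..b+h}" for g gx gt x t
  proof -
    have o: "open ((\<lambda>y. (y, t)) -` interior A)"
      by (intro continuous_open_vimage) (auto intro!: continuous_intros)
    have "((\<lambda>y. g y t) has_real_derivative gx x t) (at x within ((\<lambda>y. (y, t)) -` interior A))"
      by (rule has_partials_on_x[OF has_partials_on_subset[OF that(1) interior_subset]])
        (use inA that in auto)
    then show ?thesis using at_within_open[OF _ o, of x] inA[OF that(2,3)] by simp
  qed
  have Dt: "((\<lambda>y. g x y) has_real_derivative gt x t) (at t)"
    if "has_partials_on g gx gt A" "x \<in> {a..a+h}" "t \<in> {b..b+h}" for g gx gt x t
  proof -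
    have o: "open ((\<lambda>y. (x, y)) -` interior A)"
      by (intro continuous_open_vimage) (auto intro!: continuous_intros)
    have "((\<lambda>y. g x y) has_real_derivative gt x t) (at t within ((\<lambda>y. (x, y)) -` interior A))"
      by (rule has_partials_on_t[OF has_partials_on_subset[OF that(1) interior_subset]])
        (use inA that in auto)
    then show ?thesis using at_within_open[OF _ o, of t] inA[OF that(2,3)] by simp
  qed
  obtain x1 t1 where 1: "x1 \<in> {a..a+h}" "t1 \<in> {b..b+h}"
    "f (a+h) (b+h) - f (a+h) b - f a (b+h) + f a b = h * h * fxt x1 t1"
    by (rule second_difference[OF h, where f = f and fx = fx and fxy = fxt])
      (assumption | rule Dx[OF f] Dt[OF fx])+
  obtain t2 x2 where 2: "x2 \<in> {a..a+h}" "t2 \<in> {b..b+h}"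
    "f (a+h) (b+h) - f a (b+h) - f (a+h) b + f a b = h * h * ftx x2 t2"
    by (rule second_difference[OF h, where f = "\<lambda>t x. f x t" and fx = "\<lambda>t x. ft x t"
        and fxy = "\<lambda>t x. ftx x t"])
      (assumption | rule Dt[OF f] Dx[OF ft])+
  have "h * h * fxt x1 t1 = h * h * ftx x2 t2" using 1(3) 2(3) by linarith
  then have "fxt x1 t1 = ftx x2 t2" using h by simp
  moreover have "\<bar>fxt x1 t1 - fxt a b\<bar> < e" "\<bar>ftx x2 t2 - ftx a b\<bar> < e"
    using d1(2)[OF inA near[THEN less_le_trans]] d2(2)[OF inA near[THEN less_le_trans]] 1 2
    by (auto simp: dist_real_def)
  ultimately show False unfolding e_def by (smt (verit) field_sum_of_halves)
qed

text \<open>A closed convex set with nonempty interior is the closure of that interior. This carries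
  equations known classically inside a strip to its edges and to time 0.\<close>

lemma eq_on_convex_closed:
  fixes f g :: "'a::euclidean_space \<Rightarrow> real"
  assumes "closed A" "convex A" "interior A \<noteq> {}" "continuous_on A f" "continuous_on A g"
    and "\<And>x. x \<in> interior A \<Longrightarrow> f x = g x" and "x \<in> A"
  shows "f x = g x"
proof -
  have cl: "closure (interior A) = A"
    using assms(1-3) by (simp add: convex_closure_interior)
  have "f x - g x = 0"
    by (rule continuous_constant_on_closure[of "interior A" "\<lambda>x. f x - g x"])
      (use assms cl in \<open>auto intro!: continuous_intros\<close>)
  then show ?thesis by simp
qed

subsection \<open>Riemann invariants\<close>

text \<open>The solution \<open>z\<close> of \<open>y = \<mu>\<^sup>2 z\<^sup>1\<^sup>+\<^sup>d / (d + 1)\<close>.\<close>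

definition z_of_p :: "real \<Rightarrow> real \<Rightarrow> real \<Rightarrow> real" where
  "z_of_p \<mu> d y = ((d + 1) / \<mu>\<^sup>2 * y) powr (1 / (d + 1))"

lemma z_of_p_pos: "\<mu> > 0 \<Longrightarrow> d > 1 \<Longrightarrow> y > 0 \<Longrightarrow> z_of_p \<mu> d y > 0"
  by (simp add: z_of_p_def)

lemma z_of_p_powr:
  assumes "\<mu> > 0" "d > 1" "y > 0"
  shows "((d + 1) / \<mu>\<^sup>2 * y) powr (1 / (d + 1) - 1) = z_of_p \<mu> d y powr (- d)"
proof -
  have "1 / (d + 1) - 1 = 1 / (d + 1) * (- d)" using assms by (simp add: field_simps)
  then show ?thesis unfolding z_of_p_def powr_powr by (simp only:)
qed

text \<open>Multiplied by \<open>\<mu>\<close>, this derivative is the reciprocal of the sound speed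
  \<open>\<mu> * z powr d\<close>, which is why \<open>\<mu> * z\<close> is the pressure part of the
  Riemann invariants.\<close>

lemma DERIV_z_of_p:
  assumes "\<mu> > 0" "d > 1" "y > 0"
  shows "(z_of_p \<mu> d has_real_derivative 1 / \<mu>\<^sup>2 * z_of_p \<mu> d y powr (- d)) (at y)"
proof -
  let ?k = "(d + 1) / \<mu>\<^sup>2"
  have d1: "d + 1 \<noteq> 0" using assms by simp
  have k: "?k * y > 0" using assms by simp
  have "((\<lambda>y. ?k * y) has_real_derivative ?k) (at y)"
    by (rule DERIV_cmult_Id)
  then have "((\<lambda>y. (?k * y) powr (1 / (d + 1))) has_real_derivative
      1 / (d + 1) * (?k * y) powr (1 / (d + 1) - 1) * ?k) (at y)"
    using DERIV_fun_powr[where g = "\<lambda>y. ?k * y" and x = y and m = ?k and r = "1 / (d + 1)"] k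
    by simp
  moreover have "1 / (d + 1) * a * ?k = 1 / \<mu>\<^sup>2 * a" for a
    using d1 by simp
  ultimately have "(z_of_p \<mu> d has_real_derivative
      1 / \<mu>\<^sup>2 * (?k * y) powr (1 / (d + 1) - 1)) (at y)"
    unfolding z_of_p_def[abs_def] by (simp add: d1)
  then show ?thesis using z_of_p_powr[OF assms] by simp
qed

lemma continuous_on_z_of_p:
  assumes "\<mu> > 0" "d > 1" "S \<subseteq> {0<..}"
  shows "continuous_on S (z_of_p \<mu> d)"
  by (rule DERIV_continuous_on, rule has_field_derivative_at_within, rule DERIV_z_of_p)
    (use assms in auto)

lemma C2_on_z_of_p:
  assumes "\<mu> > 0" "d > 1" and p: "C2_on p A" "\<And>x t. (x, t) \<in> A \<Longrightarrow> p x t > 0"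
  shows "C2_on (\<lambda>x t. z_of_p \<mu> d (p x t)) A"
proof (rule C2_on_compose[OF p(1)])
  let ?g2 = "\<lambda>y. 1 / \<mu>\<^sup>2 * (- d * z_of_p \<mu> d y powr (- d - 1) * (1 / \<mu>\<^sup>2 * z_of_p \<mu> d y powr (- d)))"
  show "(z_of_p \<mu> d has_real_derivative 1 / \<mu>\<^sup>2 * z_of_p \<mu> d (p x t) powr (- d)) (at (p x t))"
    if "(x, t) \<in> A" for x t using DERIV_z_of_p assms that by blast
  show "((\<lambda>y. 1 / \<mu>\<^sup>2 * z_of_p \<mu> d y powr (- d)) has_real_derivative ?g2 (p x t)) (at (p x t))"
    if "(x, t) \<in> A" for x t
    using DERIV_cmult[OF DERIV_fun_powr[OF DERIV_z_of_p[OF assms(1,2) p(2)[OF that]]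
        z_of_p_pos[OF assms(1,2) p(2)[OF that]], of "- d"], of "1 / \<mu>\<^sup>2"]
    by simp
  have pos: "y > 0" if "y \<in> (\<lambda>(x, t). p x t) ` A" for y
    using that p(2) by auto
  then have "z_of_p \<mu> d y \<noteq> 0" if "y \<in> (\<lambda>(x, t). p x t) ` A" for y
    using that z_of_p_pos[OF assms(1,2)] by (metis less_irrefl)
  then show "continuous_on ((\<lambda>(x, t). p x t) ` A) ?g2"
    using assms pos by (intro continuous_intros continuous_on_z_of_p) auto
qed

text \<open>\<open>\<sigma> = 1\<close> gives the forward, \<open>\<sigma> = - 1\<close> the backward Riemann invariant.\<close>

lemma riemann_invariant_gradient:
  assumes A: "closed A" "convex A" "interior A \<noteq> {}"
    and \<mu>: "\<mu> > 0" and d: "d > 1" and \<sigma>: "\<sigma> * \<sigma> = 1"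
    and u: "C2_on u A" and p: "C2_on p A" and pos: "\<And>x t. (x, t) \<in> A \<Longrightarrow> p x t > 0"
    and c: "\<And>x t. c x t = \<mu> * z_of_p \<mu> d (p x t) powr d"
    and cxt: "has_partials_on c cx ct A" and cont_cx: "continuous_on A (\<lambda>(x, t). cx x t)"
    and euler: "\<And>x t. (x, t) \<in> interior A \<Longrightarrow> \<exists>ux px.
      ((\<lambda>y. u y t) has_real_derivative ux) (at x) \<and> ((\<lambda>y. p y t) has_real_derivative px) (at x) \<and>
      (u x has_real_derivative - px) (at t) \<and> (p x has_real_derivative - (c x t)\<^sup>2 * ux) (at t)"
  obtains \<alpha> \<alpha>x \<alpha>t where
    "has_partials_on (\<lambda>x t. u x t + \<sigma> * \<mu> * z_of_p \<mu> d (p x t)) \<alpha> (\<lambda>x t. - (\<sigma> * c x t * \<alpha> x t)) A"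
    "has_partials_on \<alpha> \<alpha>x \<alpha>t A"
    "\<And>x t. (x, t) \<in> A \<Longrightarrow> \<alpha>t x t + \<sigma> * c x t * \<alpha>x x t = - (\<sigma> * cx x t * \<alpha> x t)"
proof -
  let ?r = "\<lambda>x t. u x t + \<sigma> * \<mu> * z_of_p \<mu> d (p x t)"
  have "C2_on (\<lambda>x t. 1 * u x t + (\<sigma> * \<mu>) * z_of_p \<mu> d (p x t)) A"
    by (intro C2_on_lincomb u C2_on_z_of_p \<mu> d p pos)
  then have "C2_on ?r A" by simp
  then obtain rx rt rxx rxt rtx rtt where r: "has_partials_on ?r rx rt A"
    "has_partials_on rx rxx rxt A" "has_partials_on rt rtx rtt A"
    "continuous_on A (\<lambda>(x, t). rxx x t)" "continuous_on A (\<lambda>(x, t). rxt x t)"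
    "continuous_on A (\<lambda>(x, t). rtx x t)"
    unfolding C2_on_def by blast
  have cc: "continuous_on A (\<lambda>(x, t). c x t)" "continuous_on A (\<lambda>(x, t). rx x t)"
    "continuous_on A (\<lambda>(x, t). rt x t)"
    using r(2,3) cxt has_partials_on_continuous by blast+
  have dx: "((\<lambda>y. f y t) has_real_derivative fx x t) (at x)"
    and dt: "(f x has_real_derivative ft x t) (at t)"
    if f: "has_partials_on f fx ft A" and xt: "(x, t) \<in> interior A" for f fx ft x t
  proof -
    have i: "has_partials_on f fx ft (interior A)"
      using f has_partials_on_subset interior_subset by blast
    have o: "open ((\<lambda>y. (y, t)) -` interior A)" "open ((\<lambda>y. (x, y)) -` interior A)"
      by (intro continuous_open_vimage; auto intro!: continuous_intros)+
    have "((\<lambda>y. f y t) has_real_derivative fx x t) (at x within ((\<lambda>y. (y, t)) -` interior A))"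
      "(f x has_real_derivative ft x t) (at t within ((\<lambda>y. (x, y)) -` interior A))"
      by (rule has_partials_on_x[OF i] has_partials_on_t[OF i]; use xt in auto)+
    then show "((\<lambda>y. f y t) has_real_derivative fx x t) (at x)"
      "(f x has_real_derivative ft x t) (at t)"
      using at_within_open[OF _ o(1), of x] at_within_open[OF _ o(2), of t] xt by auto
  qed
  have int_pos: "p x t > 0" if "(x, t) \<in> interior A" for x t
    using pos that interior_subset by blast
  have eq1: "rt x t = - (\<sigma> * c x t * rx x t)" if xt: "(x, t) \<in> interior A" for x t
  proof -
    obtain ux px where e: "((\<lambda>y. u y t) has_real_derivative ux) (at x)"
      "((\<lambda>y. p y t) has_real_derivative px) (at x)"
      "(u x has_real_derivative - px) (at t)" "(p x has_real_derivative - (c x t)\<^sup>2 * ux) (at t)"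
      using euler[OF xt] by blast
    let ?g' = "1 / \<mu>\<^sup>2 * z_of_p \<mu> d (p x t) powr (- d)"
    have g: "((\<lambda>y. z_of_p \<mu> d (q y)) has_real_derivative ?g' * D) (at y)"
      if "q y = p x t" "(q has_real_derivative D) (at y)" for q y D
      by (rule DERIV_chain2[of "z_of_p \<mu> d"])
        (use that DERIV_z_of_p[OF \<mu> d int_pos[OF xt]] in auto)
    have "((\<lambda>y. ?r y t) has_real_derivative ux + \<sigma> * \<mu> * (?g' * px)) (at x)"
      by (intro DERIV_add e DERIV_cmult g refl)
    then have 1: "rx x t = ux + \<sigma> * \<mu> * (?g' * px)" using dx[OF r(1) xt] DERIV_unique by blast
    have "(?r x has_real_derivative - px + \<sigma> * \<mu> * (?g' * (- (c x t)\<^sup>2 * ux))) (at t)"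
      by (intro DERIV_add e DERIV_cmult g refl)
    then have 2: "rt x t = - px + \<sigma> * \<mu> * (?g' * (- (c x t)\<^sup>2 * ux))"
      using dt[OF r(1) xt] DERIV_unique by blast
    have cpos: "c x t > 0" using c[of x t] z_of_p_pos[OF \<mu> d int_pos[OF xt]] \<mu> by simp
    have "\<mu> * ?g' = 1 / c x t"
      using \<mu> z_of_p_pos[OF \<mu> d int_pos[OF xt]] unfolding c
      by (simp add: powr_minus power2_eq_square field_simps)
    then have "rx x t = ux + \<sigma> * (px / c x t)" "rt x t = - px - \<sigma> * (c x t * ux)"
      unfolding 1 2 using cpos by (auto simp: power2_eq_square field_simps)
    then show ?thesis using cpos \<sigma> by (simp add: field_simps)
  qed
  have eq2: "rxt x t = rtx x t" if "(x, t) \<in> interior A" for x t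
    by (rule mixed_partials_eq_interior[OF r(1-3) r(5,6) that])
  \<comment> \<open>The transport equation \<open>eq1\<close> is differentiated in \<open>x\<close>;
    equality of the mixed derivatives then makes it an evolution equation for
    \<open>rx\<close>.\<close>
  have eq3: "rtx x t = - (\<sigma> * (c x t * rxx x t + cx x t * rx x t))" if xt: "(x, t) \<in> interior A" for x t
  proof -
    have "((\<lambda>y. - (\<sigma> * (c y t * rx y t))) has_real_derivative
        - (\<sigma> * (c x t * rxx x t + cx x t * rx x t))) (at x)"
      by (auto intro!: derivative_eq_intros dx[OF cxt xt] dx[OF r(2) xt] simp: algebra_simps)
    moreover have "open ((\<lambda>y. (y, t)) -` interior A)"
      by (intro continuous_open_vimage) (auto intro!: continuous_intros)
    ultimately have "((\<lambda>y. rt y t) has_real_derivative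
        - (\<sigma> * (c x t * rxx x t + cx x t * rx x t))) (at x)"
      by (rule has_field_derivative_transform_within_open) (use xt eq1 in auto)
    then show ?thesis using dx[OF r(3) xt] DERIV_unique by blast
  qed
  have cont: "continuous_on A (\<lambda>(x, t). - (\<sigma> * c x t * rx x t))"
    "continuous_on A (\<lambda>(x, t). - (\<sigma> * (c x t * rxx x t + cx x t * rx x t)))"
    using cc cont_cx r(4) by (auto simp: case_prod_unfold intro!: continuous_intros)
  \<comment> \<open>The Euler equations are available only in the interior. Continuity of all terms
    extends both transport equations to the edges, where the reflections take place.\<close>
  have E1: "rt x t = - (\<sigma> * c x t * rx x t)" if "(x, t) \<in> A" for x t
    using eq_on_convex_closed[OF A cc(3) cont(1) _ that] eq1 by auto
  have E3: "rxt x t = - (\<sigma> * (c x t * rxx x t + cx x t * rx x t))" if "(x, t) \<in> A" for x t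
    using eq_on_convex_closed[OF A r(5) cont(2) _ that] eq2 eq3 by auto
  show thesis
  proof (rule that)
    show "has_partials_on ?r rx (\<lambda>x t. - (\<sigma> * c x t * rx x t)) A"
      by (rule has_partials_on_cong[OF r(1)]) (use E1 in auto)
    show "has_partials_on rx rxx rxt A" by (rule r(2))
    show "rxt x t + \<sigma> * c x t * rxx x t = - (\<sigma> * cx x t * rx x t)" if "(x, t) \<in> A" for x t
      using E3[OF that] by (simp add: algebra_simps)
  qed
qed

lemma sound_speed_partials:
  assumes \<mu>: "\<mu> > 0" and d: "d > 1"
    and p: "C2_on p A" and pos: "\<And>x t. (x, t) \<in> A \<Longrightarrow> p x t > 0"
  obtains cx ct where "has_partials_on (\<lambda>x t. \<mu> * z_of_p \<mu> d (p x t) powr d) cx ct A"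
    "continuous_on A (\<lambda>(x, t). cx x t)"
proof -
  let ?z = "\<lambda>x t. z_of_p \<mu> d (p x t)"
  obtain zx zt zxx zxt ztx ztt where z: "has_partials_on ?z zx zt A" "has_partials_on zx zxx zxt A"
    using C2_on_z_of_p[OF \<mu> d p pos] unfolding C2_on_def by blast
  have zpos: "?z x t > 0" if "(x, t) \<in> A" for x t using z_of_p_pos[OF \<mu> d pos[OF that]] .
  show thesis
  proof (rule that)
    show "has_partials_on (\<lambda>x t. \<mu> * ?z x t powr d) (\<lambda>x t. (\<mu> * (d * ?z x t powr (d - 1))) * zx x t)
      (\<lambda>x t. (\<mu> * (d * ?z x t powr (d - 1))) * zt x t) A"
      by (rule has_partials_on_compose[OF z(1)])
        (use zpos in \<open>auto intro!: derivative_eq_intros\<close>)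
    have "continuous_on A (\<lambda>q. ?z (fst q) (snd q))" "continuous_on A (\<lambda>q. zx (fst q) (snd q))"
      using has_partials_on_continuous[OF z(1)] has_partials_on_continuous[OF z(2)]
      by (simp_all add: case_prod_unfold)
    moreover have "\<forall>q\<in>A. ?z (fst q) (snd q) \<noteq> 0 \<or> 0 < d - 1" using d by simp
    moreover have "\<forall>q\<in>A. ?z (fst q) (snd q) \<noteq> 0" using zpos by (metis less_irrefl prod.collapse)
    ultimately show "continuous_on A (\<lambda>(x, t). (\<mu> * (d * ?z x t powr (d - 1))) * zx x t)"
      unfolding case_prod_unfold
      by (intro continuous_on_mult continuous_on_const continuous_on_powr)
  qed
qed

subsection \<open>Constant states on a half line\<close>

lemma compact_in_rectangle:
  fixes D :: "(real \<times> real) set"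
  assumes "closed D" "D \<subseteq> {a..b} \<times> {c..d}"
  shows "compact D"
proof -
  have "compact ({a..b} \<times> {c..d} \<inter> D)"
    by (intro compact_Int_closed compact_Times compact_Icc assms(1))
  then show ?thesis using assms(2) by (simp add: Int_absorb1)
qed

text \<open>The set where \<open>F\<close> is nonnegative is compact, so time attains its minimum on
  it. This replaces tracing a characteristic back to its origin: a short step into the past is
  enough for a contradiction.\<close>

lemma earliest_point:
  fixes F :: "real \<times> real \<Rightarrow> real"
  assumes D: "compact D" and F: "continuous_on D F" and "q \<in> D" "F q \<ge> 0"
  obtains x t where "(x, t) \<in> D" "F (x, t) \<ge> 0"
    "\<And>y s. (y, s) \<in> D \<Longrightarrow> s < t \<Longrightarrow> F (y, s) < 0"
proof -
  let ?V = "D \<inter> F -` {0..}"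
  have "closed ?V"
    using D F by (intro continuous_closed_preimage) (auto simp: compact_imp_closed)
  then have "compact ?V"
    using compact_Int_closed[OF D, of ?V] by (simp add: Int_absorb1)
  moreover have "?V \<noteq> {}" using assms by auto
  moreover have "continuous_on ?V snd" by (intro continuous_intros)
  ultimately obtain v where v: "v \<in> ?V" "\<forall>w\<in>?V. snd v \<le> snd w"
    using continuous_attains_inf by blast
  show thesis
  proof (rule that[of "fst v" "snd v"])
    show "(fst v, snd v) \<in> D" "F (fst v, snd v) \<ge> 0" using v(1) by auto
    show "F (y, s) < 0" if "(y, s) \<in> D" "s < snd v" for y s
    proof (rule ccontr)
      assume "\<not> F (y, s) < 0"
      then have "(y, s) \<in> ?V" using that by simp
      then have "snd v \<le> s" using v(2) by force
      then show False using that by simp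
    qed
  qed
qed

text \<open>Only the segment has to lie in \<open>A\<close>, so the base point may sit on the edge;
  the derivative at parameter 0 is one-sided.\<close>

lemma partials_increase_along:
  assumes f: "has_partials_on f fx ft A" and "\<delta> > 0"
    and A: "\<And>h. 0 \<le> h \<Longrightarrow> h \<le> \<delta> \<Longrightarrow> (x + h * v, t + h * w) \<in> A"
    and pos: "fx x t * v + ft x t * w > 0"
  obtains h where "0 < h" "h \<le> \<delta>" "f x t < f (x + h * v) (t + h * w)"
proof -
  have "((\<lambda>h. f (x + h * v) (t + h * w)) has_real_derivative
      fx (x + 0 * v) (t + 0 * w) * v + ft (x + 0 * v) (t + 0 * w) * w) (at 0 within {0..\<delta>})"
    by (rule has_partials_on_chain[OF f]) (use A \<open>\<delta> > 0\<close> in \<open>auto intro!: derivative_eq_intros\<close>)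
  then have "((\<lambda>h. f (x + h * v) (t + h * w)) has_real_derivative
      fx x t * v + ft x t * w) (at 0 within {0..\<delta>})" by simp
  from has_real_derivative_pos_inc_right[OF this pos] obtain e where e: "e > 0"
    "\<And>h. h > 0 \<Longrightarrow> h \<in> {0..\<delta>} \<Longrightarrow> h < e \<Longrightarrow> f x t < f (x + h * v) (t + h * w)" by auto
  have m: "0 < min \<delta> (e / 2)" "min \<delta> (e / 2) \<le> \<delta>" "min \<delta> (e / 2) < e"
    using e(1) \<open>\<delta> > 0\<close> by auto
  show thesis
    by (rule that[OF m(1,2)], rule e(2)) (use m in auto)
qed

text \<open>The slope \<open>\<epsilon>\<close> makes the bound strictly violated at an earlier point on the backward
  characteristic direction, so that a first violation cannot exist.\<close>

lemma violation_moves_back: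
  assumes w: "has_partials_on w wx wt A" and eq: "wt x t + v * wx x t = 0" and "\<delta> > 0" "\<epsilon> > 0"
    and A: "\<And>h. 0 \<le> h \<Longrightarrow> h \<le> \<delta> \<Longrightarrow> (x - h * v, t - h) \<in> A"
    and viol: "\<epsilon> * (1 + t) \<le> \<bar>w x t\<bar>"
  obtains h where "0 < h" "h \<le> \<delta>" "\<epsilon> * (1 + (t - h)) < \<bar>w (x - h * v) (t - h)\<bar>"
proof -
  \<comment> \<open>The sign replaces the absolute value by a linear function that agrees with it at
    the point and lies below it elsewhere.\<close>
  define k where "k = (if w x t \<ge> 0 then 1 else - 1 :: real)"
  have k: "\<bar>w x t\<bar> = k * w x t" "\<And>y. k * y \<le> \<bar>y\<bar>" by (auto simp: k_def)
  have time: "has_partials_on (\<lambda>x t. t) (\<lambda>_ _. 0) (\<lambda>_ _. 1) A"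
    by (rule has_partials_onI) (auto intro!: derivative_eq_intros)
  \<comment> \<open>In the direction \<open>(- v, - 1)\<close> the transport terms cancel and only
    the slope \<open>\<epsilon>\<close> survives.\<close>
  have "(k * wx x t + - \<epsilon> * 0) * (- v) + (k * wt x t + - \<epsilon> * 1) * (- 1) = \<epsilon> - k * (wt x t + v * wx x t)"
    by (simp add: algebra_simps)
  then have "(k * wx x t + - \<epsilon> * 0) * (- v) + (k * wt x t + - \<epsilon> * 1) * (- 1) > 0"
    using eq \<open>\<epsilon> > 0\<close> by simp
  from partials_increase_along[OF has_partials_on_lincomb[OF w time, of k "- \<epsilon>"] \<open>\<delta> > 0\<close> _ this]
  obtain h where h: "0 < h" "h \<le> \<delta>"
    "k * w x t + - \<epsilon> * t < k * w (x + h * - v) (t + h * - 1) + - \<epsilon> * (t + h * - 1)"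
    using A by auto
  show thesis
  proof (rule that[OF h(1,2)])
    have "\<epsilon> * (1 + t) \<le> k * w x t" using viol k(1) by simp
    then have "\<epsilon> * (1 + (t - h)) < k * w (x - h * v) (t - h)"
      using h(3) by (simp add: algebra_simps)
    then show "\<epsilon> * (1 + (t - h)) < \<bar>w (x - h * v) (t - h)\<bar>" using k(2) by (rule less_le_trans)
  qed
qed

text \<open>No bound on \<open>c\<close> is available a priori, so a wave could in principle come in from
  infinity.  The triangle of slope \<open>M\<close> excludes this: as long as the solution is nearly constant
  there, characteristics are slower than \<open>M\<close>.\<close>

lemma half_line_triangle:
  fixes c :: "real \<Rightarrow> real \<Rightarrow> real" and x0 :: real
  defines "A \<equiv> {..x0} \<times> {0..}"
  assumes w1: "has_partials_on w1 a1 b1 A" "\<And>x t. (x, t) \<in> A \<Longrightarrow> b1 x t + c x t * a1 x t = 0"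
    and w2: "has_partials_on w2 a2 b2 A" "\<And>x t. (x, t) \<in> A \<Longrightarrow> b2 x t + (- c x t) * a2 x t = 0"
    and c: "\<And>x t. (x, t) \<in> A \<Longrightarrow> c x t > 0"
    and ini: "\<And>x. x \<le> x0 \<Longrightarrow> w1 x 0 = 0" "\<And>x. x \<le> x0 \<Longrightarrow> w2 x 0 = 0"
    and M: "\<delta> > 0" "\<And>x t. (x, t) \<in> A \<Longrightarrow> \<bar>w1 x t\<bar> \<le> \<delta> \<Longrightarrow> \<bar>w2 x t\<bar> \<le> \<delta> \<Longrightarrow> c x t \<le> M"
    and X: "X \<le> x0 - M * T" "T \<ge> 0"
  shows "w1 X T = 0"
proof -
  have Mpos: "M > 0" using M(1) M(2)[of x0 0] c[of x0 0] ini[of x0] by (force simp: A_def)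
  \<comment> \<open>Both lateral sides move inwards with speed \<open>M\<close> as time grows, and
    \<open>(X, T)\<close> lies on the top edge, so backward steps of speed at most \<open>M\<close>
    do not leave \<open>D\<close>.\<close>
  define D where "D = {(y, s). 0 \<le> s \<and> s \<le> T \<and> X - M * T + M * s \<le> y \<and> y \<le> x0 - M * s}"
  have DA: "D \<subseteq> A" using Mpos by (auto simp: D_def A_def) (smt (verit) mult_nonneg_nonneg)
  have "closed D"
    unfolding D_def case_prod_unfold
    by (intro closed_Collect_conj closed_Collect_le continuous_intros)
  moreover have "D \<subseteq> {X - M * T..x0} \<times> {0..T}"
    using Mpos by (auto simp: D_def) (smt (verit) mult_nonneg_nonneg)+
  ultimately have D: "compact D"
    by (rule compact_in_rectangle)
  \<comment> \<open>The cap on \<open>\<epsilon>\<close> keeps the deviations below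
    \<open>\<delta>\<close>, the regime in which \<open>M\<close> bounds the speed; below the cap
    \<open>\<epsilon>\<close> is arbitrary.\<close>
  have small: "\<bar>w1 X T\<bar> < \<epsilon> * (1 + T)" if \<epsilon>: "\<epsilon> > 0" "\<epsilon> * (1 + T) \<le> \<delta>" for \<epsilon>
  proof (rule ccontr)
    assume viol: "\<not> ?thesis"
    define F where "F = (\<lambda>q. max \<bar>w1 (fst q) (snd q)\<bar> \<bar>w2 (fst q) (snd q)\<bar> - \<epsilon> * (1 + snd q))"
    have "continuous_on D (\<lambda>q. w1 (fst q) (snd q))" "continuous_on D (\<lambda>q. w2 (fst q) (snd q))"
      using has_partials_on_continuous[OF w1(1)] has_partials_on_continuous[OF w2(1)] DA
      by (auto simp: case_prod_unfold intro: continuous_on_subset)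
    then have contF: "continuous_on D F"
      unfolding F_def by (intro continuous_intros)
    have "(X, T) \<in> D" "F (X, T) \<ge> 0"
      using X viol by (auto simp: D_def F_def)
    then obtain y s where ys: "(y, s) \<in> D" "F (y, s) \<ge> 0"
      and first: "\<And>y' s'. (y', s') \<in> D \<Longrightarrow> s' < s \<Longrightarrow> F (y', s') < 0"
      using earliest_point[OF D contF] by metis
    have s: "0 \<le> s" "s \<le> T" "X - M * T + M * s \<le> y" "y \<le> x0 - M * s" using ys by (auto simp: D_def)
    have "s \<noteq> 0" using ys(2) s ini[of y] \<epsilon> by (auto simp: F_def)
    then have spos: "s > 0" using s by simp
    \<comment> \<open>On the vertical segment below the first violation \<open>F\<close> is
      negative, so by continuity the bound is attained but not exceeded. This gives
      \<open>c y s \<le> M\<close> at the violating point itself.\<close>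
    have "F (y, s) \<le> 0"
    proof (rule continuous_le_on_closure[of "{0..<s}" "\<lambda>s. F (y, s)"])
      have inD: "(y, s') \<in> D" if "s' \<in> {0..s}" for s'
      proof -
        have "M * s' \<le> M * s" using Mpos that by (intro mult_left_mono) auto
        then show ?thesis using s that by (auto simp: D_def)
      qed
      show "continuous_on (closure {0..<s}) (\<lambda>s. F (y, s))"
        using spos by (simp, intro continuous_on_compose2[OF contF])
          (auto intro!: continuous_intros inD)
      show "s \<in> closure {0..<s}" using spos by simp
      show "F (y, s') \<le> 0" if "s' \<in> {0..<s}" for s'
        using first[of y s'] inD[of s'] that by (auto intro: less_imp_le)
    qed
    then have "\<bar>w1 y s\<bar> \<le> \<epsilon> * (1 + s)" "\<bar>w2 y s\<bar> \<le> \<epsilon> * (1 + s)" by (auto simp: F_def)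
    moreover have "\<epsilon> * (1 + s) \<le> \<epsilon> * (1 + T)" using \<epsilon> s by (intro mult_left_mono) auto
    ultimately have "\<bar>w1 y s\<bar> \<le> \<delta>" "\<bar>w2 y s\<bar> \<le> \<delta>" using \<epsilon>(2) by linarith+
    then have cM: "c y s \<le> M" using M(2)[of y s] ys DA by auto
    have cpos: "c y s > 0" using c ys DA by auto
    have ysA: "(y, s) \<in> A" using ys DA by auto
    have mD: "(y - h * v, s - h) \<in> D" if h: "0 \<le> h" "h \<le> s" and v: "\<bar>v\<bar> \<le> M" for h v
    proof -
      have "h * v \<le> h * M" "h * (- v) \<le> h * M" using h v by (intro mult_left_mono; auto)+
      then show ?thesis using s h by (auto simp: D_def algebra_simps)
    qed
    have "\<epsilon> * (1 + s) \<le> \<bar>w1 y s\<bar> \<or> \<epsilon> * (1 + s) \<le> \<bar>w2 y s\<bar>" using ys(2) by (auto simp: F_def)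
    then show False
    proof
      assume v: "\<epsilon> * (1 + s) \<le> \<bar>w1 y s\<bar>"
      have m: "(y - h * c y s, s - h) \<in> D" if "0 \<le> h" "h \<le> s" for h
        using mD[OF that, of "c y s"] cpos cM by auto
      obtain h where "0 < h" "h \<le> s" "\<epsilon> * (1 + (s - h)) < \<bar>w1 (y - h * c y s) (s - h)\<bar>"
        using violation_moves_back[OF w1(1) w1(2)[OF ysA] spos \<epsilon>(1) _ v] m DA by blast
      then show False using first[OF m, of h] by (auto simp: F_def)
    next
      assume v: "\<epsilon> * (1 + s) \<le> \<bar>w2 y s\<bar>"
      have m: "(y - h * (- c y s), s - h) \<in> D" if "0 \<le> h" "h \<le> s" for h
        using mD[OF that, of "- c y s"] cpos cM by auto
      obtain h where "0 < h" "h \<le> s" "\<epsilon> * (1 + (s - h)) < \<bar>w2 (y - h * (- c y s)) (s - h)\<bar>"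
        using violation_moves_back[OF w2(1) w2(2)[OF ysA] spos \<epsilon>(1) _ v] m DA by blast
      then show False using first[OF m, of h] by (auto simp: F_def)
    qed
  qed
  show "w1 X T = 0"
  proof (rule ccontr)
    assume ne: "w1 X T \<noteq> 0"
    have "min \<delta> \<bar>w1 X T\<bar> / (1 + T) > 0" using ne M X by auto
    from small[OF this] show False using X by simp
  qed
qed

text \<open>The triangle lemma covers the points to the left of the line
  \<open>x = x0 - M * t\<close>. Between this line and the edge \<open>x0\<close>, forward
  characteristics come from the left, so going back from a violation leads only to the line, where
  \<open>w1\<close> vanishes. In this second region the step length is adapted to the local
  speed.\<close>

lemma half_line_constant:
  fixes c :: "real \<Rightarrow> real \<Rightarrow> real" and x0 :: real
  defines "A \<equiv> {..x0} \<times> {0..}"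
  assumes w1: "has_partials_on w1 a1 b1 A" "\<And>x t. (x, t) \<in> A \<Longrightarrow> b1 x t + c x t * a1 x t = 0"
    and w2: "has_partials_on w2 a2 b2 A" "\<And>x t. (x, t) \<in> A \<Longrightarrow> b2 x t + (- c x t) * a2 x t = 0"
    and c: "\<And>x t. (x, t) \<in> A \<Longrightarrow> c x t > 0"
    and ini: "\<And>x. x \<le> x0 \<Longrightarrow> w1 x 0 = 0" "\<And>x. x \<le> x0 \<Longrightarrow> w2 x 0 = 0"
    and M: "\<delta> > 0" "\<And>x t. (x, t) \<in> A \<Longrightarrow> \<bar>w1 x t\<bar> \<le> \<delta> \<Longrightarrow> \<bar>w2 x t\<bar> \<le> \<delta> \<Longrightarrow> c x t \<le> M"
    and T: "T \<ge> 0"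
  shows "w1 x0 T = 0"
proof -
  have Mpos: "M > 0" using M(1) M(2)[of x0 0] c[of x0 0] ini[of x0] by (force simp: A_def)
  have tri: "w1 X T = 0" if "X \<le> x0 - M * T" "T \<ge> 0" for X T
    using half_line_triangle[OF w1[unfolded A_def] w2[unfolded A_def] c[unfolded A_def] ini
        M[unfolded A_def] that] by blast
  define D where "D = {(y, s). 0 \<le> s \<and> s \<le> T \<and> x0 - M * s \<le> y \<and> y \<le> x0}"
  have DA: "D \<subseteq> A" by (auto simp: D_def A_def)
  have "closed D"
    unfolding D_def case_prod_unfold
    by (intro closed_Collect_conj closed_Collect_le continuous_intros)
  moreover have "D \<subseteq> {x0 - M * T..x0} \<times> {0..T}"
    using Mpos by (auto simp: D_def) (smt (verit) mult_left_mono)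
  ultimately have D: "compact D"
    by (rule compact_in_rectangle)
  have small: "\<bar>w1 x0 T\<bar> < \<epsilon> * (1 + T)" if \<epsilon>: "\<epsilon> > 0" for \<epsilon>
  proof (rule ccontr)
    assume viol: "\<not> ?thesis"
    define F where "F = (\<lambda>q. \<bar>w1 (fst q) (snd q)\<bar> - \<epsilon> * (1 + snd q))"
    have "continuous_on D (\<lambda>q. w1 (fst q) (snd q))"
      using has_partials_on_continuous[OF w1(1)] DA
      by (auto simp: case_prod_unfold intro: continuous_on_subset)
    then have contF: "continuous_on D F"
      unfolding F_def by (intro continuous_intros)
    have "(x0, T) \<in> D" "F (x0, T) \<ge> 0"
      using T Mpos viol by (auto simp: D_def F_def)
    then obtain y s where ys: "(y, s) \<in> D" "F (y, s) \<ge> 0"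
      and first: "\<And>y' s'. (y', s') \<in> D \<Longrightarrow> s' < s \<Longrightarrow> F (y', s') < 0"
      using earliest_point[OF D contF] by metis
    have s: "0 \<le> s" "s \<le> T" "x0 - M * s \<le> y" "y \<le> x0" using ys by (auto simp: D_def)
    have "\<epsilon> * (1 + s) > 0" using \<epsilon> s by simp
    then have "w1 y s \<noteq> 0" using ys(2) by (auto simp: F_def)
    then have gap: "y - (x0 - M * s) > 0" using tri[of y s] s by linarith
    then have spos: "s > 0" using s Mpos by (cases "s = 0") auto
    have ysA: "(y, s) \<in> A" using ys DA by auto
    have cpos: "c y s > 0" using c ysA by auto
    \<comment> \<open>Going back in time, the point moves left with speed \<open>c y s\<close> and
      the line moves right with speed \<open>M\<close>, so the gap closes at rate
      \<open>c y s + M\<close>.\<close>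
    define e where "e = min s ((y - (x0 - M * s)) / (c y s + M))"
    have e: "e > 0" using spos gap cpos Mpos by (auto simp: e_def)
    have m: "(y - h * c y s, s - h) \<in> D" if h: "0 \<le> h" "h \<le> e" for h
    proof -
      have "h \<le> (y - (x0 - M * s)) / (c y s + M)" using h by (simp add: e_def)
      then have "h * (c y s + M) \<le> y - (x0 - M * s)" using cpos Mpos by (simp add: pos_le_divide_eq)
      moreover have "h * c y s \<ge> 0" using h cpos by simp
      moreover have "h \<le> s" using h by (simp add: e_def)
      ultimately show ?thesis using s h by (auto simp: D_def algebra_simps)
    qed
    have v: "\<epsilon> * (1 + s) \<le> \<bar>w1 y s\<bar>" using ys(2) by (simp add: F_def)
    obtain h where "0 < h" "h \<le> e" "\<epsilon> * (1 + (s - h)) < \<bar>w1 (y - h * c y s) (s - h)\<bar>"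
      using violation_moves_back[OF w1(1) w1(2)[OF ysA] e \<epsilon> _ v] m DA by blast
    then show False using first[OF m, of h] by (auto simp: F_def)
  qed
  show ?thesis
  proof (rule ccontr)
    assume ne: "w1 x0 T \<noteq> 0"
    have "\<bar>w1 x0 T\<bar> / (1 + T) > 0" using ne T by auto
    from small[OF this] show False using T by simp
  qed
qed

subsection \<open>Signs of the gradients\<close>

text \<open>The weight \<open>exp (- k t)\<close> with \<open>k > \<bar>v'\<bar>\<close> makes negative values of the gradient more
  negative along backward characteristic directions.\<close>

lemma weighted_gradient_moves_back:
  assumes g: "has_partials_on g gx gt A" and eq: "gt x t + v * gx x t = - (v' * g x t)" and "\<delta> > 0"
    and A: "\<And>h. 0 \<le> h \<Longrightarrow> h \<le> \<delta> \<Longrightarrow> (x - h * v, t - h) \<in> A"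
    and k: "\<bar>v'\<bar> < k" and neg: "g x t < 0"
  obtains h where "0 < h" "h \<le> \<delta>" "g (x - h * v) (t - h) * exp (- k * (t - h)) < g x t * exp (- k * t)"
proof -
  have weight: "has_partials_on (\<lambda>x t. - exp (- k * t)) (\<lambda>_ _. 0) (\<lambda>x t. k * exp (- k * t)) A"
    by (rule has_partials_onI) (auto intro!: derivative_eq_intros)
  have "(g x t * 0 + gx x t * - exp (- k * t)) * (- v)
      + (g x t * (k * exp (- k * t)) + gt x t * - exp (- k * t)) * (- 1)
      = exp (- k * t) * ((gt x t + v * gx x t) - k * g x t)"
    by (simp add: algebra_simps)
  also have "\<dots> = exp (- k * t) * ((k + v') * (- g x t))"
    unfolding eq by (simp add: algebra_simps)
  also have "\<dots> > 0" using k neg by (intro mult_pos_pos) auto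
  finally obtain h where "0 < h" "h \<le> \<delta>"
    "g x t * - exp (- k * t) < g (x + h * - v) (t + h * - 1) * - exp (- k * (t + h * - 1))"
    using partials_increase_along[OF has_partials_on_mult[OF g weight] \<open>\<delta> > 0\<close>, of x "- v" t "- 1"] A
    by auto
  then show thesis by (intro that[of h]) (auto simp: algebra_simps)
qed

text \<open>A negative weighted minimum of the two gradients is traced to its earliest occurrence.
  Away from the wall that emits the smaller gradient, a step back makes it more negative; on that
  wall it is \<open>\<eta> < 1\<close> times the other gradient, which would then be the smaller
  one. Time 0 is excluded by the initial signs.\<close>

lemma gradients_nonneg:
  fixes c :: "real \<Rightarrow> real \<Rightarrow> real" and x0 x1 :: real
  defines "A \<equiv> {x0..x1} \<times> {0..}"
  assumes x01: "x0 < x1"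
    and \<alpha>: "has_partials_on \<alpha> \<alpha>x \<alpha>t A"
      "\<And>x t. (x, t) \<in> A \<Longrightarrow> \<alpha>t x t + c x t * \<alpha>x x t = - (cx x t * \<alpha> x t)"
    and \<beta>: "has_partials_on \<beta> \<beta>x \<beta>t A"
      "\<And>x t. (x, t) \<in> A \<Longrightarrow> \<beta>t x t + - c x t * \<beta>x x t = - (- cx x t * \<beta> x t)"
    and cpos: "\<And>x t. (x, t) \<in> A \<Longrightarrow> c x t > 0" and cx: "continuous_on A (\<lambda>(x, t). cx x t)"
    and ini: "\<And>x. x \<in> {x0..x1} \<Longrightarrow> \<alpha> x 0 \<ge> 0" "\<And>x. x \<in> {x0..x1} \<Longrightarrow> \<beta> x 0 \<ge> 0"
    and \<eta>: "0 < \<eta>" "\<eta> < 1"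
    and bc: "\<And>t. t > 0 \<Longrightarrow> \<alpha> x0 t = \<eta> * \<beta> x0 t" "\<And>t. t > 0 \<Longrightarrow> \<beta> x1 t = \<eta> * \<alpha> x1 t"
    and XT: "(X, T) \<in> A"
  shows "\<alpha> X T \<ge> 0 \<and> \<beta> X T \<ge> 0"
proof (rule ccontr)
  assume bad: "\<not> ?thesis"
  define D where "D = {x0..x1} \<times> {0..T}"
  have D: "compact D" unfolding D_def by (intro compact_Times compact_Icc)
  have DA: "D \<subseteq> A" by (auto simp: D_def A_def)
  have "continuous_on D (\<lambda>(x, t). cx x t)" using cx DA continuous_on_subset by blast
  then have "bounded ((\<lambda>(x, t). cx x t) ` D)"
    using D compact_continuous_image compact_imp_bounded by blast
  then obtain k0 where "\<forall>v\<in>(\<lambda>(x, t). cx x t) ` D. norm v \<le> k0" unfolding bounded_iff by blast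
  then have k0: "\<bar>cx x t\<bar> \<le> k0" if "(x, t) \<in> D" for x t using that by fastforce
  define k where "k = k0 + 1"
  have k: "\<bar>cx x t\<bar> < k" if "(x, t) \<in> D" for x t using k0[OF that] by (simp add: k_def)
  define m where "m x t = min (\<alpha> x t) (\<beta> x t) * exp (- k * t)" for x t
  \<comment> \<open>The level is the value at the assumed bad point, so \<open>F\<close> is
    nonnegative exactly where the weighted minimum is at least as low.\<close>
  define F where "F = (\<lambda>q. m X T - m (fst q) (snd q))"
  have "continuous_on D (\<lambda>q. \<alpha> (fst q) (snd q))" "continuous_on D (\<lambda>q. \<beta> (fst q) (snd q))"
    using has_partials_on_continuous[OF \<alpha>(1)] has_partials_on_continuous[OF \<beta>(1)] DA
    by (auto simp: case_prod_unfold intro: continuous_on_subset)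
  then have contF: "continuous_on D F"
    unfolding F_def m_def by (intro continuous_intros)
  have "(X, T) \<in> D" "F (X, T) \<ge> 0" using XT by (auto simp: D_def A_def F_def)
  then obtain y s where ys: "(y, s) \<in> D" "F (y, s) \<ge> 0"
    and first: "\<And>y' s'. (y', s') \<in> D \<Longrightarrow> s' < s \<Longrightarrow> F (y', s') < 0"
    using earliest_point[OF D contF] by metis
  have mneg: "m X T < 0" using bad by (auto simp: m_def mult_neg_pos min_def)
  have below: "m y s \<le> m X T" using ys(2) by (simp add: F_def)
  then have neg: "min (\<alpha> y s) (\<beta> y s) < 0"
    using mneg by (smt (verit) m_def exp_gt_zero mult_nonneg_nonneg less_imp_le)
  have s: "0 \<le> s" "s \<le> T" "x0 \<le> y" "y \<le> x1" using ys by (auto simp: D_def)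
  have spos: "s > 0" using neg ini[of y] s by (cases "s = 0") (auto simp: min_def split: if_splits)
  have ysA: "(y, s) \<in> A" using ys DA by auto
  have cy: "c y s > 0" using cpos ysA by auto
  have no_alpha: False if a: "\<alpha> y s \<le> \<beta> y s" "y > x0"
  proof -
    define e where "e = min s ((y - x0) / c y s)"
    have e: "e > 0" using spos that cy by (simp add: e_def)
    have m1: "(y - h * c y s, s - h) \<in> D" if h: "0 \<le> h" "h \<le> e" for h
    proof -
      have "h \<le> (y - x0) / c y s" using h by (simp add: e_def)
      then have "h * c y s \<le> y - x0" using cy by (simp add: pos_le_divide_eq)
      moreover have "h * c y s \<ge> 0" using h cy by simp
      moreover have "h \<le> s" using h by (simp add: e_def)
      ultimately show ?thesis using s h by (auto simp: D_def)
    qed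
    obtain h where h: "0 < h" "h \<le> e"
      "\<alpha> (y - h * c y s) (s - h) * exp (- k * (s - h)) < \<alpha> y s * exp (- k * s)"
      using weighted_gradient_moves_back[OF \<alpha>(1) \<alpha>(2)[OF ysA] e _ k[OF ys(1)]] m1 DA neg a by auto
    have "m (y - h * c y s) (s - h) \<le> \<alpha> (y - h * c y s) (s - h) * exp (- k * (s - h))"
      unfolding m_def by (intro mult_right_mono) auto
    also have "\<dots> < m y s" using h(3) a by (simp add: m_def min_def)
    finally show False using first[OF m1, of h] h below by (auto simp: F_def)
  qed
  have no_beta: False if a: "\<beta> y s \<le> \<alpha> y s" "y < x1"
  proof -
    define e where "e = min s ((x1 - y) / c y s)"
    have e: "e > 0" using spos that cy by (simp add: e_def)
    have m1: "(y - h * (- c y s), s - h) \<in> D" if h: "0 \<le> h" "h \<le> e" for h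
    proof -
      have "h \<le> (x1 - y) / c y s" using h by (simp add: e_def)
      then have "h * c y s \<le> x1 - y" using cy by (simp add: pos_le_divide_eq)
      moreover have "h * c y s \<ge> 0" using h cy by simp
      moreover have "h \<le> s" using h by (simp add: e_def)
      ultimately show ?thesis using s h by (auto simp: D_def)
    qed
    have k': "\<bar>- cx y s\<bar> < k" using k[OF ys(1)] by simp
    obtain h where h: "0 < h" "h \<le> e"
      "\<beta> (y - h * (- c y s)) (s - h) * exp (- k * (s - h)) < \<beta> y s * exp (- k * s)"
      using weighted_gradient_moves_back[OF \<beta>(1) \<beta>(2)[OF ysA] e _ k'] m1 DA neg a by auto
    have "m (y - h * (- c y s)) (s - h) \<le> \<beta> (y - h * (- c y s)) (s - h) * exp (- k * (s - h))"
      unfolding m_def by (intro mult_right_mono) auto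
    also have "\<dots> < m y s" using h(3) a by (simp add: m_def min_def)
    finally show False using first[OF m1, of h] h below by (auto simp: F_def)
  qed
  have shrink: "\<eta> * v > v" if "v < 0" for v using \<eta> that by (simp add: mult_less_cancel_right2)
  show False
  proof (cases "\<alpha> y s \<le> \<beta> y s")
    case True
    then have "y = x0" using no_alpha s by fastforce
    moreover have "\<alpha> y s < 0" using True neg by simp
    ultimately have "\<beta> y s < 0" "\<beta> y s < \<alpha> y s"
      using bc(1)[OF spos] \<eta> shrink[of "\<beta> y s"] by (auto simp: mult_less_0_iff)
    then show False using True by simp
  next
    case False
    then have "y = x1" using no_beta s by fastforce
    moreover have "\<beta> y s < 0" using False neg by simp
    ultimately have "\<alpha> y s < 0" "\<alpha> y s < \<beta> y s"
      using bc(2)[OF spos] \<eta> shrink[of "\<alpha> y s"] by (auto simp: mult_less_0_iff)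
    then show False using False by simp
  qed
qed

section \<open>Existence for ordinary differential equations with Lipschitz right-hand side\<close>

text \<open>Picard iteration for the rescaled unknown \<open>exp (- k * (t - a)) * X t\<close>. The
  weight makes the map a contraction on the whole interval at once, so that no local solutions have
  to be glued.\<close>

lemma ode_solution_exists:
  fixes f :: "real \<Rightarrow> real \<Rightarrow> real"
  assumes cont: "continuous_on (UNIV \<times> {a..b}) (\<lambda>(x, t). f x t)" and ab: "a \<le> b"
    and lip: "\<And>x y t. t \<in> {a..b} \<Longrightarrow> \<bar>f x t - f y t\<bar> \<le> L * \<bar>x - y\<bar>"
  obtains X where "X a = y0" "\<And>t. t \<in> {a..b} \<Longrightarrow> (X has_real_derivative f (X t) t) (at t within {a..b})"
proof -
  \<comment> \<open>Integrating the weight yields the contraction factor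
    \<open>\<bar>L\<bar> / k\<close>, here at most \<open>1 / 2\<close>; the summand 1 keeps
    \<open>k\<close> positive when \<open>L = 0\<close>.\<close>
  define k where "k = 2 * \<bar>L\<bar> + 1"
  have k: "k > 0" by (simp add: k_def)
  \<comment> \<open>Elements of \<open>bcontfun\<close> live on the whole line; clamping the time
    extends the iterates beyond \<open>{a..b}\<close> by constants and keeps them bounded.\<close>
  define \<tau> where "\<tau> t = max a (min b t)" for t
  have \<tau>: "\<tau> t \<in> {a..b}" "t \<in> {a..b} \<Longrightarrow> \<tau> t = t" for t using ab by (auto simp: \<tau>_def)
  have cont\<tau>: "continuous_on UNIV \<tau>" unfolding \<tau>_def by (intro continuous_intros)
  define I where "I g s = integral {a..s} (\<lambda>r. f (exp (k * (r - a)) * g r) r)" for g s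
  define G where "G g t = exp (- k * (\<tau> t - a)) * (y0 + I g (\<tau> t))" for g t
  have contf: "continuous_on {a..b} (\<lambda>r. f (exp (k * (r - a)) * g r) r)"
    if "continuous_on UNIV g" for g
  proof -
    have "continuous_on {a..b} (\<lambda>r. (\<lambda>(x, t). f x t) (exp (k * (r - a)) * g r, r))"
      by (rule continuous_on_compose2[OF cont])
        (use that in \<open>auto intro!: continuous_intros intro: continuous_on_subset\<close>)
    then show ?thesis by simp
  qed
  have contG0: "continuous_on {a..b} (\<lambda>s. exp (- k * (s - a)) * (y0 + I g s))"
    if "continuous_on UNIV g" for g
    unfolding I_def using contf[OF that]
    by (intro continuous_intros indefinite_integral_continuous_1 integrable_continuous_interval)
  have inG: "G g \<in> bcontfun" if "continuous_on UNIV g" for g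
  proof -
    have "continuous_on UNIV (G g)"
      unfolding G_def by (rule continuous_on_compose2[OF contG0[OF that] cont\<tau>]) (use \<tau> in auto)
    moreover have "range (G g) \<subseteq> (\<lambda>s. exp (- k * (s - a)) * (y0 + I g s)) ` {a..b}"
      using \<tau> by (auto simp: G_def)
    moreover have "bounded ((\<lambda>s. exp (- k * (s - a)) * (y0 + I g s)) ` {a..b})"
      by (intro compact_imp_bounded compact_continuous_image contG0 that compact_Icc)
    ultimately show ?thesis unfolding bcontfun_def using bounded_subset by blast
  qed
  define \<Phi> where "\<Phi> g = Bcontfun (G (apply_bcontfun g))" for g :: "real \<Rightarrow>\<^sub>C real"
  have \<Phi>: "apply_bcontfun (\<Phi> g) = G (apply_bcontfun g)" for g
    unfolding \<Phi>_def by (intro Bcontfun_inverse inG) simp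
  have contr: "dist (\<Phi> g) (\<Phi> h) \<le> 1 / 2 * dist g h" for g h
  proof (rule dist_bound)
    fix t
    define s where "s = \<tau> t"
    have s: "s \<in> {a..b}" using \<tau> by (simp add: s_def)
    have int: "(\<lambda>r. f (exp (k * (r - a)) * apply_bcontfun g r) r) integrable_on {a..s}" for g
      using contf[of "apply_bcontfun g"] s
      by (intro integrable_continuous_interval) (auto intro: continuous_on_subset)
    have "((\<lambda>r. \<bar>L\<bar> * dist g h * exp (k * (r - a))) has_integral
        \<bar>L\<bar> * dist g h * exp (k * (s - a)) / k - \<bar>L\<bar> * dist g h * exp (k * (a - a)) / k) {a..s}"
      using s k by (intro fundamental_theorem_of_calculus)
        (auto intro!: derivative_eq_intros simp flip: has_real_derivative_iff_has_vector_derivative)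
    note J = this
    have "\<bar>I (apply_bcontfun g) s - I (apply_bcontfun h) s\<bar> =
        norm (integral {a..s} (\<lambda>r. f (exp (k * (r - a)) * apply_bcontfun g r) r
          - f (exp (k * (r - a)) * apply_bcontfun h r) r))"
      unfolding I_def by (subst integral_diff[OF int int]) simp
    also have "\<dots> \<le> integral {a..s} (\<lambda>r. \<bar>L\<bar> * dist g h * exp (k * (r - a)))"
    proof (rule integral_norm_bound_integral)
      fix r assume r: "r \<in> {a..s}"
      let ?E = "exp (k * (r - a))"
      have "\<bar>f (?E * apply_bcontfun g r) r - f (?E * apply_bcontfun h r) r\<bar>
          \<le> L * \<bar>?E * apply_bcontfun g r - ?E * apply_bcontfun h r\<bar>"
        using r s by (intro lip) auto
      also have "\<dots> \<le> \<bar>L\<bar> * (?E * dist g h)"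
      proof (intro mult_mono)
        have "\<bar>?E * apply_bcontfun g r - ?E * apply_bcontfun h r\<bar>
            = ?E * dist (apply_bcontfun g r) (apply_bcontfun h r)"
          by (simp add: dist_real_def abs_mult flip: right_diff_distrib)
        also have "\<dots> \<le> ?E * dist g h" by (intro mult_left_mono dist_bounded) auto
        finally show "\<bar>?E * apply_bcontfun g r - ?E * apply_bcontfun h r\<bar> \<le> ?E * dist g h" .
      qed auto
      finally show "norm (f (?E * apply_bcontfun g r) r - f (?E * apply_bcontfun h r) r)
          \<le> \<bar>L\<bar> * dist g h * ?E"
        by (simp add: algebra_simps)
    qed (use J int in \<open>auto intro!: integrable_diff\<close>)
    also have "\<dots> = \<bar>L\<bar> * dist g h * exp (k * (s - a)) / k - \<bar>L\<bar> * dist g h * exp (k * (a - a)) / k"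
      using J by (rule integral_unique)
    also have "\<dots> \<le> \<bar>L\<bar> * dist g h * exp (k * (s - a)) / k" using k by simp
    finally have 1: "\<bar>I (apply_bcontfun g) s - I (apply_bcontfun h) s\<bar>
      \<le> \<bar>L\<bar> * dist g h * exp (k * (s - a)) / k" .
    have "dist (apply_bcontfun (\<Phi> g) t) (apply_bcontfun (\<Phi> h) t)
        = exp (- k * (s - a)) * \<bar>I (apply_bcontfun g) s - I (apply_bcontfun h) s\<bar>"
      unfolding \<Phi> G_def s_def[symmetric]
      by (simp add: dist_real_def abs_mult flip: right_diff_distrib)
    also have "\<dots> \<le> exp (- k * (s - a)) * (\<bar>L\<bar> * dist g h * exp (k * (s - a)) / k)"
      by (intro mult_left_mono 1) auto
    also have "\<dots> = (exp (- k * (s - a)) * exp (k * (s - a))) * (\<bar>L\<bar> / k * dist g h)"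
      by simp
    also have "\<dots> = \<bar>L\<bar> / k * dist g h"
      by (simp flip: exp_add)
    also have "\<dots> \<le> 1 / 2 * dist g h"
      using k by (intro mult_right_mono) (auto simp: k_def field_simps)
    finally show "dist (apply_bcontfun (\<Phi> g) t) (apply_bcontfun (\<Phi> h) t) \<le> 1 / 2 * dist g h" .
  qed
  obtain g where g: "\<Phi> g = g"
    using banach_fix_type[of "1/2" \<Phi>] contr by auto
  have gG: "apply_bcontfun g t = G (apply_bcontfun g) t" for t using \<Phi>[of g] g by simp
  define X where "X t = exp (k * (t - a)) * apply_bcontfun g t" for t
  have X: "X t = y0 + integral {a..t} (\<lambda>r. f (X r) r)" if "t \<in> {a..b}" for t
  proof -
    have "X t = exp (k * (t - a)) * (exp (- k * (t - a)) * (y0 + I (apply_bcontfun g) t))"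
      using gG[of t] \<tau>(2)[OF that] by (simp add: X_def G_def)
    also have "\<dots> = y0 + I (apply_bcontfun g) t" by (simp add: exp_minus)
    finally show ?thesis by (simp add: I_def X_def)
  qed
  show thesis
  proof (rule that)
    show "X a = y0" using X[of a] ab by simp
    show "(X has_real_derivative f (X t) t) (at t within {a..b})" if t: "t \<in> {a..b}" for t
    proof -
      have "continuous_on {a..b} (\<lambda>r. f (X r) r)" unfolding X_def by (intro contf) simp
      then have "((\<lambda>t. y0 + integral {a..t} (\<lambda>r. f (X r) r)) has_real_derivative f (X t) t)
          (at t within {a..b})"
        using t by (auto intro!: derivative_eq_intros integral_has_real_derivative)
      then show ?thesis
        by (rule has_field_derivative_transform_within[where d = 1]) (use X t in auto)
    qed
  qed
qed

subsection \<open>Characteristics crossing a strip\<close>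

text \<open>\<open>low\<close> speaks of curves rather than points, because the lower bound on the
  speed will come from the invariant transported along the curve itself. It forces the solution
  across the width \<open>L\<close> in finite time.\<close>

lemma characteristic_crosses:
  fixes f :: "real \<Rightarrow> real \<Rightarrow> real"
  assumes L: "L > 0" and cont: "continuous_on ({0..L} \<times> {a..}) (\<lambda>(x, t). f x t)"
    and lip: "\<And>T. \<exists>K. \<forall>t\<in>{a..T}. \<forall>x\<in>{0..L}. \<forall>y\<in>{0..L}. \<bar>f x t - f y t\<bar> \<le> K * \<bar>x - y\<bar>"
    and pos: "\<And>x t. x \<in> {0..L} \<Longrightarrow> t \<ge> a \<Longrightarrow> f x t > 0" and \<delta>: "\<delta> > 0"
    and low: "\<And>T X. T \<ge> a \<Longrightarrow> X a = 0 \<Longrightarrow> continuous_on {a..T} X \<Longrightarrow>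
      (\<And>t. t \<in> {a..T} \<Longrightarrow> X t \<in> {0..L}) \<Longrightarrow>
      (\<And>t. t \<in> {a<..<T} \<Longrightarrow> (X has_real_derivative f (X t) t) (at t)) \<Longrightarrow> f (X T) T \<ge> \<delta>"
  obtains b X where "a < b" "continuous_on {a..b} X" "X a = 0" "X b = L"
    "\<And>t. t \<in> {a<..<b} \<Longrightarrow> 0 < X t \<and> X t < L \<and> (X has_real_derivative f (X t) t) (at t)"
proof -
  \<comment> \<open>A speed of at least \<open>\<delta>\<close> up to this time covers
    \<open>L + \<delta>\<close>, strictly more than the width.\<close>
  define T where "T = a + L / \<delta> + 1"
  have aT: "a < T" using L \<delta> by (simp add: T_def add_pos_pos)
  obtain K where K: "\<forall>t\<in>{a..T}. \<forall>x\<in>{0..L}. \<forall>y\<in>{0..L}. \<bar>f x t - f y t\<bar> \<le> K * \<bar>x - y\<bar>"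
    using lip by blast
  \<comment> \<open>Clamping the position makes the right-hand side Lipschitz on the whole line; it
    is inactive as long as the curve stays in the strip.\<close>
  define \<kappa> where "\<kappa> x = max 0 (min L x)" for x
  have \<kappa>: "\<kappa> x \<in> {0..L}" "x \<in> {0..L} \<Longrightarrow> \<kappa> x = x" "\<bar>\<kappa> x - \<kappa> y\<bar> \<le> \<bar>x - y\<bar>" for x y
    using L by (auto simp: \<kappa>_def)
  have "continuous_on (UNIV \<times> {a..T}) (\<lambda>q. (\<lambda>(x, t). f x t) (\<kappa> (fst q), snd q))"
    by (rule continuous_on_compose2[OF cont])
      (use \<kappa>(1) in \<open>auto intro!: continuous_intros simp: \<kappa>_def\<close>)
  then have cont\<kappa>: "continuous_on (UNIV \<times> {a..T}) (\<lambda>(x, t). f (\<kappa> x) t)"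
    by (simp add: case_prod_unfold)
  have lip\<kappa>: "\<bar>f (\<kappa> x) t - f (\<kappa> y) t\<bar> \<le> \<bar>K\<bar> * \<bar>x - y\<bar>" if "t \<in> {a..T}" for x y t
  proof -
    have "\<bar>f (\<kappa> x) t - f (\<kappa> y) t\<bar> \<le> K * \<bar>\<kappa> x - \<kappa> y\<bar>" using K \<kappa>(1) that by blast
    also have "\<dots> \<le> \<bar>K\<bar> * \<bar>x - y\<bar>" using \<kappa>(3) by (intro mult_mono) auto
    finally show ?thesis .
  qed
  obtain X where X: "X a = 0"
    "\<And>t. t \<in> {a..T} \<Longrightarrow> (X has_real_derivative f (\<kappa> (X t)) t) (at t within {a..T})"
    using ode_solution_exists[OF cont\<kappa> less_imp_le[OF aT] lip\<kappa>, of 0] by blast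
  have XD: "(X has_real_derivative f (\<kappa> (X t)) t) (at t)" if "t \<in> {a<..<T}" for t
    using X(2)[of t] that by (auto simp: at_within_Icc_at)
  have contX: "continuous_on {a..T} X" using X(2) by (rule DERIV_continuous_on)
  have inc: "X s < X t" if "a \<le> s" "s < t" "t \<le> T" for s t
  proof (rule DERIV_pos_imp_increasing_open[OF that(2)])
    show "\<exists>y. (X has_real_derivative y) (at u) \<and> 0 < y" if "s < u" "u < t" for u
      using XD[of u] pos[OF \<kappa>(1), of u "X u"] that \<open>a \<le> s\<close> \<open>t \<le> T\<close> by auto
    show "continuous_on {s..t} X" using contX that by (auto intro: continuous_on_subset)
  qed
  have "X T > L"
  proof (rule ccontr)
    assume le: "\<not> X T > L"
    have inL: "X t \<in> {0..L}" if "t \<in> {a..T}" for t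
      using inc[of a t] inc[of t T] X(1) le that by (cases "t = a"; cases "t = T") auto
    have XD': "(X has_real_derivative f (X t) t) (at t)" if "t \<in> {a<..<T}" for t
      using XD[OF that] \<kappa>(2)[OF inL, of t] that by auto
    have "\<exists>l \<xi>. a < \<xi> \<and> \<xi> < T \<and> (X has_real_derivative l) (at \<xi>) \<and> X T - X a = (T - a) * l"
      by (rule MVT[OF aT contX]) (use XD' real_differentiable_def in auto)
    then obtain l \<xi> where l: "a < \<xi>" "\<xi> < T" "(X has_real_derivative l) (at \<xi>)"
      "X T - X a = (T - a) * l" by blast
    have "l = f (X \<xi>) \<xi>" using l XD'[of \<xi>] DERIV_unique by auto
    moreover have "f (X \<xi>) \<xi> \<ge> \<delta>"
      using l X(1) inL XD' contX by (intro low) (auto intro: continuous_on_subset)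
    ultimately have "(T - a) * \<delta> \<le> X T" using l X(1) aT by (simp add: mult_left_mono)
    moreover have "(T - a) * \<delta> = L + \<delta>" using \<delta> by (simp add: T_def field_simps)
    ultimately show False using le \<delta> by simp
  qed
  then obtain b where b: "a \<le> b" "b \<le> T" "X b = L"
    using IVT'[of X a L T] X(1) L aT contX by auto
  have ab: "a < b" using b X(1) L by (cases "a = b") auto
  show thesis
  proof (rule that[OF ab _ X(1) b(3)])
    show "continuous_on {a..b} X" using contX b by (auto intro: continuous_on_subset)
    show "0 < X t \<and> X t < L \<and> (X has_real_derivative f (X t) t) (at t)" if t: "t \<in> {a<..<b}" for t
    proof -
      have "0 < X t" "X t < L" using inc[of a t] inc[of t b] t b X(1) by auto
      moreover have "(X has_real_derivative f (\<kappa> (X t)) t) (at t)" using XD t b by auto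
      ultimately show ?thesis using \<kappa>(2)[of "X t"] by auto
    qed
  qed
qed

lemma nondecreasing_from_derivative_within:
  fixes f :: "real \<Rightarrow> real"
  assumes "a \<le> b" and f: "\<And>x. x \<in> {a..b} \<Longrightarrow> (f has_real_derivative f' x) (at x within {a..b})"
    and "\<And>x. x \<in> {a..b} \<Longrightarrow> f' x \<ge> 0"
  shows "f a \<le> f b"
proof (rule DERIV_nonneg_imp_increasing_open[OF assms(1)])
  show "continuous_on {a..b} f" using f by (rule DERIV_continuous_on)
  show "\<exists>y. (f has_real_derivative y) (at x) \<and> 0 \<le> y" if "a < x" "x < b" for x
    using f[of x] assms(3)[of x] that by (auto simp: at_within_Icc_at)
qed

section \<open>The strip as a boundary problem for two Riemann invariants\<close>

text \<open>The gas law enters through \<open>c_eq\<close> alone, and the outer states are condensed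
  into the constants \<open>A\<close> and \<open>B\<close> of the affine reflections
  \<open>bc0\<close> and \<open>bc1\<close>.\<close>

locale rarefaction_strip =
  fixes x0 x1 m d \<eta> A B :: real and r s \<alpha> \<beta> c cx ct :: "real \<Rightarrow> real \<Rightarrow> real"
  assumes x01: "x0 < x1" and m: "m > 0" and d: "d > 0" and \<eta>: "0 < \<eta>" "\<eta> < 1"
    and r: "has_partials_on r \<alpha> (\<lambda>x t. - (c x t * \<alpha> x t)) ({x0..x1} \<times> {0..})"
    and s: "has_partials_on s \<beta> (\<lambda>x t. c x t * \<beta> x t) ({x0..x1} \<times> {0..})"
    and pos: "\<And>x t. x \<in> {x0..x1} \<Longrightarrow> t \<ge> 0 \<Longrightarrow> r x t > s x t"
    and c_eq: "\<And>x t. x \<in> {x0..x1} \<Longrightarrow> t \<ge> 0 \<Longrightarrow> c x t = m * ((r x t - s x t) / (2 * m)) powr d"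
    and c: "has_partials_on c cx ct ({x0..x1} \<times> {0..})"
    and cx: "continuous_on ({x0..x1} \<times> {0..}) (\<lambda>(x, t). cx x t)"
    and grad: "\<And>x t. x \<in> {x0..x1} \<Longrightarrow> t \<ge> 0 \<Longrightarrow> \<alpha> x t \<ge> 0 \<and> \<beta> x t \<ge> 0"
    and bc0: "\<And>t. t \<ge> 0 \<Longrightarrow> r x0 t - A = - \<eta> * (s x0 t - A)"
    and bc1: "\<And>t. t \<ge> 0 \<Longrightarrow> s x1 t - B = - \<eta> * (r x1 t - B)"
begin

definition z :: "real \<Rightarrow> real \<Rightarrow> real" where "z x t = (r x t - s x t) / (2 * m)"

lemma z_pos: "x \<in> {x0..x1} \<Longrightarrow> t \<ge> 0 \<Longrightarrow> z x t > 0"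
  using pos m by (simp add: z_def)

lemma c_z: "x \<in> {x0..x1} \<Longrightarrow> t \<ge> 0 \<Longrightarrow> c x t = m * z x t powr d"
  by (simp add: z_def c_eq)

lemma c_pos: "x \<in> {x0..x1} \<Longrightarrow> t \<ge> 0 \<Longrightarrow> c x t > 0"
  using c_z z_pos[of x t] m by simp

lemma z_partials:
  "has_partials_on z (\<lambda>x t. (\<alpha> x t - \<beta> x t) / (2 * m)) (\<lambda>x t. - (c x t * (\<alpha> x t + \<beta> x t)) / (2 * m))
    ({x0..x1} \<times> {0..})"
  by (rule has_partials_on_cong[OF has_partials_on_lincomb[OF r s, of "1 / (2 * m)" "- 1 / (2 * m)"]])
    (use m in \<open>auto simp: z_def field_simps\<close>)

text \<open>The reflection condition and \<open>2 * m * z = r - s\<close> are two linear equations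
  for the two invariants, so on a contact each of them is an affine function of
  \<open>z\<close>.\<close>

lemma traces_x0:
  assumes "t \<ge> 0"
  shows "r x0 t = A + 2 * m * \<eta> / (1 + \<eta>) * z x0 t" "s x0 t = A - 2 * m / (1 + \<eta>) * z x0 t"
proof -
  have e: "1 + \<eta> > 0" using \<eta> by simp
  have "2 * m * z x0 t = r x0 t - s x0 t" using m by (simp add: z_def)
  then have "2 * m * z x0 t = (1 + \<eta>) * (A - s x0 t)"
    using bc0[OF assms] by (simp add: algebra_simps)
  then have eq: "A - s x0 t = 2 * m / (1 + \<eta>) * z x0 t" using e by (simp add: field_simps)
  then show "s x0 t = A - 2 * m / (1 + \<eta>) * z x0 t" by simp
  have "r x0 t = A + \<eta> * (A - s x0 t)"
    using bc0[OF assms] by (simp add: algebra_simps)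
  then show "r x0 t = A + 2 * m * \<eta> / (1 + \<eta>) * z x0 t"
    unfolding eq by simp
qed

lemma traces_x1:
  assumes "t \<ge> 0"
  shows "r x1 t = B + 2 * m / (1 + \<eta>) * z x1 t" "s x1 t = B - 2 * m * \<eta> / (1 + \<eta>) * z x1 t"
proof -
  have e: "1 + \<eta> > 0" using \<eta> by simp
  have "2 * m * z x1 t = r x1 t - s x1 t" using m by (simp add: z_def)
  then have "2 * m * z x1 t = (1 + \<eta>) * (r x1 t - B)"
    using bc1[OF assms] by (simp add: algebra_simps)
  then have eq: "r x1 t - B = 2 * m / (1 + \<eta>) * z x1 t" using e by (simp add: field_simps)
  then show "r x1 t = B + 2 * m / (1 + \<eta>) * z x1 t" by simp
  have "s x1 t = B - \<eta> * (r x1 t - B)"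
    using bc1[OF assms] by (simp add: algebra_simps)
  then show "s x1 t = B - 2 * m * \<eta> / (1 + \<eta>) * z x1 t"
    unfolding eq by simp
qed

lemma mono_in_x:
  assumes "x0 \<le> x" "x \<le> y" "y \<le> x1" "t \<ge> 0"
  shows "r x t \<le> r y t" "s x t \<le> s y t"
proof -
  have S: "(y', t) \<in> {x0..x1} \<times> {0..}" if "y' \<in> {x..y}" for y' using that assms by auto
  have g: "\<alpha> y' t \<ge> 0" "\<beta> y' t \<ge> 0" if "y' \<in> {x..y}" for y' using grad[of y' t] S[OF that] by auto
  show "r x t \<le> r y t" "s x t \<le> s y t"
    by (rule nondecreasing_from_derivative_within[OF assms(2) has_partials_on_x[OF r S] g(1)]
        nondecreasing_from_derivative_within[OF assms(2) has_partials_on_x[OF s S] g(2)]; assumption)+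
qed

text \<open>At \<open>x0\<close> the invariant \<open>s\<close> has time derivative
  \<open>c * \<beta> \<ge> 0\<close> and is an affine decreasing function of \<open>z\<close>; at
  \<open>x1\<close> the invariant \<open>r\<close> has time derivative
  \<open>- c * \<alpha> \<le> 0\<close> and is an affine increasing one.\<close>

lemma trace_decreasing:
  assumes "0 \<le> t" "t \<le> t'"
  shows "z x0 t' \<le> z x0 t" "z x1 t' \<le> z x1 t"
proof -
  have e: "2 * m / (1 + \<eta>) > 0" using m \<eta> by simp
  have S: "(x, y) \<in> {x0..x1} \<times> {0..}" if "y \<in> {t..t'}" "x = x0 \<or> x = x1" for x y
    using that assms x01 by auto
  have nonneg: "c x y * \<alpha> x y \<ge> 0" "c x y * \<beta> x y \<ge> 0" if "y \<in> {t..t'}" "x = x0 \<or> x = x1" for x y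
    using grad[of x y] c_pos[of x y] S[OF that] by auto
  have "s x0 t \<le> s x0 t'"
    by (rule nondecreasing_from_derivative_within[OF assms(2) has_partials_on_t[OF s S] nonneg(2)]) auto
  then have "2 * m / (1 + \<eta>) * z x0 t' \<le> 2 * m / (1 + \<eta>) * z x0 t"
    using traces_x0(2)[of t] traces_x0(2)[of t'] assms by linarith
  then show "z x0 t' \<le> z x0 t" using e by (rule mult_left_le_imp_le)
  have "- r x1 t \<le> - r x1 t'"
    by (rule nondecreasing_from_derivative_within[OF assms(2) DERIV_minus[OF has_partials_on_t[OF r S]]])
      (use nonneg(1) in auto)
  then have "2 * m / (1 + \<eta>) * z x1 t' \<le> 2 * m / (1 + \<eta>) * z x1 t"
    using traces_x1(1)[of t] traces_x1(1)[of t'] assms by linarith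
  then show "z x1 t' \<le> z x1 t" using e by (rule mult_left_le_imp_le)
qed

lemma nonincreasing_along_characteristic:
  assumes ab: "0 \<le> a" "a \<le> b" and Y: "continuous_on {a..b} Y" "\<And>t. t \<in> {a..b} \<Longrightarrow> Y t \<in> {x0..x1}"
    "\<And>t. t \<in> {a<..<b} \<Longrightarrow> (Y has_real_derivative \<sigma> * c (Y t) t) (at t)"
    and f: "has_partials_on f fx ft ({x0..x1} \<times> {0..})"
    "\<And>x t. x \<in> {x0..x1} \<Longrightarrow> t \<ge> 0 \<Longrightarrow> ft x t + \<sigma> * c x t * fx x t \<le> 0"
  shows "f (Y b) b \<le> f (Y a) a"
proof -
  have "- f (Y a) a \<le> - f (Y b) b"
  proof (rule DERIV_nonneg_imp_increasing_open[OF ab(2)])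
    have "continuous_on {a..b} (\<lambda>t. (\<lambda>(x, t). f x t) (Y t, t))"
      by (rule continuous_on_compose2[OF has_partials_on_continuous[OF f(1)]])
        (use Y ab in \<open>auto intro!: continuous_intros\<close>)
    then show "continuous_on {a..b} (\<lambda>t. - f (Y t) t)" by (intro continuous_intros) simp
    show "\<exists>y. ((\<lambda>t. - f (Y t) t) has_real_derivative y) (at t) \<and> 0 \<le> y" if t: "a < t" "t < b" for t
    proof -
      have "((\<lambda>t. f (Y t) t) has_real_derivative fx (Y t) t * (\<sigma> * c (Y t) t) + ft (Y t) t * 1)
          (at t within {a<..<b})"
        using has_partials_on_chain[OF f(1), of Y "\<sigma> * c (Y t) t" t "{a<..<b}" "\<lambda>t. t" 1]
          Y t ab by (auto intro: has_field_derivative_at_within)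
      then have "((\<lambda>t. - f (Y t) t) has_real_derivative - (fx (Y t) t * (\<sigma> * c (Y t) t) + ft (Y t) t * 1))
          (at t)"
        using t by (intro DERIV_minus) (simp add: at_within_open[of t "{a<..<b}"])
      moreover have "ft (Y t) t + \<sigma> * c (Y t) t * fx (Y t) t \<le> 0" using f(2)[of "Y t" t] Y t ab by auto
      ultimately show ?thesis by (intro exI conjI) (auto simp: algebra_simps)
    qed
  qed
  then show ?thesis by simp
qed

lemma constant_along_characteristic:
  assumes ab: "0 \<le> a" "a \<le> b" and Y: "continuous_on {a..b} Y" "\<And>t. t \<in> {a..b} \<Longrightarrow> Y t \<in> {x0..x1}"
    "\<And>t. t \<in> {a<..<b} \<Longrightarrow> (Y has_real_derivative \<sigma> * c (Y t) t) (at t)"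
  shows "\<sigma> = 1 \<Longrightarrow> r (Y b) b = r (Y a) a" "\<sigma> = - 1 \<Longrightarrow> s (Y b) b = s (Y a) a"
proof -
  have minus: "has_partials_on (\<lambda>x t. - f x t) (\<lambda>x t. - fx x t) (\<lambda>x t. - ft x t) S"
    if "has_partials_on f fx ft S" for f fx ft S
    using has_partials_on_lincomb[OF that that, of "- 1" 0] by simp
  show "r (Y b) b = r (Y a) a" if "\<sigma> = 1"
    using nonincreasing_along_characteristic[OF ab Y r]
      nonincreasing_along_characteristic[OF ab Y minus[OF r]] that by fastforce
  show "s (Y b) b = s (Y a) a" if "\<sigma> = - 1"
    using nonincreasing_along_characteristic[OF ab Y s]
      nonincreasing_along_characteristic[OF ab Y minus[OF s]] that by fastforce
qed

text \<open>On a forward characteristic \<open>r\<close> is constant while \<open>s\<close> changes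
  at the rate \<open>2 * c * \<beta>\<close>; on a backward one \<open>s\<close> is constant while
  \<open>r\<close> changes at the rate \<open>- 2 * c * \<alpha>\<close>.\<close>

lemma z_nonincreasing_along_characteristic:
  assumes ab: "0 \<le> a" "a \<le> b" and Y: "continuous_on {a..b} Y" "\<And>t. t \<in> {a..b} \<Longrightarrow> Y t \<in> {x0..x1}"
    "\<And>t. t \<in> {a<..<b} \<Longrightarrow> (Y has_real_derivative \<sigma> * c (Y t) t) (at t)" and \<sigma>: "\<sigma> = 1 \<or> \<sigma> = - 1"
  shows "z (Y b) b \<le> z (Y a) a"
proof (rule nonincreasing_along_characteristic[OF ab Y z_partials])
  fix x t :: real assume xt: "x \<in> {x0..x1}" "t \<ge> 0"
  have "c x t * \<alpha> x t \<ge> 0" "c x t * \<beta> x t \<ge> 0"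
    using c_pos[OF xt] grad[OF xt] by auto
  then have "- (c x t * (\<alpha> x t + \<beta> x t)) + \<sigma> * c x t * (\<alpha> x t - \<beta> x t) \<le> 0"
    using \<sigma> by (auto simp: algebra_simps)
  then have "(- (c x t * (\<alpha> x t + \<beta> x t)) + \<sigma> * c x t * (\<alpha> x t - \<beta> x t)) / (2 * m) \<le> 0"
    using m by (simp add: divide_le_0_iff)
  moreover have "(- (c x t * (\<alpha> x t + \<beta> x t)) + \<sigma> * c x t * (\<alpha> x t - \<beta> x t)) / (2 * m)
      = - (c x t * (\<alpha> x t + \<beta> x t)) / (2 * m) + \<sigma> * c x t * ((\<alpha> x t - \<beta> x t) / (2 * m))"
    unfolding add_divide_distrib by simp
  ultimately show "- (c x t * (\<alpha> x t + \<beta> x t)) / (2 * m) + \<sigma> * c x t * ((\<alpha> x t - \<beta> x t) / (2 * m)) \<le> 0"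
    by simp
qed

text \<open>Inserting the transported invariant into the trace formulas at both ends gives the same
  defect in either direction, which ties every leg to \<open>A - B\<close>. For the travel time, the
  mean value theorem picks one speed on the leg, and this lies between the speeds at the ends
  because \<open>z\<close> falls along the leg.\<close>

lemma crossing_facts:
  assumes cr: "crossing c \<sigma> y0 y1 a b" and a: "a \<ge> 0"
    and dir: "\<sigma> = 1 \<and> y0 = x0 \<and> y1 = x1 \<or> \<sigma> = - 1 \<and> y0 = x1 \<and> y1 = x0"
  shows "a < b" "z y1 b - \<eta> * z y0 a = (A - B) * ((1 + \<eta>) / (2 * m))"
    "c y1 b * (b - a) \<le> x1 - x0" "x1 - x0 \<le> c y0 a * (b - a)"
proof -
  show ab: "a < b" using cr by (simp add: crossing_def)
  obtain X where X: "continuous_on {a..b} X" "X a = y0" "X b = y1"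
    "\<And>t. t \<in> {a<..<b} \<Longrightarrow> min y0 y1 < X t \<and> X t < max y0 y1"
    "\<And>t. t \<in> {a<..<b} \<Longrightarrow> (X has_real_derivative \<sigma> * c (X t) t) (at t)"
    using cr unfolding crossing_def by blast
  have inX: "X t \<in> {x0..x1}" if "t \<in> {a..b}" for t
    using X(2,3) X(4)[of t] dir x01 that by (cases "t = a"; cases "t = b") (auto simp: min_def max_def)
  have along: "z (X v) v \<le> z (X u) u" if "a \<le> u" "u \<le> v" "v \<le> b" for u v
    by (rule z_nonincreasing_along_characteristic[of u v X \<sigma>])
      (use that a X inX dir in \<open>auto intro: continuous_on_subset\<close>)
  have cz: "c (X t) t = m * z (X t) t powr d" if "t \<in> {a..b}" for t
    using c_z[of "X t" t] inX[OF that] that a by auto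
  have e: "1 + \<eta> > 0" using \<eta> by simp
  have "2 * m / (1 + \<eta>) * (z y1 b - \<eta> * z y0 a) = A - B"
  proof (cases "\<sigma> = 1")
    case True
    then have "r x1 b = r x0 a"
      using constant_along_characteristic(1)[OF a less_imp_le[OF ab] X(1) inX X(5)] X(2,3) dir by auto
    then show ?thesis using traces_x0(1)[of a] traces_x1(1)[of b] a ab True dir
      by (auto simp: algebra_simps)
  next
    case False
    then have "s x0 b = s x1 a"
      using constant_along_characteristic(2)[OF a less_imp_le[OF ab] X(1) inX X(5)] X(2,3) dir by auto
    then show ?thesis using traces_x0(2)[of b] traces_x1(2)[of a] a ab False dir
      by (auto simp: algebra_simps)
  qed
  then show "z y1 b - \<eta> * z y0 a = (A - B) * ((1 + \<eta>) / (2 * m))"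
    using m e by (simp add: field_simps)
  have "\<exists>l \<xi>. a < \<xi> \<and> \<xi> < b \<and> (X has_real_derivative l) (at \<xi>) \<and> X b - X a = (b - a) * l"
    by (rule MVT[OF ab X(1)]) (use X(5) real_differentiable_def in auto)
  then obtain l \<xi> where l: "a < \<xi>" "\<xi> < b" "(X has_real_derivative l) (at \<xi>)"
    "X b - X a = (b - a) * l" by blast
  have "l = \<sigma> * c (X \<xi>) \<xi>" using l X(5)[of \<xi>] DERIV_unique by auto
  then have len: "x1 - x0 = c (X \<xi>) \<xi> * (b - a)" using l(4) X(2,3) dir by (auto simp: algebra_simps)
  have "z (X b) b \<le> z (X \<xi>) \<xi>" "z (X \<xi>) \<xi> \<le> z (X a) a" using along l by auto
  moreover have "z (X b) b > 0" "z (X \<xi>) \<xi> > 0" using z_pos inX[of b] inX[of \<xi>] a ab l by auto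
  ultimately have "z (X b) b powr d \<le> z (X \<xi>) \<xi> powr d" "z (X \<xi>) \<xi> powr d \<le> z (X a) a powr d"
    using d by (auto intro!: powr_mono2)
  then have "c (X b) b \<le> c (X \<xi>) \<xi>" "c (X \<xi>) \<xi> \<le> c (X a) a"
    using cz[of b] cz[of \<xi>] cz[of a] m ab l by auto
  then show "c y1 b * (b - a) \<le> x1 - x0" "x1 - x0 \<le> c y0 a * (b - a)"
    unfolding len using ab X(2,3) by (auto intro!: mult_right_mono)
qed

lemma c_lipschitz:
  "\<exists>K. \<forall>t\<in>{0..T}. \<forall>x\<in>{x0..x1}. \<forall>y\<in>{x0..x1}. \<bar>c x t - c y t\<bar> \<le> K * \<bar>x - y\<bar>"
proof -
  let ?D = "{x0..x1} \<times> {0..T}"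
  have "continuous_on ?D (\<lambda>(x, t). cx x t)"
    using cx by (rule continuous_on_subset) auto
  then have "bounded ((\<lambda>(x, t). cx x t) ` ?D)"
    by (intro compact_imp_bounded compact_continuous_image compact_Times compact_Icc)
  then obtain K where "\<forall>v\<in>(\<lambda>(x, t). cx x t) ` ?D. norm v \<le> K" unfolding bounded_iff by blast
  then have K: "norm (cx x t) \<le> K" if "x \<in> {x0..x1}" "t \<in> {0..T}" for x t using that by fastforce
  have "norm (c x t - c y t) \<le> K * norm (x - y)"
    if "t \<in> {0..T}" "x \<in> {x0..x1}" "y \<in> {x0..x1}" for t x y
    by (rule field_differentiable_bound[of "{x0..x1}" "\<lambda>x. c x t" "\<lambda>x. cx x t"])
      (use that K in \<open>auto intro!: has_partials_on_x[OF c]\<close>)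
  then show ?thesis by (intro exI[of _ K]) auto
qed

text \<open>Gronwall: the squared distance of the two curves times
  \<open>exp (- (2 * K) * t)\<close> cannot grow from 0. At the earlier arrival time both curves are
  therefore at \<open>y1\<close>, while the later one should still be strictly inside the
  strip.\<close>

lemma crossing_unique:
  assumes "crossing c \<sigma> y0 y1 a b" "crossing c \<sigma> y0 y1 a b'" and a: "a \<ge> 0"
    and dir: "\<sigma> = 1 \<and> y0 = x0 \<and> y1 = x1 \<or> \<sigma> = - 1 \<and> y0 = x1 \<and> y1 = x0"
  shows "b = b'"
proof -
  have "b = b'" if cr: "crossing c \<sigma> y0 y1 a b" "crossing c \<sigma> y0 y1 a b'" and le: "b \<le> b'" for b b'
  proof (rule ccontr)
    assume ne: "b \<noteq> b'"
    have ab: "a < b" using cr(1) by (simp add: crossing_def)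
    obtain X where X: "continuous_on {a..b} X" "X a = y0" "X b = y1"
      "\<And>t. t \<in> {a<..<b} \<Longrightarrow> min y0 y1 < X t \<and> X t < max y0 y1"
      "\<And>t. t \<in> {a<..<b} \<Longrightarrow> (X has_real_derivative \<sigma> * c (X t) t) (at t)"
      using cr(1) unfolding crossing_def by blast
    obtain Y where Y: "continuous_on {a..b'} Y" "Y a = y0"
      "\<And>t. t \<in> {a<..<b'} \<Longrightarrow> min y0 y1 < Y t \<and> Y t < max y0 y1"
      "\<And>t. t \<in> {a<..<b'} \<Longrightarrow> (Y has_real_derivative \<sigma> * c (Y t) t) (at t)"
      using cr(2) unfolding crossing_def by blast
    obtain K where K: "\<forall>t\<in>{0..b}. \<forall>x\<in>{x0..x1}. \<forall>y\<in>{x0..x1}. \<bar>c x t - c y t\<bar> \<le> K * \<bar>x - y\<bar>"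
      using c_lipschitz by blast
    define E where "E t = - ((X t - Y t)\<^sup>2 * exp (- (2 * K) * t))" for t
    have "E a \<le> E b"
    proof (rule DERIV_nonneg_imp_increasing_open[where f = E and a = a and b = b])
      show "a \<le> b" using ab by simp
      have "continuous_on {a..b} Y" using Y(1) le by (auto intro: continuous_on_subset)
      then show "continuous_on {a..b} E" unfolding E_def using X(1) by (intro continuous_intros)
      show "\<exists>y. (E has_real_derivative y) (at t) \<and> 0 \<le> y" if t: "a < t" "t < b" for t
      proof -
        let ?w = "X t - Y t" and ?w' = "\<sigma> * c (X t) t - \<sigma> * c (Y t) t" and ?e = "exp (- (2 * K) * t)"
        have D: "(E has_real_derivative - (2 * ?w * ?w' * ?e + ?w\<^sup>2 * (?e * - (2 * K)))) (at t)"
          unfolding E_def using t le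
          by (auto intro!: derivative_eq_intros X(5) Y(4) simp: algebra_simps)
        have "X t \<in> {x0..x1}" "Y t \<in> {x0..x1}"
          using X(4)[of t] Y(3)[of t] dir t le x01 by auto
        then have "\<bar>c (X t) t - c (Y t) t\<bar> \<le> K * \<bar>?w\<bar>" using K t a by auto
        moreover have "\<bar>?w'\<bar> = \<bar>c (X t) t - c (Y t) t\<bar>" using dir by auto
        ultimately have "\<bar>?w\<bar> * \<bar>?w'\<bar> \<le> \<bar>?w\<bar> * (K * \<bar>?w\<bar>)" by (intro mult_left_mono) auto
        moreover have "?w * ?w' \<le> \<bar>?w\<bar> * \<bar>?w'\<bar>" by (simp flip: abs_mult)
        ultimately have "?w * ?w' \<le> K * ?w\<^sup>2" by (simp add: power2_eq_square algebra_simps)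
        then have "0 \<le> 2 * ?e * (K * ?w\<^sup>2 - ?w * ?w')" by simp
        also have "\<dots> = - (2 * ?w * ?w' * ?e + ?w\<^sup>2 * (?e * - (2 * K)))" by (simp add: algebra_simps)
        finally show ?thesis using D by blast
      qed
    qed
    moreover have "E a = 0" using X(2) Y(2) by (simp add: E_def)
    ultimately have "(X b - Y b)\<^sup>2 * exp (- (2 * K) * b) \<le> 0" by (simp add: E_def)
    then have "Y b = y1" using X(3) by (simp add: mult_le_0_iff)
    moreover have "min y0 y1 < Y b \<and> Y b < max y0 y1" using Y(3)[of b] ab le ne by auto
    ultimately show False using dir by auto
  qed
  from this[OF assms(1,2)] this[OF assms(2,1)] show ?thesis by (cases "b \<le> b'") auto
qed

text \<open>When \<open>A = B\<close> the invariant transported by the characteristic, compared with the boundary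
  values of the other one, bounds \<open>z\<close> from below, so the opposite end is reached.\<close>

lemma crossing_exists:
  assumes AB: "A = B" and a: "a \<ge> 0"
    and dir: "\<sigma> = 1 \<and> y0 = x0 \<and> y1 = x1 \<or> \<sigma> = - 1 \<and> y0 = x1 \<and> y1 = x0"
  shows "\<exists>b. crossing c \<sigma> y0 y1 a b"
proof -
  define L where "L = x1 - x0"
  have L: "L > 0" using x01 by (simp add: L_def)
  have line: "y0 + \<sigma> * q \<in> {x0..x1}" if "q \<in> {0..L}" for q using that dir by (auto simp: L_def)
  \<comment> \<open>The transported invariant contributes
    \<open>2 * m * \<eta> / (1 + \<eta>) * z y0 a\<close> to \<open>r - s\<close>, and the other one
    can only add to this; dividing by \<open>2 * m\<close> bounds \<open>z\<close>.\<close>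
  define \<delta> where "\<delta> = m * (\<eta> / (1 + \<eta>) * z y0 a) powr d"
  have zy0: "z y0 a > 0" using z_pos[of y0 a] a dir x01 by auto
  have \<delta>: "\<delta> > 0" using m \<eta> zy0 by (simp add: \<delta>_def)
  \<comment> \<open>\<open>X\<close> measures the distance travelled from \<open>y0\<close>, which
    brings both directions into the same increasing form.\<close>
  obtain b X where bX: "a < b" "continuous_on {a..b} X" "X a = 0" "X b = L"
    "\<And>t. t \<in> {a<..<b} \<Longrightarrow> 0 < X t \<and> X t < L \<and> (X has_real_derivative c (y0 + \<sigma> * X t) t) (at t)"
  proof (rule characteristic_crosses[OF L, of a "\<lambda>q t. c (y0 + \<sigma> * q) t" \<delta>])
    have "continuous_on ({0..L} \<times> {a..}) (\<lambda>q. (\<lambda>(x, t). c x t) (y0 + \<sigma> * fst q, snd q))"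
      by (rule continuous_on_compose2[OF has_partials_on_continuous[OF c]])
        (use line a in \<open>auto intro!: continuous_intros\<close>)
    then show "continuous_on ({0..L} \<times> {a..}) (\<lambda>(q, t). c (y0 + \<sigma> * q) t)"
      by (simp add: case_prod_unfold)
    show "\<exists>K. \<forall>t\<in>{a..T}. \<forall>x\<in>{0..L}. \<forall>y\<in>{0..L}.
      \<bar>c (y0 + \<sigma> * x) t - c (y0 + \<sigma> * y) t\<bar> \<le> K * \<bar>x - y\<bar>" for T
    proof -
      obtain K where K: "\<forall>t\<in>{0..T}. \<forall>x\<in>{x0..x1}. \<forall>y\<in>{x0..x1}. \<bar>c x t - c y t\<bar> \<le> K * \<bar>x - y\<bar>"
        using c_lipschitz by blast
      have "\<bar>(y0 + \<sigma> * x) - (y0 + \<sigma> * y)\<bar> = \<bar>x - y\<bar>" for x y using dir by auto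
      then have "\<bar>c (y0 + \<sigma> * x) t - c (y0 + \<sigma> * y) t\<bar> \<le> K * \<bar>x - y\<bar>"
        if "t \<in> {a..T}" "x \<in> {0..L}" "y \<in> {0..L}" for t x y
        using K[rule_format, OF _ line[OF that(2)] line[OF that(3)], of t] that(1) a by auto
      then show ?thesis by blast
    qed
    show "c (y0 + \<sigma> * x) t > 0" if "x \<in> {0..L}" "a \<le> t" for x t
      using c_pos[OF line[OF that(1)]] that a by auto
    show "\<delta> > 0" by (rule \<delta>)
    show "c (y0 + \<sigma> * X T) T \<ge> \<delta>"
      if T: "a \<le> T" and X: "X a = 0" "continuous_on {a..T} X" "\<And>t. t \<in> {a..T} \<Longrightarrow> X t \<in> {0..L}"
        "\<And>t. t \<in> {a<..<T} \<Longrightarrow> (X has_real_derivative c (y0 + \<sigma> * X t) t) (at t)" for T X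
    proof -
      define Y where "Y t = y0 + \<sigma> * X t" for t
      have Y: "continuous_on {a..T} Y" unfolding Y_def using X(2) by (intro continuous_intros)
      have inY: "Y t \<in> {x0..x1}" if "t \<in> {a..T}" for t unfolding Y_def by (intro line X(3) that)
      have DY: "(Y has_real_derivative \<sigma> * c (Y t) t) (at t)" if "t \<in> {a<..<T}" for t
        unfolding Y_def using X(4)[OF that] by (auto intro!: derivative_eq_intros)
      have const: "\<sigma> = 1 \<Longrightarrow> r (Y T) T = r (Y a) a" "\<sigma> = - 1 \<Longrightarrow> s (Y T) T = s (Y a) a"
        using constant_along_characteristic[OF a T Y inY DY] by blast+
      have Ya: "Y a = y0" using X(1) by (simp add: Y_def)
      have YT: "Y T \<in> {x0..x1}" "x0 \<le> Y T" "Y T \<le> x1" "T \<ge> 0" using inY[of T] T a by auto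
      have K: "2 * m / (1 + \<eta>) * z x0 T \<ge> 0" "2 * m / (1 + \<eta>) * z x1 T \<ge> 0"
        "2 * m * \<eta> / (1 + \<eta>) * z x0 T \<ge> 0" "2 * m * \<eta> / (1 + \<eta>) * z x1 T \<ge> 0"
        using z_pos[of x0 T] z_pos[of x1 T] x01 YT m \<eta> by auto
      have "r (Y T) T - s (Y T) T \<ge> 2 * m * \<eta> / (1 + \<eta>) * z y0 a"
      proof (cases "\<sigma> = 1")
        case True
        have "s (Y T) T \<le> B"
          using mono_in_x(2)[OF YT(2,3) order.refl YT(4)] traces_x1(2)[OF YT(4)] K by linarith
        moreover have "r (Y T) T = A + 2 * m * \<eta> / (1 + \<eta>) * z y0 a"
          using const(1)[OF True] Ya traces_x0(1)[OF a] True dir by auto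
        ultimately show ?thesis using AB by linarith
      next
        case False
        have "r (Y T) T \<ge> A"
          using mono_in_x(1)[OF order.refl YT(2,3,4)] traces_x0(1)[OF YT(4)] K by linarith
        moreover have "s (Y T) T = B - 2 * m * \<eta> / (1 + \<eta>) * z y0 a"
          using const(2) Ya traces_x1(2)[OF a] False dir by auto
        ultimately show ?thesis using AB by linarith
      qed
      then have "(r (Y T) T - s (Y T) T) / (2 * m) \<ge> 2 * m * \<eta> / (1 + \<eta>) * z y0 a / (2 * m)"
        using m by (intro divide_right_mono) auto
      also have "2 * m * \<eta> / (1 + \<eta>) * z y0 a / (2 * m) = \<eta> / (1 + \<eta>) * z y0 a"
        using m by simp
      finally have "z (Y T) T \<ge> \<eta> / (1 + \<eta>) * z y0 a" by (simp add: z_def)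
      then have "(\<eta> / (1 + \<eta>) * z y0 a) powr d \<le> z (Y T) T powr d"
        using \<eta> zy0 d by (intro powr_mono2) auto
      then have "\<delta> \<le> c (Y T) T" unfolding \<delta>_def using c_z[OF YT(1,4)] m by simp
      then show ?thesis by (simp add: Y_def)
    qed
  qed blast
  define Y where "Y t = y0 + \<sigma> * X t" for t
  have "continuous_on {a..b} Y" unfolding Y_def using bX(2) by (intro continuous_intros)
  moreover have "Y a = y0" "Y b = y1" using bX dir by (auto simp: Y_def L_def)
  moreover have "min y0 y1 < Y t \<and> Y t < max y0 y1 \<and> (Y has_real_derivative \<sigma> * c (Y t) t) (at t)"
    if "t \<in> {a<..<b}" for t
  proof -
    have "(Y has_real_derivative \<sigma> * c (Y t) t) (at t)"
      unfolding Y_def using bX(5)[OF that] by (auto intro!: derivative_eq_intros)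
    then show ?thesis using bX(5)[OF that] dir by (auto simp: Y_def L_def)
  qed
  ultimately show ?thesis using bX(1) unfolding crossing_def by blast
qed

lemma bounce_time_nonneg: "bounce_time c x0 x1 n t \<Longrightarrow> t \<ge> 0"
  by (induction rule: bounce_time.induct) (auto simp: crossing_def)

lemma bounce_time_unique: "bounce_time c x0 x1 n t \<Longrightarrow> bounce_time c x0 x1 n t' \<Longrightarrow> t = t'"
proof (induction arbitrary: t' rule: bounce_time.induct)
  case start
  then show ?case by cases auto
next
  case (backward k a b)
  from backward(5) show ?case
  proof cases
    case (backward a')
    then show ?thesis
      using \<open>crossing c (- 1) x1 x0 a b\<close> \<open>bounce_time c x0 x1 k a\<close> crossing_unique[of "- 1" x1 x0 a b t']
        bounce_time_nonneg[of k a] backward.IH by blast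
  qed (use backward in auto)
next
  case (forward k a b)
  from forward(5) show ?case
  proof cases
    case (forward a')
    then show ?thesis
      using \<open>crossing c 1 x0 x1 a b\<close> \<open>bounce_time c x0 x1 k a\<close> crossing_unique[of 1 x0 x1 a b t']
        bounce_time_nonneg[of k a] forward.IH by blast
  qed (use forward in auto)
qed

lemma bounce_time_exists: "A = B \<Longrightarrow> \<exists>t. bounce_time c x0 x1 n t"
proof (induction n)
  case 0
  then show ?case by (blast intro: bounce_time.start)
next
  case (Suc n)
  then obtain a where a: "bounce_time c x0 x1 n a" by blast
  show ?case
  proof (cases "even n")
    case True
    then show ?thesis
      using crossing_exists[OF Suc.prems bounce_time_nonneg[OF a], of "- 1" x1 x0]
        bounce_time.backward[OF a] by blast
  next
    case False
    then show ?thesis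
      using crossing_exists[OF Suc.prems bounce_time_nonneg[OF a], of 1 x0 x1]
        bounce_time.forward[OF a] by blast
  qed
qed

end

subsection \<open>Geometric decay at the bounces\<close>

context rarefaction_strip
begin

definition trace_at :: "nat \<Rightarrow> real \<Rightarrow> real" where
  "trace_at n t = (if even n then z x1 t else z x0 t)"

text \<open>By inversion the first leg starts at time 0, and its defect is a positive multiple of
  \<open>A - B\<close>.\<close>

lemma A_eq_B_iff:
  assumes "bounce_time c x0 x1 1 t"
  shows "A = B \<longleftrightarrow> z x0 t = \<eta> * z x1 0"
proof -
  have "crossing c (- 1) x1 x0 0 t"
    using assms
  proof cases
    case (backward k a)
    from backward(2) have "a = 0" using backward(1) by cases auto
    then show ?thesis using backward by simp
  qed auto
  then have "z x0 t - \<eta> * z x1 0 = (A - B) * ((1 + \<eta>) / (2 * m))"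
    by (rule crossing_facts(2)) auto
  then show ?thesis using m \<eta> by auto
qed

text \<open>The factor by which the reciprocal of the sound speed grows from one bounce to the
  next.\<close>

definition growth :: real where "growth = \<eta> powr (- d)"

lemma growth_gt_1: "growth > 1"
  using \<eta> d powr_less_mono2_neg[of "- d" \<eta> 1] by (simp add: growth_def)

lemma powr_d_eq:
  assumes "v > 0"
  shows "(\<eta> ^ n * v) powr d = v powr d / growth ^ n"
proof -
  have "growth ^ n = \<eta> powr (- (d * n))"
    using \<eta> by (simp add: growth_def powr_powr flip: powr_realpow)
  moreover have "(\<eta> ^ n) powr d = \<eta> powr (d * n)"
    using \<eta> by (simp add: powr_powr mult.commute flip: powr_realpow)
  ultimately show ?thesis using \<eta> assms by (simp add: powr_mult powr_minus divide_inverse)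
qed

lemma powr_growth_power: "(growth ^ n) powr (- 1 / d) = \<eta> ^ n"
  using \<eta> d by (simp add: growth_def powr_powr flip: powr_realpow)

text \<open>Each leg shrinks \<open>z\<close> by the factor \<open>\<eta>\<close>, so the sound speed on the \<open>n\<close>-th leg lies between
  \<open>c\<^sub>0 / growth\<^sup>n\<^sup>+\<^sup>1\<close> and \<open>c\<^sub>0 / growth\<^sup>n\<close>; summing the traversal times is a geometric series.\<close>

lemma bounce_time_bounds:
  assumes AB: "A = B" and "bounce_time c x0 x1 n t"
  shows "trace_at n t = \<eta> ^ n * z x1 0 \<and>
    (growth ^ n - 1) * (x1 - x0) \<le> t * c x1 0 * (growth - 1) \<and>
    t * c x1 0 * (1 - 1 / growth) \<le> (growth ^ n - 1) * (x1 - x0)"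
  using assms(2)
proof induction
  case start
  then show ?case by (simp add: trace_at_def)
next
  have step: "trace_at (Suc k) b = \<eta> ^ Suc k * z x1 0 \<and>
      (growth ^ Suc k - 1) * (x1 - x0) \<le> b * c x1 0 * (growth - 1) \<and>
      b * c x1 0 * (1 - 1 / growth) \<le> (growth ^ Suc k - 1) * (x1 - x0)"
    if a: "a \<ge> 0" and cr: "crossing c \<sigma> y0 y1 a b"
      and dir: "\<sigma> = 1 \<and> y0 = x0 \<and> y1 = x1 \<or> \<sigma> = - 1 \<and> y0 = x1 \<and> y1 = x0"
      and k: "trace_at k a = z y0 a" "trace_at (Suc k) b = z y1 b"
      and IH: "trace_at k a = \<eta> ^ k * z x1 0 \<and>
      (growth ^ k - 1) * (x1 - x0) \<le> a * c x1 0 * (growth - 1) \<and>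
      a * c x1 0 * (1 - 1 / growth) \<le> (growth ^ k - 1) * (x1 - x0)" for \<sigma> y0 y1 a b k
  proof -
    note f = crossing_facts[OF cr a dir]
    have growth: "growth > 1" "growth ^ k > 0" using growth_gt_1 by auto
    have z1: "z x1 0 > 0" using z_pos[of x1 0] x01 by simp
    have y01: "y0 \<in> {x0..x1}" "y1 \<in> {x0..x1}" "b \<ge> 0" using dir x01 f(1) a by auto
    have zb: "z y1 b = \<eta> ^ Suc k * z x1 0" "z y0 a = \<eta> ^ k * z x1 0" using f(2) AB k IH by auto
    have c0: "c x1 0 = m * z x1 0 powr d" using c_z[of x1 0] x01 by simp
    have "c y0 a = c x1 0 / growth ^ k"
      using c_z[OF y01(1) a] zb powr_d_eq[OF z1, of k] c0 by simp
    then have "c x1 0 * (b - a) = c y0 a * (b - a) * growth ^ k" using growth by simp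
    also have "\<dots> \<ge> (x1 - x0) * growth ^ k" using f(4) growth by (intro mult_right_mono) auto
    finally have 1: "(x1 - x0) * growth ^ k \<le> c x1 0 * (b - a)" .
    have "c y1 b = c x1 0 / growth ^ Suc k"
      using c_z[OF y01(2,3)] zb powr_d_eq[OF z1, of "Suc k"] c0 by simp
    then have "c x1 0 * (b - a) = c y1 b * (b - a) * growth ^ Suc k" using growth by simp
    also have "\<dots> \<le> (x1 - x0) * growth ^ Suc k" using f(3) growth by (intro mult_right_mono) auto
    finally have 2: "c x1 0 * (b - a) \<le> (x1 - x0) * growth ^ Suc k" .
    \<comment> \<open>The invariants are closed forms: with \<open>L = x1 - x0\<close> and
      \<open>c0 = c x1 0\<close>, the time of bounce \<open>n\<close> is at least
      \<open>L / c0\<close> times the sum of \<open>growth ^ k\<close> over \<open>k < n\<close>,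
      and at most \<open>L / c0\<close> times the sum of \<open>growth ^ Suc k\<close>.\<close>
    have "(growth ^ Suc k - 1) * (x1 - x0) = (growth ^ k - 1) * (x1 - x0) + (x1 - x0) * growth ^ k * (growth - 1)"
      by (simp add: algebra_simps)
    also have "\<dots> \<le> a * c x1 0 * (growth - 1) + c x1 0 * (b - a) * (growth - 1)"
      using IH 1 growth by (intro add_mono mult_right_mono) auto
    also have "\<dots> = b * c x1 0 * (growth - 1)" by (simp add: algebra_simps)
    finally have 3: "(growth ^ Suc k - 1) * (x1 - x0) \<le> b * c x1 0 * (growth - 1)" .
    have "b * c x1 0 * (1 - 1 / growth) = a * c x1 0 * (1 - 1 / growth) + c x1 0 * (b - a) * (1 - 1 / growth)"
      by (simp add: algebra_simps)
    also have "\<dots> \<le> (growth ^ k - 1) * (x1 - x0) + (x1 - x0) * growth ^ Suc k * (1 - 1 / growth)"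
      using IH 2 growth by (intro add_mono mult_right_mono) auto
    also have "\<dots> = (growth ^ Suc k - 1) * (x1 - x0)" using growth by (simp add: field_simps)
    finally show ?thesis using 3 zb k by simp
  qed
  {
    case (backward k a b)
    then show ?case
      by (intro step[of a "- 1" x1 x0 b k]) (auto simp: trace_at_def bounce_time_nonneg)
  next
    case (forward k a b)
    then show ?case
      by (intro step[of a 1 x0 x1 b k]) (auto simp: trace_at_def bounce_time_nonneg)
  }
qed

text \<open>The time bounds enclose \<open>growth ^ n\<close> between two affine functions of
  \<open>t\<close>; the decreasing power \<open>- 1 / d\<close> turns \<open>growth ^ n\<close> into
  \<open>\<eta> ^ n\<close> and reverses the inequalities.\<close>

lemma bounce_rate:
  assumes AB: "A = B" and b: "bounce_time c x0 x1 n t"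
  shows "z x1 0 * (1 + t * c x1 0 / (x1 - x0) * (\<eta> powr (- d) - 1)) powr (- 1 / d) \<le> trace_at n t"
    "trace_at n t \<le> z x1 0 * (1 + t * c x1 0 / (x1 - x0) * (1 - \<eta> powr d)) powr (- 1 / d)"
proof -
  note B = bounce_time_bounds[OF AB b, THEN conjunct1] bounce_time_bounds[OF AB b, THEN conjunct2]
  have z1: "z x1 0 > 0" using z_pos[of x1 0] x01 by simp
  have c1: "c x1 0 > 0" using c_pos[of x1 0] x01 by simp
  have t: "t \<ge> 0" using b by (rule bounce_time_nonneg)
  have growth: "growth > 1" "growth ^ n > 0" using growth_gt_1 by auto
  have tr: "trace_at n t = z x1 0 * (growth ^ n) powr (- 1 / d)" using B(1) powr_growth_power[of n] by simp
  have L: "x1 - x0 > 0" using x01 by simp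
  have 1: "growth ^ n \<le> 1 + t * c x1 0 / (x1 - x0) * (\<eta> powr (- d) - 1)"
    using B(2) L by (simp add: field_simps flip: growth_def)
  have "\<eta> powr d = 1 / growth" by (simp add: growth_def powr_minus divide_inverse)
  then have 2: "1 + t * c x1 0 / (x1 - x0) * (1 - \<eta> powr d) \<le> growth ^ n"
    using B(2) L by (simp add: field_simps)
  have "1 / growth \<le> 1" using growth by simp
  then have 3: "1 + t * c x1 0 / (x1 - x0) * (1 - \<eta> powr d) > 0"
    using t c1 L \<open>\<eta> powr d = 1 / growth\<close> by (intro add_pos_nonneg mult_nonneg_nonneg) auto
  have e: "- 1 / d \<le> 0" using d by simp
  show "z x1 0 * (1 + t * c x1 0 / (x1 - x0) * (\<eta> powr (- d) - 1)) powr (- 1 / d) \<le> trace_at n t"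
    unfolding tr using z1 by (intro mult_left_mono powr_mono2' e 1 growth) auto
  show "trace_at n t \<le> z x1 0 * (1 + t * c x1 0 / (x1 - x0) * (1 - \<eta> powr d)) powr (- 1 / d)"
    unfolding tr using z1 by (intro mult_left_mono powr_mono2' e 2 3) auto
qed

section \<open>From bounce times to all times\<close>

text \<open>The lower bound on the bounce times is geometric, so they exceed any given
  \<open>t\<close>. The first one to do so is not the initial one, since that takes place at time
  0.\<close>

lemma bounce_bracket:
  assumes AB: "A = B" and t: "t \<ge> 0"
  obtains n a b where "bounce_time c x0 x1 n a" "bounce_time c x0 x1 (Suc n) b" "a \<le> t" "t < b"
proof -
  have "\<forall>n. \<exists>t. bounce_time c x0 x1 n t" using bounce_time_exists[OF AB] by blast
  then obtain T where T: "\<And>n. bounce_time c x0 x1 n (T n)" by metis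
  have growth: "growth > 1" using growth_gt_1 .
  have L: "x1 - x0 > 0" using x01 by simp
  obtain N where N: "t * c x1 0 * (growth - 1) / (x1 - x0) + 1 < growth ^ N"
    using real_arch_pow[OF growth] by blast
  have "t * c x1 0 * (growth - 1) < (growth ^ N - 1) * (x1 - x0)"
    using N L by (simp add: field_simps)
  also have "\<dots> \<le> T N * c x1 0 * (growth - 1)" using bounce_time_bounds[OF AB T] by blast
  finally have "t * (c x1 0 * (growth - 1)) < T N * (c x1 0 * (growth - 1))" by (simp add: mult.assoc)
  moreover have "c x1 0 * (growth - 1) > 0" using growth c_pos[of x1 0] x01 by simp
  ultimately have tN: "t < T N" by (simp add: mult_less_cancel_right)
  define k where "k = (LEAST n. t < T n)"
  have k: "t < T k" unfolding k_def using tN by (rule LeastI)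
  have "T 0 = 0" using bounce_time_unique[OF T bounce_time.start] .
  then have "k \<noteq> 0" using k t by (cases k) auto
  then obtain n where n: "k = Suc n" by (cases k) auto
  have "\<not> t < T n" using not_less_Least[of n "\<lambda>n. t < T n"] n k_def by simp
  then show thesis using that[OF T T, of n] k n by simp
qed

lemma bounce_time_mono:
  assumes "bounce_time c x0 x1 (Suc n) b" "bounce_time c x0 x1 n a"
  shows "a \<le> b"
  using assms(1)
  by cases (use bounce_time_unique[OF assms(2)] in \<open>fastforce simp: crossing_def\<close>)+

text \<open>Each trace decreases in time, so its value at a bounce bounds it from above afterwards
  and from below before. Between bounces \<open>n\<close> and \<open>n + 1\<close>, the end of
  bounce \<open>n\<close> is controlled since that bounce, and the other end by bounce
  \<open>n + 1\<close> from below and by bounce \<open>n - 1\<close> from above.\<close>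

lemma trace_sum_bracket:
  assumes AB: "A = B"
  obtains K where "K > 0" "\<And>n a b t. bounce_time c x0 x1 n a \<Longrightarrow> bounce_time c x0 x1 (Suc n) b \<Longrightarrow>
    a \<le> t \<Longrightarrow> t \<le> b \<Longrightarrow> \<eta> ^ Suc n * z x1 0 \<le> z x0 t + z x1 t \<and> z x0 t + z x1 t \<le> K * \<eta> ^ n"
proof -
  have tr: "trace_at n u \<le> trace_at n t" if "0 \<le> t" "t \<le> u" for n t u
    using trace_decreasing[OF that] by (simp add: trace_at_def)
  have sum: "z x0 t + z x1 t = trace_at n t + trace_at (Suc n) t" for n t by (simp add: trace_at_def)
  have tpos: "trace_at n t > 0" if "t \<ge> 0" for n t
    using z_pos[of x0 t] z_pos[of x1 t] x01 that by (simp add: trace_at_def)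
  have z1: "z x1 0 > 0" "z x0 0 > 0" using z_pos x01 by auto
  note val = bounce_time_bounds[OF AB, THEN conjunct1]
  \<comment> \<open>The first term serves the end just visited. The other end needs
    \<open>z x1 0 / \<eta>\<close> because its last visit was one bounce earlier, and
    \<open>z x0 0\<close> for \<open>n = 0\<close>, when it has not been visited at all.\<close>
  define K where "K = z x1 0 + (z x1 0 / \<eta> + z x0 0)"
  show thesis
  proof (rule that[of K])
    show "K > 0" using z1 \<eta> by (simp add: K_def add_pos_pos)
    fix n a b t
    assume ab: "bounce_time c x0 x1 n a" "bounce_time c x0 x1 (Suc n) b" "a \<le> t" "t \<le> b"
    have a: "a \<ge> 0" using bounce_time_nonneg[OF ab(1)] .
    have "\<eta> ^ Suc n * z x1 0 \<le> trace_at (Suc n) t" using val[OF ab(2)] tr[of t b "Suc n"] a ab by simp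
    moreover have "trace_at n t > 0" using tpos a ab by simp
    ultimately have 1: "\<eta> ^ Suc n * z x1 0 \<le> z x0 t + z x1 t" unfolding sum[of t n] by linarith
    have 2: "trace_at n t \<le> \<eta> ^ n * z x1 0" using val[OF ab(1)] tr[of a t n] a ab by simp
    have 3: "trace_at (Suc n) t \<le> \<eta> ^ n * (z x1 0 / \<eta> + z x0 0)"
    proof (cases n)
      case 0
      have "trace_at (Suc n) t \<le> trace_at (Suc n) 0" using a ab by (intro tr) auto
      also have "\<dots> = z x0 0" using 0 by (simp add: trace_at_def)
      also have "\<dots> \<le> \<eta> ^ n * (z x1 0 / \<eta> + z x0 0)" using 0 z1 \<eta> by simp
      finally show ?thesis .
    next
      case (Suc k)
      obtain a' where a': "bounce_time c x0 x1 k a'" using bounce_time_exists[OF AB] by blast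
      have "a' \<le> a" using bounce_time_mono[OF ab(1)[unfolded Suc] a'] .
      then have "trace_at k t \<le> trace_at k a'" using bounce_time_nonneg[OF a'] ab by (intro tr) auto
      also have "\<dots> = \<eta> ^ k * z x1 0" by (rule val[OF a'])
      also have "\<dots> = \<eta> ^ n * (z x1 0 / \<eta>)" using Suc \<eta> by simp
      also have "\<dots> \<le> \<eta> ^ n * (z x1 0 / \<eta> + z x0 0)" using z1 \<eta> by (intro mult_left_mono) auto
      finally show ?thesis using Suc by (simp add: trace_at_def)
    qed
    have "z x0 t + z x1 t \<le> K * \<eta> ^ n"
      unfolding sum[of t n] using 2 3 by (simp add: K_def algebra_simps)
    with 1 show "\<eta> ^ Suc n * z x1 0 \<le> z x0 t + z x1 t \<and> z x0 t + z x1 t \<le> K * \<eta> ^ n" by blast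
  qed
qed

text \<open>Between consecutive bounces \<open>growth ^ n\<close> is comparable to
  \<open>1 + t\<close>, so \<open>\<eta> ^ n\<close> is comparable to the power
  \<open>- 1 / d\<close> of \<open>1 + t\<close>.\<close>

lemma trace_sum_rate:
  assumes AB: "A = B"
  obtains C1 C2 where "C1 > 0" "C2 > 0" "\<And>t. t \<ge> 0 \<Longrightarrow>
    C1 * (1 + t) powr (- 1 / d) \<le> z x0 t + z x1 t \<and> z x0 t + z x1 t \<le> C2 * (1 + t) powr (- 1 / d)"
proof -
  obtain K where K: "K > 0" "\<And>n a b t. bounce_time c x0 x1 n a \<Longrightarrow> bounce_time c x0 x1 (Suc n) b \<Longrightarrow>
    a \<le> t \<Longrightarrow> t \<le> b \<Longrightarrow> \<eta> ^ Suc n * z x1 0 \<le> z x0 t + z x1 t \<and> z x0 t + z x1 t \<le> K * \<eta> ^ n"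
    using trace_sum_bracket[OF AB] by blast
  have growth: "growth > 1" using growth_gt_1 .
  have L: "x1 - x0 > 0" using x01 by simp
  have c0: "c x1 0 > 0" using c_pos[of x1 0] x01 by simp
  have z1: "z x1 0 > 0" using z_pos[of x1 0] x01 by simp
  define q1 where "q1 = c x1 0 * (growth - 1)"
  define q2 where "q2 = c x1 0 * (1 - 1 / growth)"
  have q: "q1 > 0" "q2 > 0" using growth c0 by (simp_all add: q1_def q2_def)
  \<comment> \<open>Together with \<open>k1 \<le> 1\<close>, the bound
    \<open>(growth ^ n - 1) * k1 \<le> a\<close> gives
    \<open>k1 * growth ^ n \<le> 1 + t\<close>.\<close>
  define k1 where "k1 = min 1 ((x1 - x0) / q1)"
  \<comment> \<open>The summand 1 absorbs the 1 in \<open>1 + t\<close>, since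
    \<open>growth ^ n \<ge> 1\<close>; the factor \<open>growth\<close> comes from using bounce
    \<open>Suc n\<close>.\<close>
  define k2 where "k2 = 1 + (x1 - x0) * growth / q2"
  have k: "k1 > 0" "k2 > 0" using L q growth by (simp_all add: k1_def k2_def add_pos_pos)
  have e: "- 1 / d \<le> 0" using d by simp
  show thesis
  proof (rule that[of "\<eta> * z x1 0 / k1 powr (- 1 / d)" "K / k2 powr (- 1 / d)"])
    show "\<eta> * z x1 0 / k1 powr (- 1 / d) > 0" "K / k2 powr (- 1 / d) > 0"
      using \<eta> z1 k K(1) by simp_all
    fix t :: real assume t: "t \<ge> 0"
    obtain n a b where nab: "bounce_time c x0 x1 n a" "bounce_time c x0 x1 (Suc n) b" "a \<le> t" "t < b"
      using bounce_bracket[OF AB t] by blast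
    have yn: "growth ^ n \<ge> 1" using growth by simp
    have "(growth ^ n - 1) * (x1 - x0) \<le> a * q1"
      using bounce_time_bounds[OF AB nab(1)] by (simp add: q1_def mult.assoc)
    then have "(growth ^ n - 1) * ((x1 - x0) / q1) \<le> a" using q by (simp add: field_simps)
    moreover have "(growth ^ n - 1) * k1 \<le> (growth ^ n - 1) * ((x1 - x0) / q1)"
      using yn by (intro mult_left_mono) (auto simp: k1_def)
    ultimately have "(growth ^ n - 1) * k1 \<le> a" by linarith
    moreover have "k1 \<le> 1" by (simp add: k1_def)
    ultimately have low: "k1 * growth ^ n \<le> 1 + t" using nab(3) by (simp add: algebra_simps)
    have "b * q2 \<le> (growth ^ Suc n - 1) * (x1 - x0)"
      using bounce_time_bounds[OF AB nab(2)] by (simp add: q2_def mult.assoc)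
    also have "\<dots> \<le> growth ^ Suc n * (x1 - x0)" using L by (intro mult_right_mono) auto
    finally have "b \<le> growth ^ n * ((x1 - x0) * growth / q2)" using q by (simp add: field_simps)
    then have high: "1 + t \<le> k2 * growth ^ n" using nab(4) yn by (simp add: k2_def algebra_simps)
    have "(1 + t) powr (- 1 / d) \<le> (k1 * growth ^ n) powr (- 1 / d)"
      using e low k yn by (intro powr_mono2') auto
    also have "\<dots> = k1 powr (- 1 / d) * \<eta> ^ n"
      using k growth powr_mult[of k1 "growth ^ n" "- 1 / d"] unfolding powr_growth_power by auto
    finally have "(1 + t) powr (- 1 / d) \<le> k1 powr (- 1 / d) * \<eta> ^ n" .
    then have "\<eta> * z x1 0 / k1 powr (- 1 / d) * (1 + t) powr (- 1 / d)
        \<le> \<eta> * z x1 0 / k1 powr (- 1 / d) * (k1 powr (- 1 / d) * \<eta> ^ n)"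
      using \<eta> z1 k by (intro mult_left_mono) auto
    also have "\<dots> = \<eta> ^ Suc n * z x1 0" using k by simp
    also have "\<dots> \<le> z x0 t + z x1 t" using K(2)[OF nab(1-3)] nab(4) by simp
    finally have 1: "\<eta> * z x1 0 / k1 powr (- 1 / d) * (1 + t) powr (- 1 / d) \<le> z x0 t + z x1 t" .
    have "k2 powr (- 1 / d) * \<eta> ^ n = (k2 * growth ^ n) powr (- 1 / d)"
      using k growth powr_mult[of k2 "growth ^ n" "- 1 / d"] unfolding powr_growth_power by auto
    also have "\<dots> \<le> (1 + t) powr (- 1 / d)" using e high t by (intro powr_mono2') auto
    finally have "K / k2 powr (- 1 / d) * (k2 powr (- 1 / d) * \<eta> ^ n)
        \<le> K / k2 powr (- 1 / d) * (1 + t) powr (- 1 / d)"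
      using K(1) k by (intro mult_left_mono) auto
    moreover have "K / k2 powr (- 1 / d) * (k2 powr (- 1 / d) * \<eta> ^ n) = K * \<eta> ^ n" using k by simp
    moreover have "z x0 t + z x1 t \<le> K * \<eta> ^ n" using K(2)[OF nab(1-3)] nab(4) by simp
    ultimately show "\<eta> * z x1 0 / k1 powr (- 1 / d) * (1 + t) powr (- 1 / d) \<le> z x0 t + z x1 t \<and>
      z x0 t + z x1 t \<le> K / k2 powr (- 1 / d) * (1 + t) powr (- 1 / d)" using 1 by linarith
  qed
qed

text \<open>Monotonicity in \<open>x\<close> puts \<open>r - s\<close> between
  \<open>r x0 t - s x1 t\<close> and \<open>r x1 t - s x0 t\<close>. With \<open>A = B\<close> the
  constants cancel in both, and the trace formulas leave multiples of the sum of the two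
  traces.\<close>

lemma z_rate:
  assumes AB: "A = B"
  obtains C1 C2 where "C1 > 0" "C2 > 0" "\<And>x t. x \<in> {x0..x1} \<Longrightarrow> t \<ge> 0 \<Longrightarrow>
    C1 * (1 + t) powr (- 1 / d) \<le> z x t \<and> z x t \<le> C2 * (1 + t) powr (- 1 / d)"
proof -
  obtain C1 C2 where C: "C1 > 0" "C2 > 0" "\<And>t. t \<ge> 0 \<Longrightarrow>
    C1 * (1 + t) powr (- 1 / d) \<le> z x0 t + z x1 t \<and> z x0 t + z x1 t \<le> C2 * (1 + t) powr (- 1 / d)"
    using trace_sum_rate[OF AB] by blast
  have m2: "2 * m > 0" using m by simp
  show thesis
  proof (rule that[of "\<eta> / (1 + \<eta>) * C1" "1 / (1 + \<eta>) * C2"])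
    show "\<eta> / (1 + \<eta>) * C1 > 0" "1 / (1 + \<eta>) * C2 > 0" using C \<eta> by auto
    fix x t :: real assume xt: "x \<in> {x0..x1}" "t \<ge> 0"
    then have x: "x0 \<le> x" "x \<le> x1" by auto
    have "2 * m * z x t = r x t - s x t" using m by (simp add: z_def)
    then have "2 * m * \<eta> / (1 + \<eta>) * (z x0 t + z x1 t) \<le> 2 * m * z x t"
      "2 * m * z x t \<le> 2 * m / (1 + \<eta>) * (z x0 t + z x1 t)"
      using mono_in_x[OF order.refl x xt(2)] mono_in_x[OF x order.refl xt(2)]
        traces_x0[OF xt(2)] traces_x1[OF xt(2)] AB by (simp_all add: distrib_left)
    then have "2 * m * (\<eta> / (1 + \<eta>) * (z x0 t + z x1 t)) \<le> 2 * m * z x t"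
      "2 * m * z x t \<le> 2 * m * (1 / (1 + \<eta>) * (z x0 t + z x1 t))" by simp_all
    then have "\<eta> / (1 + \<eta>) * (z x0 t + z x1 t) \<le> z x t" "z x t \<le> 1 / (1 + \<eta>) * (z x0 t + z x1 t)"
      using m2 by (simp_all only: mult_le_cancel_left_pos)
    moreover have "\<eta> / (1 + \<eta>) * (C1 * (1 + t) powr (- 1 / d)) \<le> \<eta> / (1 + \<eta>) * (z x0 t + z x1 t)"
      "1 / (1 + \<eta>) * (z x0 t + z x1 t) \<le> 1 / (1 + \<eta>) * (C2 * (1 + t) powr (- 1 / d))"
      using C(3)[OF xt(2)] \<eta> by (intro mult_left_mono; simp)+
    ultimately show "\<eta> / (1 + \<eta>) * C1 * (1 + t) powr (- 1 / d) \<le> z x t \<and>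
      z x t \<le> 1 / (1 + \<eta>) * C2 * (1 + t) powr (- 1 / d)" by (simp add: mult.assoc)
  qed
qed

end

subsection \<open>Outer invariants and reflection conditions\<close>

text \<open>The volume and energy equations are traded for \<open>p_t = - c^2 u_x\<close>, which
  uses only the quantities that are continuous across a contact.\<close>

definition reduced_euler ::
  "(real \<Rightarrow> real \<Rightarrow> real) \<Rightarrow> (real \<Rightarrow> real \<Rightarrow> real) \<Rightarrow> (real \<Rightarrow> real \<Rightarrow> real) \<Rightarrow> real \<Rightarrow> real \<Rightarrow> bool"
where
  "reduced_euler c u p x t \<longleftrightarrow> (\<exists>ux px.
      ((\<lambda>y. u y t) has_real_derivative ux) (at x) \<and> ((\<lambda>y. p y t) has_real_derivative px) (at x) \<and>
      (u x has_real_derivative - px) (at t) \<and> (p x has_real_derivative - (c x t)\<^sup>2 * ux) (at t))"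

lemma has_partials_on_const: "has_partials_on (\<lambda>_ _. k) (\<lambda>_ _. 0) (\<lambda>_ _. 0) A"
  by (rule has_partials_onI) (auto intro!: derivative_eq_intros)

lemma has_partials_on_minus_const:
  "has_partials_on f fx ft A \<Longrightarrow> has_partials_on (\<lambda>x t. f x t - k) fx ft A"
  using has_partials_on_lincomb[of f fx ft A "\<lambda>_ _. k" "\<lambda>_ _. 0" "\<lambda>_ _. 0" 1 "- 1"]
  by (simp add: has_partials_on_const)

text \<open>Both invariants minus their initial constants are fed to
  \<open>half_line_constant\<close>; the forward one then stays constant up to the edge, whatever
  waves leave the strip through it.\<close>

lemma forward_invariant_left:
  fixes a :: real and u p :: "real \<Rightarrow> real \<Rightarrow> real"
  assumes \<mu>: "\<mu> > 0" and d: "d > 1"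
    and u: "C2_on u ({..a} \<times> {0..})" and p: "C2_on p ({..a} \<times> {0..})"
    and pos: "\<And>x t. t \<ge> 0 \<Longrightarrow> p x t > 0"
    and euler: "\<And>x t. x < a \<Longrightarrow> t > 0 \<Longrightarrow>
      reduced_euler (\<lambda>x t. \<mu> * z_of_p \<mu> d (p x t) powr d) u p x t"
    and ini: "\<And>x. x \<le> a \<Longrightarrow> u x 0 = u a 0 \<and> p x 0 = p a 0" and t: "t \<ge> 0"
  shows "u a t + \<mu> * z_of_p \<mu> d (p a t) = u a 0 + \<mu> * z_of_p \<mu> d (p a 0)"
proof -
  let ?A = "{..a} \<times> {0::real..}"
  let ?Z = "\<lambda>x t. z_of_p \<mu> d (p x t)"
  let ?c = "\<lambda>x t. \<mu> * ?Z x t powr d"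
  have A: "closed ?A" "convex ?A" "interior ?A \<noteq> {}"
    by (auto intro: closed_Times convex_Times simp: interior_Times interior_real_atMost interior_real_atLeast)
  have posA: "p x t > 0" if "(x, t) \<in> ?A" for x t using pos that by auto
  have Zpos: "?Z x t > 0" if "(x, t) \<in> ?A" for x t using z_of_p_pos[OF \<mu> d posA[OF that]] .
  have E: "\<exists>ux px. ((\<lambda>y. u y t) has_real_derivative ux) (at x) \<and>
      ((\<lambda>y. p y t) has_real_derivative px) (at x) \<and> (u x has_real_derivative - px) (at t) \<and>
      (p x has_real_derivative - (?c x t)\<^sup>2 * ux) (at t)" if "(x, t) \<in> interior ?A" for x t
    using euler[of x t] that
    by (auto simp: interior_Times interior_real_atMost interior_real_atLeast reduced_euler_def)
  obtain cx ct where c: "has_partials_on ?c cx ct ?A" "continuous_on ?A (\<lambda>(x, t). cx x t)"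
    using sound_speed_partials[OF \<mu> d p posA] by blast
  note R = riemann_invariant_gradient[OF A \<mu> d _ u p posA refl c E]
  obtain \<alpha> where \<alpha>: "has_partials_on (\<lambda>x t. u x t + 1 * \<mu> * ?Z x t) \<alpha> (\<lambda>x t. - (1 * ?c x t * \<alpha> x t)) ?A"
    using R[of 1] by (metis mult_1)
  obtain \<beta> where \<beta>: "has_partials_on (\<lambda>x t. u x t + - 1 * \<mu> * ?Z x t) \<beta> (\<lambda>x t. - (- 1 * ?c x t * \<beta> x t)) ?A"
    using R[of "- 1"] by (metis mult_minus1 minus_minus)
  let ?r0 = "u a 0 + 1 * \<mu> * ?Z a 0" and ?s0 = "u a 0 + - 1 * \<mu> * ?Z a 0"
  have "u a t + 1 * \<mu> * ?Z a t - ?r0 = 0"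
  proof (rule half_line_constant[where c = ?c, OF has_partials_on_minus_const[OF \<alpha>] _
        has_partials_on_minus_const[OF \<beta>, of ?s0] _ _ _ _ _ _ t])
    show "?c x t > 0" if "(x, t) \<in> ?A" for x t using Zpos[OF that] \<mu> by simp
    show "u x 0 + 1 * \<mu> * ?Z x 0 - ?r0 = 0" "u x 0 + - 1 * \<mu> * ?Z x 0 - ?s0 = 0" if "x \<le> a" for x
      using ini[OF that] by simp_all
    show "(1::real) > 0" by simp
    \<comment> \<open>\<open>\<mu> * z\<close> is half the difference of the invariants, so moving
      each by at most 1 changes it by at most 1. This provides the speed bound \<open>M\<close> for
      deviations up to \<open>\<delta> = 1\<close>.\<close>
    show "?c x t \<le> \<mu> * (?Z a 0 + 1 / \<mu>) powr d"
      if xt: "(x, t) \<in> ?A" and w: "\<bar>u x t + 1 * \<mu> * ?Z x t - ?r0\<bar> \<le> 1"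
        "\<bar>u x t + - 1 * \<mu> * ?Z x t - ?s0\<bar> \<le> 1" for x t
    proof -
      have "\<bar>(u x t + \<mu> * ?Z x t) - (u a 0 + \<mu> * ?Z a 0)\<bar> \<le> 1"
        "\<bar>(u x t - \<mu> * ?Z x t) - (u a 0 - \<mu> * ?Z a 0)\<bar> \<le> 1" using w by simp_all
      moreover have "2 * v \<le> 2 * (v0 + 1)"
        if "\<bar>(w + v) - (w0 + v0)\<bar> \<le> 1" "\<bar>(w - v) - (w0 - v0)\<bar> \<le> 1" for v w v0 w0 :: real
        using that by (simp add: abs_le_iff)
      ultimately have "2 * (\<mu> * ?Z x t) \<le> 2 * (\<mu> * ?Z a 0 + 1)" by blast
      then have "?Z x t \<le> ?Z a 0 + 1 / \<mu>" using \<mu> by (simp add: field_simps)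
      then have "?Z x t powr d \<le> (?Z a 0 + 1 / \<mu>) powr d"
        using Zpos[OF xt] d by (intro powr_mono2) auto
      then show ?thesis using \<mu> by simp
    qed
  qed auto
  then show ?thesis by simp
qed

text \<open>The factor \<open>k\<close> is \<open>- 1\<close> for the velocity and 1 for the
  pressure when the right half line is mirrored.\<close>

lemma C2_on_reflect:
  fixes f :: "real \<Rightarrow> real \<Rightarrow> real"
  assumes "C2_on f ({a..} \<times> T)"
  shows "C2_on (\<lambda>x t. k * f (- x) t) ({..- a} \<times> T)"
proof -
  let ?A = "{a..} \<times> T" and ?B = "{..- a} \<times> T"
  have P: "has_partials_on (\<lambda>x t. k * g (- x) t) (\<lambda>x t. (- k) * gx (- x) t) (\<lambda>x t. k * gt (- x) t) ?B"
    if g: "has_partials_on g gx gt ?A" for g gx gt k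
  proof (rule has_partials_onI)
    fix x t assume xt: "(x, t) \<in> ?B"
    have "((\<lambda>q. g (fst q) (snd q)) has_derivative (\<lambda>q. gx (- x) t * fst q + gt (- x) t * snd q))
        (at (- x, t) within (\<lambda>q. (- fst q, snd q)) ` ?B)"
      by (rule has_derivative_subset[OF has_partials_onD[OF g]]) (use xt in auto)
    then have "((\<lambda>q. g (fst q) (snd q)) has_derivative (\<lambda>q. gx (- x) t * fst q + gt (- x) t * snd q))
        (at ((\<lambda>q. (- fst q, snd q)) (x, t)) within (\<lambda>q. (- fst q, snd q)) ` ?B)" by simp
    moreover have "((\<lambda>q. (- fst q, snd q)) has_derivative (\<lambda>q. (- fst q, snd q))) (at (x, t) within ?B)"
      by (auto intro!: derivative_eq_intros)
    ultimately have "((\<lambda>q. g (fst ((\<lambda>q. (- fst q, snd q)) q)) (snd ((\<lambda>q. (- fst q, snd q)) q)))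
        has_derivative (\<lambda>q. gx (- x) t * fst ((\<lambda>q. (- fst q, snd q)) q) + gt (- x) t * snd ((\<lambda>q. (- fst q, snd q)) q)))
        (at (x, t) within ?B)"
      by (rule has_derivative_in_compose[rotated])
    then have "((\<lambda>q. k * g (- fst q) (snd q)) has_derivative
        (\<lambda>q. k * (gx (- x) t * (- fst q) + gt (- x) t * snd q))) (at (x, t) within ?B)"
      by (intro has_derivative_mult_right) simp
    then show "((\<lambda>q. k * g (- fst q) (snd q)) has_derivative
        (\<lambda>q. (- k) * gx (- x) t * fst q + k * gt (- x) t * snd q)) (at (x, t) within ?B)"
      by (simp add: algebra_simps)
  qed
  have C: "continuous_on ?B (\<lambda>(x, t). k * g (- x) t)" if g: "continuous_on ?A (\<lambda>(x, t). g x t)"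
    for g :: "real \<Rightarrow> real \<Rightarrow> real" and k
  proof -
    have "continuous_on ?B (\<lambda>q. (\<lambda>(x, t). g x t) (- fst q, snd q))"
      by (rule continuous_on_compose2[OF g]) (auto intro!: continuous_intros)
    then show ?thesis
      by (auto simp: case_prod_unfold intro!: continuous_intros)
  qed
  obtain fx ft fxx fxt ftx ftt where f: "has_partials_on f fx ft ?A" "has_partials_on fx fxx fxt ?A"
    "has_partials_on ft ftx ftt ?A" "continuous_on ?A (\<lambda>(x, t). fxx x t)"
    "continuous_on ?A (\<lambda>(x, t). fxt x t)" "continuous_on ?A (\<lambda>(x, t). ftx x t)"
    "continuous_on ?A (\<lambda>(x, t). ftt x t)"
    using assms unfolding C2_on_def by blast
  show ?thesis
    unfolding C2_on_def
    by (intro exI conjI, rule P[OF f(1)], rule P[OF f(2)], rule P[OF f(3)])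
      (rule C f)+
qed

text \<open>The equations are invariant under \<open>x\<close> to \<open>- x\<close> and
  \<open>u\<close> to \<open>- u\<close>, which exchanges forward and backward invariants.\<close>

lemma backward_invariant_right:
  fixes b :: real and u p :: "real \<Rightarrow> real \<Rightarrow> real"
  assumes \<mu>: "\<mu> > 0" and d: "d > 1"
    and u: "C2_on u ({b..} \<times> {0..})" and p: "C2_on p ({b..} \<times> {0..})"
    and pos: "\<And>x t. t \<ge> 0 \<Longrightarrow> p x t > 0"
    and euler: "\<And>x t. x > b \<Longrightarrow> t > 0 \<Longrightarrow>
      reduced_euler (\<lambda>x t. \<mu> * z_of_p \<mu> d (p x t) powr d) u p x t"
    and ini: "\<And>x. x \<ge> b \<Longrightarrow> u x 0 = u b 0 \<and> p x 0 = p b 0" and t: "t \<ge> 0"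
  shows "u b t - \<mu> * z_of_p \<mu> d (p b t) = u b 0 - \<mu> * z_of_p \<mu> d (p b 0)"
proof -
  define u' where "u' x t = - 1 * u (- x) t" for x t
  define p' where "p' x t = 1 * p (- x) t" for x t
  have "u' (- b) t + \<mu> * z_of_p \<mu> d (p' (- b) t) = u' (- b) 0 + \<mu> * z_of_p \<mu> d (p' (- b) 0)"
  proof (rule forward_invariant_left[OF \<mu> d _ _ _ _ _ t])
    show "C2_on u' ({..- b} \<times> {0..})" "C2_on p' ({..- b} \<times> {0..})"
      unfolding u'_def p'_def by (intro C2_on_reflect u p)+
    show "p' x t > 0" if "t \<ge> 0" for x t using pos[OF that] by (simp add: p'_def)
    show "u' x 0 = u' (- b) 0 \<and> p' x 0 = p' (- b) 0" if "x \<le> - b" for x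
      using ini[of "- x"] that by (simp add: u'_def p'_def)
    show "reduced_euler (\<lambda>x t. \<mu> * z_of_p \<mu> d (p' x t) powr d) u' p' x t" if "x < - b" "t > 0" for x t
    proof -
      obtain ux px where e: "((\<lambda>y. u y t) has_real_derivative ux) (at (- x))"
        "((\<lambda>y. p y t) has_real_derivative px) (at (- x))"
        "(u (- x) has_real_derivative - px) (at t)"
        "(p (- x) has_real_derivative - (\<mu> * z_of_p \<mu> d (p (- x) t) powr d)\<^sup>2 * ux) (at t)"
        using euler[of "- x" t] \<open>x < - b\<close> \<open>t > 0\<close> unfolding reduced_euler_def by auto
      have n: "(uminus has_real_derivative - 1) (at x)" by (auto intro!: derivative_eq_intros)
      show ?thesis
        unfolding reduced_euler_def
      proof (intro exI conjI)
        show "((\<lambda>y. u' y t) has_real_derivative ux) (at x)"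
          using DERIV_minus[OF DERIV_chain2[OF e(1) n]] by (simp add: u'_def)
        show "((\<lambda>y. p' y t) has_real_derivative - px) (at x)"
          using DERIV_chain2[OF e(2) n] by (simp add: p'_def)
        show "(u' x has_real_derivative - (- px)) (at t)"
          using DERIV_minus[OF e(3)] by (simp add: u'_def[abs_def])
        show "(p' x has_real_derivative - (\<mu> * z_of_p \<mu> d (p' x t) powr d)\<^sup>2 * ux) (at t)"
          using e(4) by (simp add: p'_def[abs_def])
      qed
    qed
  qed
  then show ?thesis by (simp add: u'_def p'_def)
qed

text \<open>Applied with the outer entropy to obtain the reflections, and with the unspecified
  entropy values at the two contacts to obtain the rates on the closed interval.\<close>

lemma z_of_p_scale:
  assumes "\<mu> > 0" "m > 0" "d > 1" "y > 0"
  shows "z_of_p \<mu> d y = ((m / \<mu>)\<^sup>2) powr (1 / (d + 1)) * z_of_p m d y"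
proof -
  have "z_of_p \<mu> d y = ((m / \<mu>)\<^sup>2 * ((d + 1) / m\<^sup>2 * y)) powr (1 / (d + 1))"
    using assms unfolding z_of_p_def by (simp add: power_divide)
  also have "\<dots> = ((m / \<mu>)\<^sup>2) powr (1 / (d + 1)) * z_of_p m d y"
    unfolding z_of_p_def by (intro powr_mult)
  finally show ?thesis .
qed

text \<open>Continuity of \<open>u\<close> and \<open>p\<close> across a contact turns the constant outer invariant into a
  reflection condition with coefficient \<open>- \<eta>\<close>; \<open>1 / Q\<close> is the ratio \<open>m\<^sub>* z\<^sub>* / (m z)\<close>.\<close>

lemma impedance_ratio:
  assumes "mstar > 0" "m > 0" "d > 1" "y > 0" and Q: "Q = (m / mstar) powr ((d - 1) / (d + 1))"
  shows "mstar * z_of_p mstar d y = m * z_of_p m d y / Q"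
proof -
  have d1: "d + 1 \<noteq> 0" using assms by simp
  have "z_of_p mstar d y = ((m / mstar)\<^sup>2) powr (1 / (d + 1)) * z_of_p m d y"
    using assms(1-4) by (rule z_of_p_scale)
  also have "((m / mstar)\<^sup>2) powr (1 / (d + 1)) = (m / mstar) powr (2 / (d + 1))"
    using assms by (simp add: powr_powr flip: powr_numeral)
  also have "2 / (d + 1) = 1 + - ((d - 1) / (d + 1))" using d1 by (simp add: field_simps)
  also have "(m / mstar) powr \<dots> = m / mstar / Q"
    using assms by (simp add: powr_diff)
  finally show ?thesis using assms by simp
qed

text \<open>Here \<open>v\<close> is the velocity and \<open>w\<close> is \<open>m * z\<close>
  inside, so \<open>w / Q\<close> is the outer \<open>mstar * z\<close>. At \<open>x0\<close>,
  \<open>(v + w) - A = w * (1 - 1 / Q)\<close> and \<open>(v - w) - A = - w * (1 + 1 / Q)\<close>,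
  whose quotient is \<open>- \<eta>\<close>.\<close>

lemma reflection_condition:
  fixes Q w :: real
  assumes Q: "Q > 0" and \<eta>: "\<eta> = (Q - 1) / (Q + 1)"
  shows "v + w / Q = A \<Longrightarrow> (v + w) - A = - \<eta> * ((v - w) - A)"
    "v - w / Q = B \<Longrightarrow> (v - w) - B = - \<eta> * ((v + w) - B)"
proof -
  have Q1: "Q + 1 \<noteq> 0" "Q \<noteq> 0" using Q by auto
  have e: "\<eta> * (w / Q + w) = w - w / Q"
  proof -
    have "w / Q + w = w / Q * (Q + 1)" using Q1 by (simp add: field_simps)
    then have "\<eta> * (w / Q + w) = w / Q * (Q - 1)" using Q1 by (simp add: \<eta>)
    then show ?thesis using Q1 by (simp add: field_simps)
  qed
  show "(v + w) - A = - \<eta> * ((v - w) - A)" if "v + w / Q = A"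
  proof -
    have "- \<eta> * ((v - w) - A) = \<eta> * (w / Q + w)" unfolding that[symmetric] by (simp add: algebra_simps)
    then show ?thesis using e that by simp
  qed
  show "(v - w) - B = - \<eta> * ((v + w) - B)" if "v - w / Q = B"
  proof -
    have "- \<eta> * ((v + w) - B) = - (\<eta> * (w / Q + w))" unfolding that[symmetric] by (simp add: algebra_simps)
    then show ?thesis using e that by simp
  qed
qed

subsection \<open>From the Euler equations to the strip\<close>

text \<open>The locale hypothesis that takes work is \<open>grad\<close>: the signs come from the
  initial data, and the boundary relations for the gradients from differentiating the reflections in
  time.\<close>

lemma rarefaction_strip_exists:
  fixes u p :: "real \<Rightarrow> real \<Rightarrow> real" and x0 x1 m d \<eta> A B :: real
  defines "Z \<equiv> \<lambda>x t. z_of_p m d (p x t)"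
  defines "c \<equiv> \<lambda>x t. m * Z x t powr d"
  assumes x01: "x0 < x1" and m: "m > 0" and d: "d > 1" and \<eta>: "0 < \<eta>" "\<eta> < 1"
    and u: "C2_on u ({x0..x1} \<times> {0..})" and p: "C2_on p ({x0..x1} \<times> {0..})"
    and pos: "\<And>x t. t \<ge> 0 \<Longrightarrow> p x t > 0"
    and euler: "\<And>x t. x0 < x \<Longrightarrow> x < x1 \<Longrightarrow> t > 0 \<Longrightarrow> reduced_euler c u p x t"
    and ini: "\<And>x. x0 < x \<Longrightarrow> x < x1 \<Longrightarrow> \<exists>ux px. ((\<lambda>y. u y 0) has_real_derivative ux) (at x) \<and>
      ((\<lambda>y. p y 0) has_real_derivative px) (at x) \<and> ux + px / c x 0 \<ge> 0 \<and> ux - px / c x 0 \<ge> 0"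
    and bc0: "\<And>t. t \<ge> 0 \<Longrightarrow> (u x0 t + m * Z x0 t) - A = - \<eta> * ((u x0 t - m * Z x0 t) - A)"
    and bc1: "\<And>t. t \<ge> 0 \<Longrightarrow> (u x1 t - m * Z x1 t) - B = - \<eta> * ((u x1 t + m * Z x1 t) - B)"
  obtains \<alpha> \<beta> cx ct where "rarefaction_strip x0 x1 m d \<eta> A B
    (\<lambda>x t. u x t + m * Z x t) (\<lambda>x t. u x t - m * Z x t) \<alpha> \<beta> c cx ct"
proof -
  let ?A = "{x0..x1} \<times> {0::real..}"
  have A: "closed ?A" "convex ?A" "interior ?A \<noteq> {}"
    using x01 by (auto intro: closed_Times convex_Times simp: interior_Times interior_real_atLeast)
  have posA: "p x t > 0" if "(x, t) \<in> ?A" for x t using pos that by auto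
  have Zpos: "Z x t > 0" if "t \<ge> 0" for x t unfolding Z_def using z_of_p_pos[OF m d pos[OF that]] .
  have cpos: "c x t > 0" if "t \<ge> 0" for x t using Zpos[OF that, of x] m by (simp add: c_def)
  have E: "\<exists>ux px. ((\<lambda>y. u y t) has_real_derivative ux) (at x) \<and>
      ((\<lambda>y. p y t) has_real_derivative px) (at x) \<and> (u x has_real_derivative - px) (at t) \<and>
      (p x has_real_derivative - (c x t)\<^sup>2 * ux) (at t)" if "(x, t) \<in> interior ?A" for x t
    using euler[of x t] that
    by (auto simp: interior_Times interior_real_atLeast reduced_euler_def)
  obtain cx ct where c: "has_partials_on c cx ct ?A" "continuous_on ?A (\<lambda>(x, t). cx x t)"
    using sound_speed_partials[OF m d p posA] unfolding c_def Z_def by blast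
  have c_eq: "c x t = m * z_of_p m d (p x t) powr d" for x t by (simp add: c_def Z_def)
  obtain \<alpha> \<alpha>x \<alpha>t where \<alpha>: "has_partials_on (\<lambda>x t. u x t + 1 * m * z_of_p m d (p x t)) \<alpha> (\<lambda>x t. - (1 * c x t * \<alpha> x t)) ?A"
    "has_partials_on \<alpha> \<alpha>x \<alpha>t ?A"
    "\<And>x t. (x, t) \<in> ?A \<Longrightarrow> \<alpha>t x t + 1 * c x t * \<alpha>x x t = - (1 * cx x t * \<alpha> x t)"
    by (rule riemann_invariant_gradient[OF A m d _ u p posA c_eq c E, of 1]) auto
  obtain \<beta> \<beta>x \<beta>t where \<beta>: "has_partials_on (\<lambda>x t. u x t + - 1 * m * z_of_p m d (p x t)) \<beta> (\<lambda>x t. - (- 1 * c x t * \<beta> x t)) ?A"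
    "has_partials_on \<beta> \<beta>x \<beta>t ?A"
    "\<And>x t. (x, t) \<in> ?A \<Longrightarrow> \<beta>t x t + - 1 * c x t * \<beta>x x t = - (- 1 * cx x t * \<beta> x t)"
    by (rule riemann_invariant_gradient[OF A m d _ u p posA c_eq c E, of "- 1"]) auto
  have r: "has_partials_on (\<lambda>x t. u x t + m * Z x t) \<alpha> (\<lambda>x t. - (c x t * \<alpha> x t)) ?A"
    using \<alpha>(1) by (simp add: Z_def)
  have s: "has_partials_on (\<lambda>x t. u x t - m * Z x t) \<beta> (\<lambda>x t. c x t * \<beta> x t) ?A"
    using \<beta>(1) by (simp add: Z_def)
  have ini_int: "\<alpha> x 0 \<ge> 0 \<and> \<beta> x 0 \<ge> 0" if x: "x \<in> {x0<..<x1}" for x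
  proof -
    obtain ux px where e: "((\<lambda>y. u y 0) has_real_derivative ux) (at x)"
      "((\<lambda>y. p y 0) has_real_derivative px) (at x)" "ux + px / c x 0 \<ge> 0" "ux - px / c x 0 \<ge> 0"
      using ini[of x] x by auto
    have "((\<lambda>y. Z y 0) has_real_derivative 1 / m\<^sup>2 * Z x 0 powr (- d) * px) (at x)"
      unfolding Z_def by (rule DERIV_chain2[OF DERIV_z_of_p[OF m d pos] e(2)]) simp
    then have "((\<lambda>y. m * Z y 0) has_real_derivative m * (1 / m\<^sup>2 * Z x 0 powr (- d) * px)) (at x)"
      by (rule DERIV_cmult)
    moreover have "m * (1 / m\<^sup>2 * Z x 0 powr (- d) * px) = px / c x 0"
      using m Zpos[of 0 x] by (simp add: c_def powr_minus power2_eq_square field_simps)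
    ultimately have mZ: "((\<lambda>y. m * Z y 0) has_real_derivative px / c x 0) (at x)" by simp
    have "((\<lambda>y. u y 0 + m * Z y 0) has_real_derivative \<alpha> x 0) (at x within {x0<..<x1})"
      "((\<lambda>y. u y 0 - m * Z y 0) has_real_derivative \<beta> x 0) (at x within {x0<..<x1})"
      by (rule has_partials_on_x[OF r] has_partials_on_x[OF s]; use x in auto)+
    then have "((\<lambda>y. u y 0 + m * Z y 0) has_real_derivative \<alpha> x 0) (at x)"
      "((\<lambda>y. u y 0 - m * Z y 0) has_real_derivative \<beta> x 0) (at x)"
      using x by (simp_all add: at_within_open[of x "{x0<..<x1}"])
    then have "\<alpha> x 0 = ux + px / c x 0" "\<beta> x 0 = ux - px / c x 0"
      using DERIV_unique DERIV_add[OF e(1) mZ] DERIV_diff[OF e(1) mZ] by blast+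
    then show ?thesis using e by simp
  qed
  \<comment> \<open>The data give the signs only in the open interval, where the entropy is
    \<open>m\<close>; continuity adds the two ends.\<close>
  have ini_ge: "g x 0 \<ge> 0"
    if g: "has_partials_on g gx gt ?A" and int: "\<And>x. x \<in> {x0<..<x1} \<Longrightarrow> g x 0 \<ge> 0"
      and x: "x \<in> {x0..x1}" for g gx gt x
  proof (rule continuous_ge_on_closure[of "{x0<..<x1}" "\<lambda>x. g x 0"])
    have "continuous_on {x0..x1} (\<lambda>x. (\<lambda>(x, t). g x t) (x, 0))"
      by (rule continuous_on_compose2[OF has_partials_on_continuous[OF g]])
        (auto intro!: continuous_intros)
    then show "continuous_on (closure {x0<..<x1}) (\<lambda>x. g x 0)" using x01 by simp
  qed (use x x01 int in auto)
  \<comment> \<open>Both invariants travel with the same speed \<open>c\<close> at the wall, so it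
    cancels from the differentiated reflection, and their opposite directions turn
    \<open>- \<eta>\<close> into \<open>\<eta>\<close>.\<close>
  have bc: "\<alpha> x0 t = \<eta> * \<beta> x0 t \<and> \<beta> x1 t = \<eta> * \<alpha> x1 t" if t: "t > 0" for t
  proof -
    have at: "(g y has_real_derivative gt y t) (at t)"
      if "has_partials_on g gx gt ?A" "y \<in> {x0..x1}" for g gx gt y
      using has_partials_on_t[OF that(1), of "{0<..}" y t] that(2) t
      by (auto simp: at_within_open[of t "{0<..}"])
    have D: "((\<lambda>t. u x t + m * Z x t) has_real_derivative - (c x t * \<alpha> x t)) (at t)"
      "((\<lambda>t. u x t - m * Z x t) has_real_derivative c x t * \<beta> x t) (at t)" if "x \<in> {x0..x1}" for x
      using at[OF r that] at[OF s that] by simp_all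
    have reflect: "(h has_real_derivative - \<eta> * D) (at t)"
      if "(g has_real_derivative D) (at t)" "\<And>t. t \<ge> 0 \<Longrightarrow> h t - k = - \<eta> * (g t - k)"
      for g h :: "real \<Rightarrow> real" and D k
    proof (rule has_field_derivative_transform_within_open[of "\<lambda>t. k + - \<eta> * (g t - k)" _ _ "{0<..}"])
      show "((\<lambda>t. k + - \<eta> * (g t - k)) has_real_derivative - \<eta> * D) (at t)"
        using that(1) by (auto intro!: derivative_eq_intros)
      show "k + - \<eta> * (g y - k) = h y" if "y \<in> {0<..}" for y
        using \<open>\<And>t. t \<ge> 0 \<Longrightarrow> h t - k = - \<eta> * (g t - k)\<close>[of y] that by simp
    qed (use t in auto)
    have x: "x0 \<in> {x0..x1}" "x1 \<in> {x0..x1}" using x01 by auto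
    have "((\<lambda>t. u x0 t + m * Z x0 t) has_real_derivative - \<eta> * (c x0 t * \<beta> x0 t)) (at t)"
      by (rule reflect[OF D(2)[OF x(1)] bc0])
    then have "- (c x0 t * \<alpha> x0 t) = - \<eta> * (c x0 t * \<beta> x0 t)"
      using D(1)[OF x(1)] DERIV_unique by blast
    then have 1: "\<alpha> x0 t = \<eta> * \<beta> x0 t" using cpos[of t x0] t by simp
    have "((\<lambda>t. u x1 t - m * Z x1 t) has_real_derivative - \<eta> * (- (c x1 t * \<alpha> x1 t))) (at t)"
      by (rule reflect[OF D(1)[OF x(2)] bc1])
    then have "c x1 t * \<beta> x1 t = - \<eta> * (- (c x1 t * \<alpha> x1 t))"
      using D(2)[OF x(2)] DERIV_unique by blast
    then have 2: "\<beta> x1 t = \<eta> * \<alpha> x1 t" using cpos[of t x1] t by simp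
    from 1 2 show ?thesis by blast
  qed
  have grad: "\<alpha> x t \<ge> 0 \<and> \<beta> x t \<ge> 0" if "x \<in> {x0..x1}" "t \<ge> 0" for x t
  proof (rule gradients_nonneg[OF x01 \<alpha>(2) _ \<beta>(2) _ _ c(2) _ _ \<eta>])
    show "\<alpha>t x t + c x t * \<alpha>x x t = - (cx x t * \<alpha> x t)"
      "\<beta>t x t + - c x t * \<beta>x x t = - (- cx x t * \<beta> x t)" if "(x, t) \<in> ?A" for x t
      using \<alpha>(3)[OF that] \<beta>(3)[OF that] by simp_all
    show "\<alpha> x 0 \<ge> 0" "\<beta> x 0 \<ge> 0" if "x \<in> {x0..x1}" for x
      using ini_ge[OF \<alpha>(2) _ that] ini_ge[OF \<beta>(2) _ that] ini_int by auto
  qed (use bc cpos that in auto)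
  show thesis
  proof (rule that[of \<alpha> \<beta> cx ct], unfold_locales)
    show "u x t - m * Z x t < u x t + m * Z x t" if "t \<ge> 0" for x t
      using m Zpos[OF that, of x] by simp
    show "c x t = m * ((u x t + m * Z x t - (u x t - m * Z x t)) / (2 * m)) powr d" for x t
      using m by (simp add: c_def)
  qed (use x01 m d \<eta> r s c grad bc0 bc1 in auto)
qed

section \<open>Translation of the gas variables and of the entropy profile\<close>

lemma gas_Cm_pos: "\<gamma> > 1 \<Longrightarrow> K > 0 \<Longrightarrow> gas_Cm \<gamma> K > 0"
  using gas_Cz_pos[of \<gamma>] by (simp add: gas_Cm_def)

lemma entropy_var_pos: "\<gamma> > 1 \<Longrightarrow> K > 0 \<Longrightarrow> entropy_var \<gamma> K cv s > 0"
  using gas_Cm_pos by (simp add: entropy_var_def)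

lemma entropy_var_eq_iff:
  "\<gamma> > 1 \<Longrightarrow> K > 0 \<Longrightarrow> cv > 0 \<Longrightarrow> entropy_var \<gamma> K cv s = entropy_var \<gamma> K cv s' \<longleftrightarrow> s = s'"
  using gas_Cm_pos[of \<gamma> K] by (simp add: entropy_var_def)

lemma p_field_pos: "K > 0 \<Longrightarrow> \<tau> x t > 0 \<Longrightarrow> p_field \<gamma> K cv \<tau> S x t > 0"
  by (simp add: p_field_def pressure_def)

lemma z_field_eq:
  assumes "\<gamma> > 1" "K > 0" "\<tau> x t > 0"
  shows "z_field \<gamma> \<tau> x t = z_of_p (m_field \<gamma> K cv S x) (gas_d \<gamma>) (p_field \<gamma> K cv \<tau> S x t)"
proof -
  have d: "gas_d \<gamma> > 1" using gas_d_gt_1 assms by blast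
  have m: "m_field \<gamma> K cv S x > 0" using entropy_var_pos assms by (simp add: m_field_def)
  have z: "z_field \<gamma> \<tau> x t > 0" using gas_Cz_pos assms by (simp add: z_field_def z_var_def)
  have "(gas_d \<gamma> + 1) / (m_field \<gamma> K cv S x)\<^sup>2 * p_field \<gamma> K cv \<tau> S x t
      = z_field \<gamma> \<tau> x t powr (1 + gas_d \<gamma>)"
    unfolding p_field_def pressure_eq[OF assms] using d m
    by (simp add: m_field_def z_field_def)
  then show ?thesis unfolding z_of_p_def using z d by (simp add: powr_powr add.commute)
qed

lemma c_field_eq:
  assumes "\<gamma> > 1" "K > 0" "\<tau> x t > 0"
  shows "c_field \<gamma> K cv \<tau> S x t = m_field \<gamma> K cv S x *
    z_of_p (m_field \<gamma> K cv S x) (gas_d \<gamma>) (p_field \<gamma> K cv \<tau> S x t) powr gas_d \<gamma>"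
  unfolding z_field_eq[where \<tau> = \<tau> and x = x and t = t, OF assms, symmetric]
  using sound_speed_eq[OF assms, of cv "S x"] by (simp add: c_field_def m_field_def z_field_def)

text \<open>With the entropy frozen in time, \<open>p_t\<close> is the volume derivative
  \<open>- c^2\<close> of the pressure times \<open>\<tau>_t = u_x\<close>. For \<open>t > 0\<close>
  the one-sided time derivatives are two-sided.\<close>

lemma euler_reduced:
  assumes \<gamma>: "\<gamma> > 1" and K: "K > 0" and pos: "\<And>s. s \<ge> 0 \<Longrightarrow> \<tau> x s > 0" and t: "t > 0"
    and eu: "euler_at \<gamma> K cv \<tau> u S x t"
  shows "reduced_euler (c_field \<gamma> K cv \<tau> S) u (p_field \<gamma> K cv \<tau> S) x t"
proof -
  obtain ux px where e: "((\<lambda>y. u y t) has_real_derivative ux) (at x)"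
    "((\<lambda>y. p_field \<gamma> K cv \<tau> S y t) has_real_derivative px) (at x)"
    "((\<lambda>s. \<tau> x s) has_real_derivative ux) (at t within {0..})"
    "((\<lambda>s. u x s) has_real_derivative - px) (at t within {0..})"
    using eu unfolding euler_at_def by (elim exE conjE) (rule that)
  have at: "at t within {0..} = at t" by (rule at_within_interior) (use t in \<open>simp add: interior_real_atLeast\<close>)
  have \<tau>: "\<tau> x t > 0" using pos t by simp
  let ?D = "K * exp (S x / cv) * (- \<gamma> * \<tau> x t powr (- \<gamma> - 1))"
  have D: "((\<lambda>w. pressure \<gamma> K cv w (S x)) has_real_derivative ?D) (at (\<tau> x t))"
    unfolding pressure_def using \<tau> by (auto intro!: derivative_eq_intros)
  have "?D \<le> 0" using K \<gamma> by (simp add: mult_nonneg_nonneg)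
  then have c2: "(c_field \<gamma> K cv \<tau> S x t)\<^sup>2 = - ?D"
    unfolding c_field_def sound_speed_def DERIV_imp_deriv[OF D] by (subst real_sqrt_pow2) auto
  have "((\<lambda>s. pressure \<gamma> K cv (\<tau> x s) (S x)) has_real_derivative ?D * ux) (at t)"
    using DERIV_chain2[OF D e(3)] unfolding at .
  then show ?thesis
    using e(1,2,4) unfolding reduced_euler_def at c2 by (auto simp: p_field_def[abs_def])
qed

text \<open>A larger connected set would meet another of the three intervals and hence contain
  \<open>a\<close> or \<open>b\<close>.\<close>

lemma component_interval:
  fixes a :: real
  assumes "I \<in> {{..<a}, {a<..<b}, {b<..}}" "a < b"
  shows "I \<in> components (- {a, b})"
proof -
  have "a - 1 \<in> I \<or> (a + b) / 2 \<in> I \<or> b + 1 \<in> I" using assms by auto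
  then have "I \<noteq> {}" by auto
  moreover have "I \<subseteq> - {a, b}" "connected I" using assms by auto
  moreover have "d = I" if d: "I \<subseteq> d" "d \<subseteq> - {a, b}" "connected d" "d \<noteq> {}" for d
  proof
    show "d \<subseteq> I"
    proof
      fix y assume y: "y \<in> d"
      obtain x where x: "x \<in> I" using \<open>I \<noteq> {}\<close> by blast
      have "w \<in> d" if "min x y \<le> w" "w \<le> max x y" for w
        using d(3)[unfolded connected_iff_interval, rule_format, of "min x y" "max x y" w] that x y d(1)
        by (auto simp: min_def max_def split: if_splits)
      then have "\<not> (min x y \<le> a \<and> a \<le> max x y)" "\<not> (min x y \<le> b \<and> b \<le> max x y)"
        using d(2) by auto
      then show "y \<in> I" using x assms by (auto simp: min_def max_def split: if_splits)
    qed
  qed (use d in auto)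
  ultimately show ?thesis unfolding in_components_maximal by blast
qed

text \<open>The values at \<open>a\<close> and \<open>b\<close> are unspecified, so discontinuity
  there is read off from the distinct one-sided limits.\<close>

lemma jumps_of_step:
  fixes f :: "real \<Rightarrow> real"
  assumes "a < b" "l \<noteq> v" "v \<noteq> w" and f: "\<And>x. x < a \<Longrightarrow> f x = l" "\<And>x. a < x \<Longrightarrow> x < b \<Longrightarrow> f x = v"
    "\<And>x. b < x \<Longrightarrow> f x = w"
  shows "jumps f = {a, b}"
proof -
  have cont: "isCont f x" if ne: "x \<noteq> a" "x \<noteq> b" for x
  proof -
    have o: "isCont f x" if "open U" "x \<in> U" "\<And>y. y \<in> U \<Longrightarrow> f y = k" for U k
      using continuous_on_eq_continuous_at[OF that(1), of f] that continuous_on_cong[OF refl that(3)]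
      by auto
    consider "x < a" | "x \<in> {a<..<b}" | "b < x" using ne
      by (cases x a rule: linorder_cases; cases x b rule: linorder_cases) auto
    then show ?thesis using o[of "{..<a}" l] o[of "{a<..<b}" v] o[of "{b<..}" w] f by cases auto
  qed
  have L: "(f \<longlongrightarrow> k) (at_left x)" if "c < x" "\<And>y. c < y \<Longrightarrow> y < x \<Longrightarrow> f y = k" for c x k
    by (rule tendsto_eventually) (use that in \<open>auto simp: eventually_at_left[OF that(1)]\<close>)
  have R: "(f \<longlongrightarrow> k) (at_right x)" if "x < c" "\<And>y. x < y \<Longrightarrow> y < c \<Longrightarrow> f y = k" for c x k
    by (rule tendsto_eventually) (use that in \<open>auto simp: eventually_at_right[OF that(1)]\<close>)
  have no: "\<not> isCont f x" if "(f \<longlongrightarrow> k) (at_left x)" "(f \<longlongrightarrow> k') (at_right x)" "k \<noteq> k'" for x k k'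
  proof
    assume "isCont f x"
    then have "(f \<longlongrightarrow> f x) (at_left x)" "(f \<longlongrightarrow> f x) (at_right x)"
      by (auto simp: isCont_def filterlim_at_split)
    then show False using that tendsto_unique trivial_limit_at_left_real trivial_limit_at_right_real
      by metis
  qed
  have "\<not> isCont f a" by (rule no[OF L[of "a - 1" a l] R[of a b v]]) (use assms in auto)
  moreover have "\<not> isCont f b" by (rule no[OF L[of a b v] R[of b "b + 1" w]]) (use assms in auto)
  ultimately show ?thesis using cont by (auto simp: jumps_def)
qed

subsection \<open>Vacuum rates\<close>

lemma crossing_cong:
  assumes "crossing c \<sigma> y0 y1 a b"
    and "\<And>x t. min y0 y1 < x \<Longrightarrow> x < max y0 y1 \<Longrightarrow> a < t \<Longrightarrow> c x t = c' x t"
  shows "crossing c' \<sigma> y0 y1 a b"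
proof -
  obtain X where X: "a < b" "continuous_on {a..b} X" "X a = y0" "X b = y1"
    "\<And>t. t \<in> {a<..<b} \<Longrightarrow> min y0 y1 < X t \<and> X t < max y0 y1 \<and>
      (X has_real_derivative \<sigma> * c (X t) t) (at t)"
    using assms(1) unfolding crossing_def by blast
  have "min y0 y1 < X t \<and> X t < max y0 y1 \<and> (X has_real_derivative \<sigma> * c' (X t) t) (at t)"
    if "t \<in> {a<..<b}" for t
    using X(5)[OF that] assms(2)[of "X t" t] that by auto
  then show ?thesis unfolding crossing_def using X(1-4) by blast
qed

text \<open>The equation of a crossing evaluates the sound speed only strictly inside the strip, so
  its arbitrary values at the contacts do not influence the bounce times.\<close>

lemma bounce_time_cong:
  assumes "bounce_time c x0 x1 n t" "x0 < x1"
    and eq: "\<And>x t. x0 < x \<Longrightarrow> x < x1 \<Longrightarrow> 0 < t \<Longrightarrow> c x t = c' x t"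
  shows "bounce_time c' x0 x1 n t"
proof -
  have "bounce_time c' x0 x1 n t \<and> t \<ge> 0"
    using assms(1)
  proof induction
    case start
    then show ?case by (simp add: bounce_time.start)
  next
    case (backward k a b)
    have "crossing c' (- 1) x1 x0 a b"
      by (rule crossing_cong[OF backward(3)]) (use backward.IH \<open>x0 < x1\<close> eq in auto)
    moreover have "a < b" using backward(3) by (simp add: crossing_def)
    ultimately show ?case using backward.IH backward(2) bounce_time.backward[of c' x0 x1 k a b] by auto
  next
    case (forward k a b)
    have "crossing c' 1 x0 x1 a b"
      by (rule crossing_cong[OF forward(3)]) (use forward.IH \<open>x0 < x1\<close> eq in auto)
    moreover have "a < b" using forward(3) by (simp add: crossing_def)
    ultimately show ?case using forward.IH forward(2) bounce_time.forward[of c' x0 x1 k a b] by auto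
  qed
  then show ?thesis by blast
qed

lemma inner_trace_eq:
  assumes "x0 < x1" and eq: "\<And>x. x0 < x \<Longrightarrow> x < x1 \<Longrightarrow> z x t = Z x t"
    and cont: "continuous_on {x0..x1} (\<lambda>x. Z x t)"
  shows "inner_trace z x0 x1 n t = (if even n then Z x1 t else Z x0 t)"
proof -
  have "((\<lambda>x. Z x t) \<longlongrightarrow> Z x1 t) (at_left x1)" "((\<lambda>x. Z x t) \<longlongrightarrow> Z x0 t) (at_right x0)"
    using continuous_on_Icc_at_leftD[OF cont assms(1)] continuous_on_Icc_at_rightD[OF cont assms(1)]
    by simp_all
  moreover have e: "\<forall>\<^sub>F x in at_left x1. z x t = Z x t" "\<forall>\<^sub>F x in at_right x0. z x t = Z x t"
    using eq assms(1) by (auto simp: eventually_at_left[OF assms(1)] eventually_at_right[OF assms(1)])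
  ultimately have "((\<lambda>x. z x t) \<longlongrightarrow> Z x1 t) (at_left x1)" "((\<lambda>x. z x t) \<longlongrightarrow> Z x0 t) (at_right x0)"
    by (simp_all add: tendsto_cong[OF e(1)] tendsto_cong[OF e(2)])
  then have "Lim (at_left x1) (\<lambda>x. z x t) = Z x1 t" "Lim (at_right x0) (\<lambda>x. z x t) = Z x0 t"
    by (intro tendsto_Lim; simp)+
  then show ?thesis by (simp add: inner_trace_def)
qed

text \<open>The exponent \<open>1 - d\<close> is negative, so the bounds change sides:
  \<open>b\<close> controls \<open>\<tau>\<close> from below and \<open>a\<close> from above. The
  new rate is \<open>- 1 / d * (1 - d) = 1 - 1 / d\<close>.\<close>

lemma volume_rate:
  fixes a b d t z \<tau> :: real
  assumes d: "d > 1" and ab: "a > 0" "b > 0" and t: "t \<ge> 0" and \<tau>: "\<tau> = z powr (1 - d) / (d - 1)"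
    and z: "a * (1 + t) powr (- 1 / d) \<le> z" "z \<le> b * (1 + t) powr (- 1 / d)"
  shows "b powr (1 - d) / (d - 1) * (1 + t) powr (1 - 1 / d) \<le> \<tau>"
    "\<tau> \<le> a powr (1 - d) / (d - 1) * (1 + t) powr (1 - 1 / d)"
    "(d - 1) / a powr (1 - d) * (1 + t) powr (1 / d - 1) \<le> 1 / \<tau>"
    "1 / \<tau> \<le> (d - 1) / b powr (1 - d) * (1 + t) powr (1 / d - 1)"
proof -
  let ?w = "(1 + t) powr (- 1 / d)" and ?v = "(1 + t) powr (1 - 1 / d)"
  have "1 + t > 0" using t by simp
  then have w: "?w > 0" "?v > 0" by simp_all
  have aw: "a * ?w > 0" using ab w by simp
  have zpos: "z > 0" using z(1) aw by linarith
  have e: "- 1 / d * (1 - d) = 1 - 1 / d" using d by (simp add: field_simps)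
  have pw: "(k * ?w) powr (1 - d) = k powr (1 - d) * ?v" if "k > 0" for k
    using that t by (simp only: powr_mult powr_powr e)
  have "(b * ?w) powr (1 - d) \<le> z powr (1 - d)" "z powr (1 - d) \<le> (a * ?w) powr (1 - d)"
    using d aw zpos z by (intro powr_mono2'; simp)+
  then have "b powr (1 - d) * ?v / (d - 1) \<le> z powr (1 - d) / (d - 1)"
    "z powr (1 - d) / (d - 1) \<le> a powr (1 - d) * ?v / (d - 1)"
    unfolding pw[OF ab(1)] pw[OF ab(2)] using d by (intro divide_right_mono; simp)+
  then show 1: "b powr (1 - d) / (d - 1) * ?v \<le> \<tau>" "\<tau> \<le> a powr (1 - d) / (d - 1) * ?v"
    by (simp_all add: \<tau>)
  have \<tau>pos: "\<tau> > 0" using zpos d by (simp add: \<tau>)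
  have inv: "(1 + t) powr (1 / d - 1) = 1 / ?v"
    using powr_minus_divide[of "1 + t" "1 - 1 / d"] by simp
  have flip: "(d - 1) / k powr (1 - d) * (1 + t) powr (1 / d - 1) = 1 / (k powr (1 - d) / (d - 1) * ?v)" for k
    unfolding inv by simp
  show "(d - 1) / a powr (1 - d) * (1 + t) powr (1 / d - 1) \<le> 1 / \<tau>"
    unfolding flip using 1(2) \<tau>pos ab d w by (intro divide_left_mono) (auto intro!: mult_pos_pos divide_pos_pos)
  have bv: "b powr (1 - d) / (d - 1) * ?v > 0" using ab d w by simp
  show "1 / \<tau> \<le> (d - 1) / b powr (1 - d) * (1 + t) powr (1 / d - 1)"
    unfolding flip
    by (rule divide_left_mono[OF 1(1)], simp, rule mult_pos_pos) (rule \<tau>pos bv)+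
qed

theorem corollary7p3:
  fixes \<gamma> K cv x0 x1 mstar m d Q \<eta> z0 t1 z1 \<zeta> c0 :: real
    and \<tau> u p c z :: "real \<Rightarrow> real \<Rightarrow> real"
    and S :: "real \<Rightarrow> real"
  assumes "\<gamma> > 1" and "K > 0" and "cv > 0"
    and d_eq: "d = gas_d \<gamma>"
    and p_eq: "p = p_field \<gamma> K cv \<tau> S"
    and c_eq: "c = c_field \<gamma> K cv \<tau> S"
    and z_eq: "z = z_field \<gamma> \<tau>"
    and "x0 < x1" and "m > mstar" and "mstar > 0"
    and profile_left: "\<And>x. x < x0 \<Longrightarrow> m_field \<gamma> K cv S x = mstar"
    and profile_mid: "\<And>x. x0 < x \<Longrightarrow> x < x1 \<Longrightarrow> m_field \<gamma> K cv S x = m"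
    and profile_right: "\<And>x. x1 < x \<Longrightarrow> m_field \<gamma> K cv S x = mstar"
    and Q_eq: "Q = (m / mstar) powr ((d - 1) / (d + 1))"
    and eta_eq: "\<eta> = (Q - 1) / (Q + 1)"
    and solution: "global_shock_free \<gamma> K cv \<tau> u S"
    and data: "admissible_data x0 x1 (\<lambda>x. u x 0) (\<lambda>x. p x 0)"
    and rarefactive: "rarefactive \<gamma> K cv \<tau> u S"
    and z0_eq: "z0 = inner_trace z x0 x1 0 0"
    and c0_eq: "c0 = m * z0 powr d"
    and t1: "bounce_time c x0 x1 1 t1"
    and z1_eq: "z1 = inner_trace z x0 x1 1 t1"
    and zeta_eq: "\<zeta> = z1 - \<eta> * z0"
    and zeta_zero: "\<zeta> = 0"
  shows "(\<forall>n. \<exists>!t. bounce_time c x0 x1 n t) \<and>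
    (\<forall>n t. bounce_time c x0 x1 n t \<longrightarrow>
       z0 * (1 + t * c0 / (x1 - x0) * (\<eta> powr (- d) - 1)) powr (- 1 / d)
         \<le> inner_trace z x0 x1 n t \<and>
       inner_trace z x0 x1 n t
         \<le> z0 * (1 + t * c0 / (x1 - x0) * (1 - \<eta> powr d)) powr (- 1 / d)) \<and>
    (\<exists>a>0. \<exists>b>0. \<forall>x\<in>{x0..x1}. \<forall>t\<ge>0.
       a * (1 + t) powr (- 1 / d) \<le> z x t \<and> z x t \<le> b * (1 + t) powr (- 1 / d)) \<and>
    (\<exists>a>0. \<exists>b>0. \<forall>x\<in>{x0..x1}. \<forall>t\<ge>0.
       a * (1 + t) powr (1 - 1 / d) \<le> \<tau> x t \<and> \<tau> x t \<le> b * (1 + t) powr (1 - 1 / d)) \<and>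
    (\<exists>a>0. \<exists>b>0. \<forall>x\<in>{x0..x1}. \<forall>t\<ge>0.
       a * (1 + t) powr (1 / d - 1) \<le> 1 / \<tau> x t \<and> 1 / \<tau> x t \<le> b * (1 + t) powr (1 / d - 1))"
proof -
  note \<gamma> = \<open>\<gamma> > 1\<close> and K = \<open>K > 0\<close> and x01 = \<open>x0 < x1\<close>
  have d: "d > 1" using gas_d_gt_1[OF \<gamma>] by (simp add: d_eq)
  have m: "m > 0" and ms: "mstar > 0" using \<open>m > mstar\<close> \<open>mstar > 0\<close> by auto
  have "m / mstar > 1" using \<open>m > mstar\<close> ms by simp
  then have Q: "Q > 1" unfolding Q_eq using d by (simp add: gr_one_powr)
  then have \<eta>: "0 < \<eta>" "\<eta> < 1" by (simp_all add: eta_eq)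
  have \<tau>pos: "\<tau> x t > 0" if "t \<ge> 0" for x t
    using solution that by (auto simp: global_shock_free_def)
  have ppos: "p x t > 0" if "t \<ge> 0" for x t using p_field_pos K \<tau>pos[OF that] by (simp add: p_eq)
  let ?M = "m_field \<gamma> K cv S"
  have Mpos: "?M x > 0" for x using entropy_var_pos[OF \<gamma> K] by (simp add: m_field_def)
  have z_p: "z x t = z_of_p (?M x) d (p x t)" if "t \<ge> 0" for x t
    using z_field_eq[of \<gamma> K \<tau> x t cv S] \<gamma> K \<tau>pos[OF that] by (simp add: z_eq d_eq p_eq)
  have c_p: "c x t = ?M x * z_of_p (?M x) d (p x t) powr d" if "t \<ge> 0" for x t
    using c_field_eq[of \<gamma> K \<tau> x t cv S] \<gamma> K \<tau>pos[OF that] by (simp add: c_eq d_eq p_eq)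

  \<comment> \<open>The profile is prescribed for \<open>m\<close>, whereas the solution concept
    refers to the jumps of \<open>S\<close>; injectivity of \<open>entropy_var\<close> connects
    them.\<close>
  have S_eq: "S x = S y \<longleftrightarrow> ?M x = ?M y" for x y
    using entropy_var_eq_iff[OF \<gamma> K \<open>cv > 0\<close>] by (simp add: m_field_def)
  have jumps: "jumps S = {x0, x1}"
  proof (rule jumps_of_step[OF x01, of "S (x0 - 1)" "S ((x0 + x1) / 2)" "S (x1 + 1)"])
    have mid: "x0 < (x0 + x1) / 2" "(x0 + x1) / 2 < x1" using x01 by auto
    note v = profile_left[of "x0 - 1"] profile_mid[OF mid] profile_right[of "x1 + 1"]
    show "S (x0 - 1) \<noteq> S ((x0 + x1) / 2)" "S ((x0 + x1) / 2) \<noteq> S (x1 + 1)"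
      using v \<open>m > mstar\<close> by (auto simp: S_eq)
    show "S x = S (x0 - 1)" if "x < x0" for x using v profile_left[OF that] by (simp add: S_eq)
    show "S x = S ((x0 + x1) / 2)" if "x0 < x" "x < x1" for x
      using v profile_mid[OF that] by (simp add: S_eq)
    show "S x = S (x1 + 1)" if "x1 < x" for x using v profile_right[OF that] by (simp add: S_eq)
  qed
  have C2: "C2_on u (closure I \<times> {0..}) \<and> C2_on p (closure I \<times> {0..})"
    if "I \<in> {{..<x0}, {x0<..<x1}, {x1<..}}" for I
    using solution component_interval[OF that x01] by (simp add: global_shock_free_def jumps p_eq)
  have C2': "C2_on u ({..x0} \<times> {0..})" "C2_on p ({..x0} \<times> {0..})"
    "C2_on u ({x0..x1} \<times> {0..})" "C2_on p ({x0..x1} \<times> {0..})"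
    "C2_on u ({x1..} \<times> {0..})" "C2_on p ({x1..} \<times> {0..})"
    using C2[of "{..<x0}"] C2[of "{x0<..<x1}"] C2[of "{x1<..}"] x01 by auto
  have euler: "reduced_euler (\<lambda>x t. \<mu> * z_of_p \<mu> d (p x t) powr d) u p x t"
    if "x \<noteq> x0" "x \<noteq> x1" "t > 0" "?M x = \<mu>" for x t \<mu>
  proof -
    have "euler_at \<gamma> K cv \<tau> u S x t" using solution that by (auto simp: global_shock_free_def jumps)
    from euler_reduced[OF \<gamma> K \<tau>pos that(3) this] have "reduced_euler c u p x t"
      by (simp add: c_eq p_eq)
    moreover have "c x t = \<mu> * z_of_p \<mu> d (p x t) powr d" using c_p[of t x] that by simp
    ultimately show ?thesis unfolding reduced_euler_def by (simp only:)
  qed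

  have left0: "u x 0 = u x0 0 \<and> p x 0 = p x0 0" if "x \<le> x0" for x
    using data that by (force simp: admissible_data_def constant_on_def)
  have right0: "u x 0 = u x1 0 \<and> p x 0 = p x1 0" if "x \<ge> x1" for x
    using data that by (force simp: admissible_data_def constant_on_def)
  define A where "A = u x0 0 + mstar * z_of_p mstar d (p x0 0)"
  define B where "B = u x1 0 - mstar * z_of_p mstar d (p x1 0)"
  have outer0: "u x0 t + mstar * z_of_p mstar d (p x0 t) = A" if "t \<ge> 0" for t
    unfolding A_def
    by (rule forward_invariant_left[OF ms d C2'(1,2) ppos _ left0 that])
      (use euler profile_left x01 in auto)
  have outer1: "u x1 t - mstar * z_of_p mstar d (p x1 t) = B" if "t \<ge> 0" for t
    unfolding B_def
    by (rule backward_invariant_right[OF ms d C2'(5,6) ppos _ right0 that])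
      (use euler profile_right x01 in auto)
  \<comment> \<open>\<open>Z\<close> uses the inner entropy \<open>m\<close> everywhere and so
    extends \<open>z\<close> continuously from the open strip to both contacts; its values there are
    the inner traces.\<close>
  define Z where "Z = (\<lambda>x t. z_of_p m d (p x t))"
  define c' where "c' = (\<lambda>x t. m * Z x t powr d)"
  have outer0': "u x0 t + m * Z x0 t / Q = A" if "t \<ge> 0" for t
    using outer0[OF that] impedance_ratio[OF ms m d ppos[OF that] Q_eq] by (simp add: Z_def)
  have outer1': "u x1 t - m * Z x1 t / Q = B" if "t \<ge> 0" for t
    using outer1[OF that] impedance_ratio[OF ms m d ppos[OF that] Q_eq] by (simp add: Z_def)
  have Q0: "Q > 0" using Q by simp
  have c_c': "c x t = c' x t" and z_Z: "z x t = Z x t" if "x0 < x" "x < x1" "t \<ge> 0" for x t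
    using c_p[OF that(3)] z_p[OF that(3)] profile_mid[OF that(1,2)] by (simp_all add: c'_def Z_def)
  have euler': "reduced_euler c' u p x t" if "x0 < x" "x < x1" "t > 0" for x t
    using euler[OF _ _ that(3) profile_mid[OF that(1,2)]] that by (simp add: c'_def Z_def)
  have ini: "\<exists>ux px. ((\<lambda>y. u y 0) has_real_derivative ux) (at x) \<and>
      ((\<lambda>y. p y 0) has_real_derivative px) (at x) \<and> ux + px / c' x 0 \<ge> 0 \<and> ux - px / c' x 0 \<ge> 0"
    if x: "x0 < x" "x < x1" for x
  proof -
    obtain u' where u': "\<And>x. ((\<lambda>y. u y 0) has_real_derivative u' x) (at x)"
      using data unfolding admissible_data_def C2_real_def by metis
    obtain p' where p': "\<And>x. ((\<lambda>y. p y 0) has_real_derivative p' x) (at x)"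
      using data unfolding admissible_data_def C2_real_def by metis
    have "alpha_field \<gamma> K cv \<tau> u S x 0 \<ge> 0" "beta_field \<gamma> K cv \<tau> u S x 0 \<ge> 0"
      using rarefactive unfolding rarefactive_def by simp_all
    then have "u' x + p' x / c x 0 \<ge> 0" "u' x - p' x / c x 0 \<ge> 0"
      using DERIV_imp_deriv[OF u'[of x]] DERIV_imp_deriv[OF p'[of x]]
      by (simp_all add: alpha_field_def beta_field_def c_eq p_eq)
    then show ?thesis using u'[of x] p'[of x] c_c'[OF x, of 0] by auto
  qed
  note bc = reflection_condition(1)[OF Q0 eta_eq outer0'] reflection_condition(2)[OF Q0 eta_eq outer1']
  obtain \<alpha> \<beta> cx ct where strip: "rarefaction_strip x0 x1 m d \<eta> A B
    (\<lambda>x t. u x t + m * Z x t) (\<lambda>x t. u x t - m * Z x t) \<alpha> \<beta> c' cx ct"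
    unfolding c'_def Z_def
    by (rule rarefaction_strip_exists[OF x01 m d \<eta> C2'(3,4) ppos euler'[unfolded c'_def Z_def]
        ini[unfolded c'_def Z_def] bc[unfolded Z_def]]) (assumption | rule that)+
  interpret st: rarefaction_strip x0 x1 m d \<eta> A B
    "\<lambda>x t. u x t + m * Z x t" "\<lambda>x t. u x t - m * Z x t" \<alpha> \<beta> c' cx ct
    by (rule strip)
  have stz: "st.z = Z" using m by (simp add: st.z_def fun_eq_iff)
  have bounce: "bounce_time c x0 x1 n t \<longleftrightarrow> bounce_time c' x0 x1 n t" for n t
    using bounce_time_cong[of c x0 x1 n t c'] bounce_time_cong[of c' x0 x1 n t c] x01 c_c' by auto
  have trace: "inner_trace z x0 x1 n t = st.trace_at n t" if "t \<ge> 0" for n t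
  proof -
    have "continuous_on {x0..x1} (\<lambda>x. (\<lambda>(x, t). st.z x t) (x, t))"
      by (rule continuous_on_compose2[OF has_partials_on_continuous[OF st.z_partials]])
        (use that in \<open>auto intro!: continuous_intros\<close>)
    then have "continuous_on {x0..x1} (\<lambda>x. Z x t)" by (simp add: stz)
    then show ?thesis
      using inner_trace_eq[OF x01, of z t Z n] z_Z that by (simp add: st.trace_at_def stz)
  qed
  have z0: "z0 = Z x1 0" using trace[of 0 0] by (simp add: z0_eq st.trace_at_def stz)
  have c0: "c0 = c' x1 0" by (simp add: c0_eq z0 c'_def)
  have t1': "bounce_time c' x0 x1 1 t1" using t1 bounce by blast
  have "z1 = Z x0 t1" using trace[OF st.bounce_time_nonneg[OF t1'], of 1]
    by (simp add: z1_eq st.trace_at_def stz)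
  then have AB: "A = B" using st.A_eq_B_iff[OF t1'] zeta_eq zeta_zero z0 by (simp add: stz)

  have part1: "\<exists>!t. bounce_time c x0 x1 n t" for n
    unfolding bounce using st.bounce_time_exists[OF AB] st.bounce_time_unique by blast
  have part2: "z0 * (1 + t * c0 / (x1 - x0) * (\<eta> powr (- d) - 1)) powr (- 1 / d)
         \<le> inner_trace z x0 x1 n t \<and>
       inner_trace z x0 x1 n t
         \<le> z0 * (1 + t * c0 / (x1 - x0) * (1 - \<eta> powr d)) powr (- 1 / d)"
    if "bounce_time c x0 x1 n t" for n t
  proof -
    have b: "bounce_time c' x0 x1 n t" using that bounce by blast
    show ?thesis
      using st.bounce_rate[OF AB b] trace[OF st.bounce_time_nonneg[OF b], of n] z0 c0 by (simp add: stz)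
  qed

  obtain C1 C2 where C: "C1 > 0" "C2 > 0" "\<And>x t. x \<in> {x0..x1} \<Longrightarrow> t \<ge> 0 \<Longrightarrow>
    C1 * (1 + t) powr (- 1 / d) \<le> Z x t \<and> Z x t \<le> C2 * (1 + t) powr (- 1 / d)"
    using st.z_rate[OF AB] unfolding stz by blast
  \<comment> \<open>The rates are claimed on the closed interval, but at \<open>x0\<close> and
    \<open>x1\<close> the fields \<open>z\<close> and \<open>\<tau>\<close> depend on arbitrary
    entropy values. There \<open>z\<close> differs from \<open>Z\<close> by a fixed positive factor,
    which the constants \<open>a\<close> and \<open>b\<close> absorb.\<close>
  define \<kappa> where "\<kappa> x = ((m / ?M x)\<^sup>2) powr (1 / (d + 1))" for x
  have \<kappa>pos: "\<kappa> x > 0" for x using Mpos[of x] m by (simp add: \<kappa>_def)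
  have z\<kappa>: "z x t = \<kappa> x * Z x t" if "t \<ge> 0" for x t
    using z_p[OF that] z_of_p_scale[OF Mpos m d ppos[OF that]] by (simp add: \<kappa>_def Z_def)
  have \<kappa>1: "\<kappa> x = 1" if "x0 < x" "x < x1" for x using profile_mid[OF that] m by (simp add: \<kappa>_def)
  define a where "a = min 1 (min (\<kappa> x0) (\<kappa> x1)) * C1"
  define b where "b = max 1 (max (\<kappa> x0) (\<kappa> x1)) * C2"
  have ab: "a > 0" "b > 0" using \<kappa>pos C by (auto simp: a_def b_def min_def max_def)
  have zab: "a * (1 + t) powr (- 1 / d) \<le> z x t" "z x t \<le> b * (1 + t) powr (- 1 / d)"
    if "x \<in> {x0..x1}" "t \<ge> 0" for x t
  proof -
    have \<kappa>: "min 1 (min (\<kappa> x0) (\<kappa> x1)) \<le> \<kappa> x" "\<kappa> x \<le> max 1 (max (\<kappa> x0) (\<kappa> x1))"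
      using \<kappa>1[of x] that by (cases "x = x0"; cases "x = x1"; simp)+
    have "Z x t > 0" using z_of_p_pos[OF m d ppos[OF that(2)]] by (simp add: Z_def)
    then have "min 1 (min (\<kappa> x0) (\<kappa> x1)) * (C1 * (1 + t) powr (- 1 / d)) \<le> \<kappa> x * Z x t"
      "\<kappa> x * Z x t \<le> max 1 (max (\<kappa> x0) (\<kappa> x1)) * (C2 * (1 + t) powr (- 1 / d))"
      using C(3)[OF that] C(1,2) \<kappa> \<kappa>pos[of x] by (intro mult_mono; auto)+
    then show "a * (1 + t) powr (- 1 / d) \<le> z x t" "z x t \<le> b * (1 + t) powr (- 1 / d)"
      using z\<kappa>[OF that(2)] by (simp_all add: a_def b_def mult.assoc)
  qed
  have \<tau>z: "\<tau> x t = z x t powr (1 - d) / (d - 1)" if "t \<ge> 0" for x t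
    using tau_eq_z_var[OF \<gamma> \<tau>pos[OF that]] by (simp add: z_eq z_field_def d_eq)
  note V = volume_rate[OF d ab _ \<tau>z zab]
  have pos: "a powr (1 - d) / (d - 1) > 0" "b powr (1 - d) / (d - 1) > 0"
    "(d - 1) / a powr (1 - d) > 0" "(d - 1) / b powr (1 - d) > 0"
    using ab d by simp_all
  show ?thesis
  proof (intro conjI)
    show "\<forall>n. \<exists>!t. bounce_time c x0 x1 n t" using part1 by blast
    show "\<forall>n t. bounce_time c x0 x1 n t \<longrightarrow>
       z0 * (1 + t * c0 / (x1 - x0) * (\<eta> powr (- d) - 1)) powr (- 1 / d)
         \<le> inner_trace z x0 x1 n t \<and>
       inner_trace z x0 x1 n t
         \<le> z0 * (1 + t * c0 / (x1 - x0) * (1 - \<eta> powr d)) powr (- 1 / d)"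
      using part2 by blast
    show "\<exists>a>0. \<exists>b>0. \<forall>x\<in>{x0..x1}. \<forall>t\<ge>0.
       a * (1 + t) powr (- 1 / d) \<le> z x t \<and> z x t \<le> b * (1 + t) powr (- 1 / d)"
      using zab ab by blast
    show "\<exists>a>0. \<exists>b>0. \<forall>x\<in>{x0..x1}. \<forall>t\<ge>0.
       a * (1 + t) powr (1 - 1 / d) \<le> \<tau> x t \<and> \<tau> x t \<le> b * (1 + t) powr (1 - 1 / d)"
      by (rule exI[of _ "b powr (1 - d) / (d - 1)"], rule conjI[OF pos(2)],
          rule exI[of _ "a powr (1 - d) / (d - 1)"], rule conjI[OF pos(1)]) (use V(1,2) in blast)
    show "\<exists>a>0. \<exists>b>0. \<forall>x\<in>{x0..x1}. \<forall>t\<ge>0.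
       a * (1 + t) powr (1 / d - 1) \<le> 1 / \<tau> x t \<and> 1 / \<tau> x t \<le> b * (1 + t) powr (1 / d - 1)"
      by (rule exI[of _ "(d - 1) / a powr (1 - d)"], rule conjI[OF pos(3)],
          rule exI[of _ "(d - 1) / b powr (1 - d)"], rule conjI[OF pos(4)]) (use V(3,4) in blast)
  qed
qed

end
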